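(* Let $\mu$ be a finite positive Borel measure on $\mathbb{D}$, let $0<p\leq 1<q<\infty$ and $-1<\beta\leq\alpha<\infty$. Put $t=\frac{\beta+2}{\alpha+2}$ and let $q'$ be defined by $\frac1q+\frac1{q'}=1$. Then $T_{\mu,\beta}:L_a^p(\omega_\alpha)\to L_a^q(\omega_\beta)$ is compact if and only if $\mu$ is a vanishing $\big(\frac1p+\frac{t}{q'}\big)$-Carleson measure for $L_a^1(\omega_\alpha)$.
   Context: $\mathbb{D}$ is the open unit disk in $\mathbb{C}$ and $dA$ is the normalized area measure on $\mathbb{D}$. For $-1<\alpha<\infty$, $\omega_\alpha(z)=(1+\alpha)(1-|z|^2)^\alpha$. For $0<p<\infty$, the weighted Bergman space $L_a^p(\omega_\alpha)$ consists of the analytic functions $f$ on $\mathbb{D}$ with $\|f\|_{L^p(\omega_\alpha)}:=\big(\int_{\mathbb{D}}|f(z)|^p\omega_\alpha(z)\,dA(z)\big)^{1/p}<\infty$. For a finite positive Borel measure $\mu$ on $\mathbb{D}$ and $\beta>-1$, the Toeplitz operator is $T_{\mu,\beta}(f)(z)=\int_{\mathbb{D}}\frac{f(w)}{(1-z\bar w)^{2+\beta}}\,d\mu(w)$, $z\in\mathbb{D}$. The operator $T_{\mu,\beta}:L_a^p(\omega_\alpha)\to L_a^q(\omega_\beta)$ is called bounded if there is a constant $C$ such that $\|T_{\mu,\beta}(f)\|_{L^q(\omega_\beta)}\leq C\|f\|_{L^p(\omega_\alpha)}$ for all polynomials $f$; in that case, polynomials being dense, $T_{\mu,\beta}$ denotes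 also its continuous extension to $L_a^p(\omega_\alpha)$. Compactness (of a bounded $T_{\mu,\beta}$) with $1\le q<\infty$: if $1\leq p<\infty$, $T_{\mu,\beta}:L_a^p(\omega_\alpha)\to L_a^q(\omega_\beta)$ is compact if for every bounded sequence $\{f_n\}$ in $L_a^p(\omega_\alpha)$ some subsequence of $\{T_{\mu,\beta}(f_n)\}$ converges in $L_a^q(\omega_\beta)$. If $0<p<1$, it is compact if $\lim_{n\to\infty}\|T_{\mu,\beta}(f_n)\|_{L^q(\omega_\beta)}=0$ for every bounded sequence $\{f_n\}$ in $L_a^p(\omega_\alpha)$ that converges to $0$ uniformly on each compact subset of $\mathbb{D}$. For $0<s,p<\infty$ (here $s$ denotes the exponent), a finite positive Borel measure $\mu$ on $\mathbb{D}$ is a vanishing $s$-Carleson measure for $L_a^p(\omega_\alpha)$ if $\lim_{n\to\infty}\int_{\mathbb{D}}|f_n|^s\,d\mu=0$ for every bounded sequence $\{f_n\}$ in $L_a^p(\omega_\alpha)$ that converges to $0$ uniformly on each compact subset of $\mathbb{D}$. *)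

theory Defs
  imports "HOL-Complex_Analysis.Complex_Analysis" "HOL-Computational_Algebra.Polynomial"
begin

abbreviation unit_disk :: "complex set" where
  "unit_disk \<equiv> ball 0 1"

definition disk_area :: "complex measure" where
  "disk_area = scale_measure (ennreal (1 / pi)) (restrict_space lborel unit_disk)"

definition weight :: "real \<Rightarrow> complex \<Rightarrow> real" where
  "weight \<alpha> z = (1 + \<alpha>) * (1 - (cmod z)\<^sup>2) powr \<alpha>"

text \<open>Functions on the disk are represented by functions on \<open>\<complex>\<close> whose values off the disk are
  irrelevant. For a holomorphic integrand, integrability amounts to finiteness of the integral of
  the nonnegative function below.\<close>

definition bergman_space :: "real \<Rightarrow> real \<Rightarrow> (complex \<Rightarrow> complex) set" where
  "bergman_space p \<alpha> =
     {f. f holomorphic_on unit_disk \<and>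
         integrable disk_area (\<lambda>z. cmod (f z) powr p * weight \<alpha> z)}"

text \<open>Only meaningful on \<^const>\<open>bergman_space\<close>: the Bochner integral of a non-integrable function
  is 0. Membership is therefore always required separately.\<close>

definition bergman_norm :: "real \<Rightarrow> real \<Rightarrow> (complex \<Rightarrow> complex) \<Rightarrow> real" where
  "bergman_norm p \<alpha> f =
     (\<integral>z. cmod (f z) powr p * weight \<alpha> z \<partial>disk_area) powr (1 / p)"

definition bergman_bounded_seq :: "real \<Rightarrow> real \<Rightarrow> (nat \<Rightarrow> complex \<Rightarrow> complex) \<Rightarrow> bool" where
  "bergman_bounded_seq p \<alpha> f \<longleftrightarrow>
     (\<forall>n. f n \<in> bergman_space p \<alpha>) \<and> (\<exists>M. \<forall>n. bergman_norm p \<alpha> (f n) \<le> M)"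

definition locally_uniformly_null :: "(nat \<Rightarrow> complex \<Rightarrow> complex) \<Rightarrow> bool" where
  "locally_uniformly_null f \<longleftrightarrow>
     (\<forall>K. compact K \<and> K \<subseteq> unit_disk \<longrightarrow> uniform_limit K f (\<lambda>_. 0) sequentially)"

definition finite_borel_measure_on_disk :: "complex measure \<Rightarrow> bool" where
  "finite_borel_measure_on_disk \<mu> \<longleftrightarrow>
     finite_measure \<mu> \<and> sets \<mu> = sets (restrict_space borel unit_disk)"

text \<open>For \<open>z\<close>, \<open>w\<close> in the disk, \<open>1 - z * cnj w\<close> has positive real part, so the principal branch
  used by \<open>powr\<close> is the holomorphic one with value 1 at \<open>z = 0\<close>.\<close>

definition toeplitz ::
  "complex measure \<Rightarrow> real \<Rightarrow> (complex \<Rightarrow> complex) \<Rightarrow> complex \<Rightarrow> complex" where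
  "toeplitz \<mu> \<beta> f z = (\<integral>w. f w / (1 - z * cnj w) powr complex_of_real (2 + \<beta>) \<partial>\<mu>)"

definition toeplitz_bounded ::
  "complex measure \<Rightarrow> real \<Rightarrow> real \<Rightarrow> real \<Rightarrow> real \<Rightarrow> bool" where
  "toeplitz_bounded \<mu> p \<alpha> q \<beta> \<longleftrightarrow>
     (\<exists>C. \<forall>P. toeplitz \<mu> \<beta> (poly P) \<in> bergman_space q \<beta> \<and>
        bergman_norm q \<beta> (toeplitz \<mu> \<beta> (poly P)) \<le> C * bergman_norm p \<alpha> (poly P))"

text \<open>The continuous extension from the polynomials to the Bergman space. When
  \<^const>\<open>toeplitz_bounded\<close> holds, density of the polynomials and completeness of the target make
  \<open>g\<close> exist and be unique on the disk; the choice only concerns its values off the disk.\<close>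

definition toeplitz_ext ::
  "complex measure \<Rightarrow> real \<Rightarrow> real \<Rightarrow> real \<Rightarrow> real \<Rightarrow> (complex \<Rightarrow> complex) \<Rightarrow> complex \<Rightarrow> complex" where
  "toeplitz_ext \<mu> p \<alpha> q \<beta> f =
     (SOME g. g \<in> bergman_space q \<beta> \<and>
        (\<forall>P :: nat \<Rightarrow> complex poly.
           (\<lambda>n. bergman_norm p \<alpha> (\<lambda>z. poly (P n) z - f z)) \<longlonglongrightarrow> 0 \<longrightarrow>
           (\<lambda>n. bergman_norm q \<beta> (\<lambda>z. toeplitz \<mu> \<beta> (poly (P n)) z - g z)) \<longlonglongrightarrow> 0))"

text \<open>Intended for \<open>1 \<le> q\<close>.\<close>

definition toeplitz_compact ::
  "complex measure \<Rightarrow> real \<Rightarrow> real \<Rightarrow> real \<Rightarrow> real \<Rightarrow> bool" where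
  "toeplitz_compact \<mu> p \<alpha> q \<beta> \<longleftrightarrow>
     toeplitz_bounded \<mu> p \<alpha> q \<beta> \<and>
     (if 1 \<le> p then
        (\<forall>f. bergman_bounded_seq p \<alpha> f \<longrightarrow>
           (\<exists>r g. strict_mono r \<and> g \<in> bergman_space q \<beta> \<and>
              (\<lambda>n. bergman_norm q \<beta> (\<lambda>z. toeplitz_ext \<mu> p \<alpha> q \<beta> (f (r n)) z - g z))
                \<longlonglongrightarrow> 0))
      else
        (\<forall>f. bergman_bounded_seq p \<alpha> f \<and> locally_uniformly_null f \<longrightarrow>
           (\<lambda>n. bergman_norm q \<beta> (toeplitz_ext \<mu> p \<alpha> q \<beta> (f n))) \<longlonglongrightarrow> 0))"

definition vanishing_carleson ::
  "complex measure \<Rightarrow> real \<Rightarrow> real \<Rightarrow> real \<Rightarrow> bool" where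
  "vanishing_carleson \<mu> s p \<alpha> \<longleftrightarrow>
     (\<forall>f. bergman_bounded_seq p \<alpha> f \<and> locally_uniformly_null f \<longrightarrow>
        (\<lambda>n. \<integral>\<^sup>+ w. ennreal (cmod (f n w) powr s) \<partial>\<mu>) \<longlonglongrightarrow> 0)"

end

theory Submission
  imports Defs
begin

text \<open>Both properties are equivalent to the decay, as \<open>z\<close> tends to the unit circle, of
  \<open>(1 - \<bar>z\<bar>\<^sup>2) powr (c - A)\<close> times the integral of \<open>\<bar>1 - w * cnj z\<bar> powr (- c)\<close> over \<open>w\<close> with respect to
  \<open>\<mu>\<close>, where \<open>A = (2 + \<alpha>) / p + (2 + \<beta>) / q'\<close> and \<open>c > A\<close> is some exponent. The exponent of the
  Carleson measure is chosen such that \<open>A = (2 + \<alpha>) * (1 / p + t / q')\<close>.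

  The decay is necessary because normalized powers of the kernel are bounded and tend to 0 locally
  uniformly. In the case of the operator one evaluates a derivative of high order of the image of a
  test function at the point \<open>z\<close>. It is sufficient because the sub-mean value property
  bounds \<open>\<bar>f\<bar> powr p\<close> at a point by an average against the kernel, so that Tonelli's theorem yields
  an embedding theorem, and because Minkowski's inequality bounds the \<open>L\<^sup>q\<close> norm of the image of
  \<open>f\<close> by the integral of \<open>\<bar>f\<bar>\<close> times the \<open>L\<^sup>q\<close> norm of the kernel function. Since \<open>p \<le> 1\<close>, no
  duality is needed. The embedding theorem also gives the density of the polynomials.\<close>

section \<open>Rotation invariance of planar Lebesgue measure\<close>

text \<open>The exponent \<open>A\<close> multiplies two growth rates: functions of norm 1 in the
  source space grow at most like \<open>rho powr (- (2 + \<alpha>) / p)\<close>, and the Toeplitz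
  kernel at \<open>w\<close> has norm of order \<open>rho w powr (- (2 + \<beta>) / q')\<close> in
  the target. The decay condition says that \<open>\<mu>\<close> gives a hyperbolic disk around
  \<open>z\<close> a mass of smaller order than \<open>rho z powr A\<close>; a kernel power with
  free exponent \<open>c\<close> is a smooth substitute for the indicator function of that disk. One
  obstacle is that boundedness of the operator speaks of polynomials only. The test functions
  therefore extend holomorphically across the circle: their Taylor polynomials converge uniformly on
  the closed disk, which identifies the extended operator with the integral. Another is cancellation
  in the Toeplitz integral: the order of the derivative and the exponent of the test function are
  matched so that the integrand becomes nonnegative at the point of evaluation. Rotation invariance
  of area serves twice, in reducing the kernel integrals to a real parameter and in the mean value
  property.\<close>

lemma lborel_complex_eq_distr:
  "(lborel :: complex measure) = distr (lborel \<Otimes>\<^sub>M lborel) borel (\<lambda>(x, y). Complex x y)"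
proof (rule lborel_eqI)
  have meas: "(\<lambda>(x, y). Complex x y) \<in> borel_measurable (lborel \<Otimes>\<^sub>M lborel)"
    unfolding split_beta Complex_eq by measurable
  fix l u :: complex
  assume "\<And>b. b \<in> Basis \<Longrightarrow> l \<bullet> b \<le> u \<bullet> b"
  from this[of 1] this[of \<i>] have le: "Re l \<le> Re u" "Im l \<le> Im u"
    by (auto simp: Basis_complex_def)
  have eq: "(\<lambda>(x, y). Complex x y) -` box l u \<inter> space (lborel \<Otimes>\<^sub>M lborel)
      = {Re l<..<Re u} \<times> {Im l<..<Im u}"
    by (auto simp: box_def Basis_complex_def space_pair_measure)
  show "emeasure (distr (lborel \<Otimes>\<^sub>M lborel) borel (\<lambda>(x, y). Complex x y)) (box l u)
      = (\<Prod>b\<in>Basis. (u - l) \<bullet> b)"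
    using le unfolding emeasure_distr[OF meas, of "box l u", simplified] eq
    by (subst lborel.emeasure_pair_measure_Times)
      (auto simp: Basis_complex_def ennreal_mult complex_eq_iff)
qed simp

text \<open>A shear adds a multiple of one coordinate to the other, and the moved coordinate has to
  be the inner variable of integration; hence both orders.\<close>

lemma nn_integral_lborel_complex:
  fixes F :: "complex \<Rightarrow> ennreal"
  assumes [measurable]: "F \<in> borel_measurable borel"
  shows "(\<integral>\<^sup>+z. F z \<partial>lborel) = (\<integral>\<^sup>+x. \<integral>\<^sup>+y. F (Complex x y) \<partial>lborel \<partial>lborel)"
    and "(\<integral>\<^sup>+z. F z \<partial>lborel) = (\<integral>\<^sup>+y. \<integral>\<^sup>+x. F (Complex x y) \<partial>lborel \<partial>lborel)"
proof -
  have meas: "(\<lambda>(x, y). Complex x y) \<in> borel_measurable (lborel \<Otimes>\<^sub>M lborel)"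
    unfolding split_beta Complex_eq by measurable
  have m2: "(\<lambda>(x, y). F (Complex x y)) \<in> borel_measurable (lborel \<Otimes>\<^sub>M lborel)"
    using measurable_compose[OF meas, of F borel] by (simp add: case_prod_beta')
  have "(\<integral>\<^sup>+z. F z \<partial>lborel) = (\<integral>\<^sup>+z. F (Complex (fst z) (snd z)) \<partial>(lborel \<Otimes>\<^sub>M lborel))"
    by (subst lborel_complex_eq_distr, subst nn_integral_distr[OF meas])
      (simp_all add: case_prod_beta')
  then show "(\<integral>\<^sup>+z. F z \<partial>lborel) = (\<integral>\<^sup>+x. \<integral>\<^sup>+y. F (Complex x y) \<partial>lborel \<partial>lborel)"
    using lborel.nn_integral_fst[OF m2] by (simp add: case_prod_beta')
  then show "(\<integral>\<^sup>+z. F z \<partial>lborel) = (\<integral>\<^sup>+y. \<integral>\<^sup>+x. F (Complex x y) \<partial>lborel \<partial>lborel)"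
    using lborel_pair.Fubini'[OF m2] by simp
qed

lemma nn_integral_lborel_translate:
  fixes F :: "real \<Rightarrow> ennreal"
  assumes "F \<in> borel_measurable borel"
  shows "(\<integral>\<^sup>+x. F (x + t) \<partial>lborel) = (\<integral>\<^sup>+x. F x \<partial>lborel)"
  using nn_integral_real_affine[OF assms, of 1 t] by (simp add: add.commute)

lemma measurable_borel_complex_comp:
  fixes F :: "complex \<Rightarrow> ennreal"
  assumes [measurable]: "F \<in> borel_measurable borel"
    "g \<in> borel_measurable borel" "h \<in> borel_measurable borel"
  shows "(\<lambda>x. F (Complex (g x) (h x))) \<in> borel_measurable borel"
  unfolding Complex_eq by measurable

text \<open>A rotation is a composition of three shears, and shears preserve Lebesgue measure by Fubini
  and translation invariance. The shear parameter \<open>Im c / (1 + Re c)\<close> excludes \<open>c = -1\<close>, which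
  is the square of the rotation by \<open>\<i>\<close>.\<close>

lemma nn_integral_lborel_rotate:
  fixes F :: "complex \<Rightarrow> ennreal"
  assumes [measurable]: "F \<in> borel_measurable borel" and c: "cmod c = 1"
  shows "(\<integral>\<^sup>+z. F (c * z) \<partial>lborel) = (\<integral>\<^sup>+z. F z \<partial>lborel)"
proof -
  have shear1: "(\<integral>\<^sup>+z. G (Complex (Re z + k * Im z) (Im z)) \<partial>lborel) = (\<integral>\<^sup>+z. G z \<partial>lborel)"
    if [measurable]: "G \<in> borel_measurable borel" for G :: "complex \<Rightarrow> ennreal" and k
  proof -
    have [measurable]: "(\<lambda>z. G (Complex (Re z + k * Im z) (Im z))) \<in> borel_measurable borel"
      by (intro measurable_borel_complex_comp) auto
    have "(\<integral>\<^sup>+x. G (Complex (x + k * y) y) \<partial>lborel) = (\<integral>\<^sup>+x. G (Complex x y) \<partial>lborel)" for y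
      by (rule nn_integral_lborel_translate[where F="\<lambda>x. G (Complex x y)"])
        (intro measurable_borel_complex_comp, auto)
    then show ?thesis
      by (simp add: nn_integral_lborel_complex(2))
  qed
  have shear2: "(\<integral>\<^sup>+z. G (Complex (Re z) (Im z + k * Re z)) \<partial>lborel) = (\<integral>\<^sup>+z. G z \<partial>lborel)"
    if [measurable]: "G \<in> borel_measurable borel" for G :: "complex \<Rightarrow> ennreal" and k
  proof -
    have [measurable]: "(\<lambda>z. G (Complex (Re z) (Im z + k * Re z))) \<in> borel_measurable borel"
      by (intro measurable_borel_complex_comp) auto
    have "(\<integral>\<^sup>+y. G (Complex x (y + k * x)) \<partial>lborel) = (\<integral>\<^sup>+y. G (Complex x y) \<partial>lborel)" for x
      by (rule nn_integral_lborel_translate[where F="\<lambda>y. G (Complex x y)"])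
        (intro measurable_borel_complex_comp, auto)
    then show ?thesis
      by (simp add: nn_integral_lborel_complex(1))
  qed
  have rot: "(\<integral>\<^sup>+z. G (c * z) \<partial>lborel) = (\<integral>\<^sup>+z. G z \<partial>lborel)"
    if [measurable]: "G \<in> borel_measurable borel" and c: "cmod c = 1" "c \<noteq> -1"
    for G :: "complex \<Rightarrow> ennreal" and c
  proof -
    \<comment> \<open>For \<open>c = cis \<theta>\<close> this is
      \<open>- tan (\<theta> / 2)\<close>. The rotation shears the first coordinate by
      \<open>t\<close>, then the second by \<open>Im c\<close>, then the first by \<open>t\<close>
      again.\<close>
    define t where "t = - (Im c / (1 + Re c))"
    have sq: "(Re c)\<^sup>2 + (Im c)\<^sup>2 = 1"
      using c by (simp add: cmod_def)
    have ne: "1 + Re c \<noteq> 0"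
    proof
      assume "1 + Re c = 0"
      then have "Re c = -1" by simp
      with sq have "Im c = 0" by simp
      with \<open>Re c = -1\<close> c(2) show False by (simp add: complex_eq_iff)
    qed
    have tb: "1 + t * Im c = Re c" and ta: "t * (1 + Re c) = - Im c"
      using ne sq by (simp_all add: t_def field_simps power2_eq_square)
    define H1 where "H1 z = G (Complex (Re z + t * Im z) (Im z))" for z
    define H2 where "H2 z = H1 (Complex (Re z) (Im z + Im c * Re z))" for z
    have [measurable]: "H1 \<in> borel_measurable borel"
      unfolding H1_def by (intro measurable_borel_complex_comp) auto
    have [measurable]: "H2 \<in> borel_measurable borel"
      unfolding H2_def by (intro measurable_borel_complex_comp) auto
    have "G (c * z) = H2 (Complex (Re z + t * Im z) (Im z))" for z
    proof -
      have 1: "Im z + Im c * (Re z + t * Im z) = Im c * Re z + (1 + t * Im c) * Im z"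
        by (simp add: algebra_simps)
      have 2: "Re z + t * Im z + t * (Im c * Re z + Re c * Im z)
          = (1 + t * Im c) * Re z + (t * (1 + Re c)) * Im z"
        by (simp add: algebra_simps)
      have "c * z = Complex (Re z + t * Im z + t * (Im z + Im c * (Re z + t * Im z)))
          (Im z + Im c * (Re z + t * Im z))"
        unfolding 1 tb 2 ta by (simp add: complex_eq_iff)
      then show ?thesis by (simp add: H1_def H2_def)
    qed
    then have "(\<integral>\<^sup>+z. G (c * z) \<partial>lborel) = (\<integral>\<^sup>+z. H2 z \<partial>lborel)"
      using shear1[of H2 t] by simp
    also have "\<dots> = (\<integral>\<^sup>+z. H1 z \<partial>lborel)"
      unfolding H2_def by (rule shear2) simp
    also have "\<dots> = (\<integral>\<^sup>+z. G z \<partial>lborel)"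
      unfolding H1_def by (rule shear1) simp
    finally show ?thesis .
  qed
  show ?thesis
  proof (cases "c = -1")
    case True
    have "(\<integral>\<^sup>+z. F (c * z) \<partial>lborel) = (\<integral>\<^sup>+z. F (\<i> * (\<i> * z)) \<partial>lborel)"
      by (simp add: True mult.assoc[symmetric])
    also have "\<dots> = (\<integral>\<^sup>+z. F (\<i> * z) \<partial>lborel)"
      by (rule rot[where G="\<lambda>z. F (\<i> * z)"]) (auto simp: complex_eq_iff)
    also have "\<dots> = (\<integral>\<^sup>+z. F z \<partial>lborel)"
      by (rule rot) (auto simp: complex_eq_iff)
    finally show ?thesis .
  qed (use rot c in auto)
qed

section \<open>Integrals of the kernel over the disk\<close>

definition rho :: "complex \<Rightarrow> real" where
  "rho z = 1 - (cmod z)\<^sup>2"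

lemma rho_pos: "z \<in> unit_disk \<Longrightarrow> 0 < rho z"
  by (simp add: rho_def abs_square_less_1)

lemma rho_le_1: "rho z \<le> 1"
  by (simp add: rho_def)

lemma rho_measurable [measurable]: "rho \<in> borel_measurable borel"
  unfolding rho_def by measurable

lemma weight_eq: "weight \<alpha> z = (1 + \<alpha>) * rho z powr \<alpha>"
  by (simp add: weight_def rho_def)

text \<open>In \<open>rho z = (1 - cmod z) * (1 + cmod z)\<close> the second factor lies between 1
  and 2, so powers of \<open>rho\<close> and of the distance to the circle are interchangeable up to
  constants.\<close>

lemma rho_bounds:
  assumes "z \<in> unit_disk"
  shows "1 - cmod z \<le> rho z" "rho z \<le> 2 * (1 - cmod z)"
proof -
  have eq: "rho z = (1 - cmod z) * (1 + cmod z)"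
    by (simp add: rho_def power2_eq_square algebra_simps)
  have "(1 - cmod z) * 1 \<le> (1 - cmod z) * (1 + cmod z)"
    "(1 - cmod z) * (1 + cmod z) \<le> (1 - cmod z) * 2"
    using assms by (intro mult_left_mono; simp)+
  then show "1 - cmod z \<le> rho z" "rho z \<le> 2 * (1 - cmod z)"
    by (auto simp: eq)
qed

lemma space_disk_area [simp]: "space disk_area = unit_disk"
  by (simp add: disk_area_def space_scale_measure space_restrict_space)

lemma sets_disk_area [measurable_cong]: "sets disk_area = sets (restrict_space borel unit_disk)"
  by (simp add: disk_area_def sets_restrict_space)

lemma nn_integral_disk_area:
  assumes "F \<in> borel_measurable (restrict_space borel unit_disk)"
  shows "(\<integral>\<^sup>+z. F z \<partial>disk_area) = ennreal (1 / pi) * (\<integral>\<^sup>+z. F z * indicator unit_disk z \<partial>lborel)"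
proof -
  have "F \<in> borel_measurable (restrict_space lborel unit_disk)"
    using assms by (simp cong: measurable_cong_sets)
  then show ?thesis
    unfolding disk_area_def by (simp add: nn_integral_scale_measure nn_integral_restrict_space)
qed

lemma disk_area_measurableI:
  "f \<in> borel_measurable borel \<Longrightarrow> f \<in> borel_measurable disk_area"
  by (simp add: measurable_restrict_space1 sets_disk_area cong: measurable_cong_sets)

lemma emeasure_disk_area_finite: "emeasure disk_area (space disk_area) < \<infinity>"
proof -
  have "emeasure disk_area (space disk_area) = (\<integral>\<^sup>+z. 1 \<partial>disk_area)"
    by simp
  also have "\<dots> = ennreal (1 / pi) * emeasure lborel unit_disk"
    by (subst nn_integral_disk_area) simp_all
  also have "\<dots> < \<infinity>"
    using emeasure_bounded_finite[of unit_disk] by (simp add: ennreal_mult_less_top)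
  finally show ?thesis .
qed

interpretation disk_area: finite_measure disk_area
  by standard (use emeasure_disk_area_finite in auto)

text \<open>The power of \<open>\<epsilon>\<close> is the one dictated by scaling; the hypotheses
  express convergence at 0 and at infinity. The integral is split at \<open>u = \<epsilon>\<close>,
  and in each range \<open>\<epsilon> + u\<close> is replaced by its larger summand, which gives the
  two terms of the constant.\<close>

lemma powr_kernel_integral_real:
  fixes \<beta> c :: real
  assumes "-1 < \<beta>" "1 + \<beta> < c"
  shows "\<exists>C\<ge>0. \<forall>\<epsilon>>0. (\<integral>\<^sup>+u. ennreal (u powr \<beta> * (\<epsilon> + u) powr (- c) * indicator {0<..} u) \<partial>lborel)
    \<le> ennreal (C * \<epsilon> powr (1 + \<beta> - c))"
proof (intro exI conjI allI impI)
  let ?C = "1 / (1 + \<beta>) + 1 / (c - 1 - \<beta>)"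
  show "0 \<le> ?C" using assms by simp
  fix \<epsilon> :: real assume \<epsilon>: "\<epsilon> > 0"
  have int1: "(\<integral>\<^sup>+u. ennreal (indicator {0..\<epsilon>} u * u powr \<beta>) \<partial>lborel)
      = ennreal (\<epsilon> powr (1 + \<beta>) / (1 + \<beta>))"
    using nn_integral_has_integral_lebesgue[OF _ has_integral_powr_from_0[of \<beta> \<epsilon>]] assms \<epsilon>
    by (simp add: add.commute)
  have int2: "(\<integral>\<^sup>+u. ennreal (indicator {\<epsilon>..} u * u powr (\<beta> - c)) \<partial>lborel)
      = ennreal (\<epsilon> powr (1 + \<beta> - c) / (c - 1 - \<beta>))"
  proof -
    have "- (\<epsilon> powr (\<beta> - c + 1)) / (\<beta> - c + 1) = \<epsilon> powr (1 + \<beta> - c) / (c - 1 - \<beta>)"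
      using assms by (simp add: field_simps)
    then show ?thesis
      using nn_integral_has_integral_lebesgue[OF _ has_integral_powr_to_inf[of "\<beta> - c" \<epsilon>]] assms \<epsilon>
      by simp
  qed
  have "(\<integral>\<^sup>+u. ennreal (u powr \<beta> * (\<epsilon> + u) powr (- c) * indicator {0<..} u) \<partial>lborel)
      \<le> (\<integral>\<^sup>+u. ennreal (\<epsilon> powr (- c)) * ennreal (indicator {0..\<epsilon>} u * u powr \<beta>)
          + ennreal (indicator {\<epsilon>..} u * u powr (\<beta> - c)) \<partial>lborel)"
  proof (rule nn_integral_mono)
    fix u :: real
    show "ennreal (u powr \<beta> * (\<epsilon> + u) powr (- c) * indicator {0<..} u)
      \<le> ennreal (\<epsilon> powr (- c)) * ennreal (indicator {0..\<epsilon>} u * u powr \<beta>)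
          + ennreal (indicator {\<epsilon>..} u * u powr (\<beta> - c))"
    proof (cases "u > 0")
      case True
      show ?thesis
      proof (cases "u \<le> \<epsilon>")
        case le: True
        have "(\<epsilon> + u) powr (- c) \<le> \<epsilon> powr (- c)"
          using \<epsilon> True assms by (intro powr_mono2') auto
        then have "u powr \<beta> * (\<epsilon> + u) powr (- c) \<le> \<epsilon> powr (- c) * u powr \<beta>"
          using mult_left_mono[of "(\<epsilon> + u) powr (- c)" "\<epsilon> powr (- c)" "u powr \<beta>"]
          by (simp add: mult.commute)
        then have "ennreal (u powr \<beta> * (\<epsilon> + u) powr (- c))
            \<le> ennreal (\<epsilon> powr (- c)) * ennreal (u powr \<beta>)"
          by (simp add: ennreal_mult[symmetric])
        then show ?thesis
          using True le by (intro order_trans[OF _ add_increasing2[OF zero_le order_refl]]) simp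
      next
        case False
        have "(\<epsilon> + u) powr (- c) \<le> u powr (- c)"
          using \<epsilon> True assms by (intro powr_mono2') auto
        then have "u powr \<beta> * (\<epsilon> + u) powr (- c) \<le> u powr (\<beta> - c)"
          by (simp add: powr_diff powr_minus divide_inverse mult_left_mono)
        then show ?thesis
          using True False by simp
      qed
    qed simp
  qed
  also have "\<dots> = ennreal (\<epsilon> powr (- c)) * ennreal (\<epsilon> powr (1 + \<beta>) / (1 + \<beta>))
      + ennreal (\<epsilon> powr (1 + \<beta> - c) / (c - 1 - \<beta>))"
    by (subst nn_integral_add) (simp_all add: nn_integral_cmult int1 int2)
  also have "\<dots> = ennreal (\<epsilon> powr (1 + \<beta> - c) / (1 + \<beta>) + \<epsilon> powr (1 + \<beta> - c) / (c - 1 - \<beta>))"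
  proof -
    have "\<epsilon> powr (- c) * (\<epsilon> powr (1 + \<beta>) / (1 + \<beta>)) = \<epsilon> powr (1 + \<beta> - c) / (1 + \<beta>)"
    proof -
      have "\<epsilon> powr (- c) * \<epsilon> powr (1 + \<beta>) = \<epsilon> powr (1 + \<beta> - c)"
        unfolding powr_add[symmetric] by (rule arg_cong) simp
      then show ?thesis by simp
    qed
    then show ?thesis
      using assms by (simp add: ennreal_mult[symmetric] ennreal_plus[symmetric] del: ennreal_plus)
  qed
  also have "\<dots> = ennreal (?C * \<epsilon> powr (1 + \<beta> - c))"
    by (simp add: algebra_simps)
  finally show "(\<integral>\<^sup>+u. ennreal (u powr \<beta> * (\<epsilon> + u) powr (- c) * indicator {0<..} u) \<partial>lborel)
    \<le> ennreal (?C * \<epsilon> powr (1 + \<beta> - c))" .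
qed

text \<open>\<open>X - \<bar>x\<bar>\<close> takes each value at most twice, with slope 1 or -1. In
  use, the two signs are the two ends of a chord of the disk.\<close>

lemma nn_integral_abs_le:
  fixes F :: "real \<Rightarrow> ennreal"
  assumes [measurable]: "F \<in> borel_measurable borel"
  shows "(\<integral>\<^sup>+x. F (X - \<bar>x\<bar>) \<partial>lborel) \<le> 2 * (\<integral>\<^sup>+x. F x \<partial>lborel)"
proof -
  have "(\<integral>\<^sup>+x. F (X - \<bar>x\<bar>) \<partial>lborel) \<le> (\<integral>\<^sup>+x. F (X + 1 * x) + F (X + (-1) * x) \<partial>lborel)"
    by (intro nn_integral_mono) (auto simp: abs_if)
  also have "\<dots> = (\<integral>\<^sup>+x. F (X + 1 * x) \<partial>lborel) + (\<integral>\<^sup>+x. F (X + (-1) * x) \<partial>lborel)"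
    by (rule nn_integral_add) auto
  also have "\<dots> = 2 * (\<integral>\<^sup>+x. F x \<partial>lborel)"
    using nn_integral_real_affine[OF assms, of 1 X] nn_integral_real_affine[OF assms, of "-1" X]
    by (simp add: mult_2)
  finally show ?thesis .
qed

text \<open>The absolute value in the exponent of \<open>M\<close> covers increasing and decreasing
  powers at once.\<close>

lemma powr_le_comparable:
  fixes x y \<gamma> M :: real
  assumes "0 < x" "0 < y" "1 \<le> M" "x \<le> M * y" "y \<le> M * x"
  shows "x powr \<gamma> \<le> M powr \<bar>\<gamma>\<bar> * y powr \<gamma>"
proof (cases "\<gamma> \<ge> 0")
  case True
  have "x powr \<gamma> \<le> (M * y) powr \<gamma>"
    using assms True by (intro powr_mono2) auto
  then show ?thesis using assms True by (simp add: powr_mult)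
next
  case False
  have "x powr \<gamma> \<le> (y / M) powr \<gamma>"
    using assms False by (intro powr_mono2') (auto simp: field_simps)
  also have "\<dots> = y powr \<gamma> / M powr \<gamma>"
    using assms by (simp add: powr_divide)
  also have "\<dots> = M powr \<bar>\<gamma>\<bar> * y powr \<gamma>"
    using False by (simp add: powr_minus field_simps)
  finally show ?thesis .
qed

text \<open>In a strip \<open>\<bar>v\<bar> \<le> 3/4\<close> the weight is comparable to the horizontal distance
  \<open>sqrt (1 - v\<^sup>2) - \<bar>u\<bar>\<close> to the circle; every point of the disk lies in this strip or in the
  one with the coordinates exchanged.\<close>

lemma strip_comparison:
  fixes u v :: real
  assumes "u\<^sup>2 + v\<^sup>2 < 1" "\<bar>v\<bar> \<le> 3/4"
  defines "s \<equiv> sqrt (1 - v\<^sup>2) - \<bar>u\<bar>"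
  shows "0 < s" "s \<le> 1" "s \<le> 2 * (1 - (u\<^sup>2 + v\<^sup>2))" "1 - (u\<^sup>2 + v\<^sup>2) \<le> 2 * s"
proof -
  let ?X = "sqrt (1 - v\<^sup>2)"
  have v2: "v\<^sup>2 \<le> (3/4)\<^sup>2"
    using power_mono[OF assms(2), of 2] by simp
  have X2: "?X\<^sup>2 = 1 - v\<^sup>2"
    using assms(1) zero_le_power2[of u] by (intro real_sqrt_pow2) linarith
  have "\<bar>u\<bar> = sqrt (u\<^sup>2)" by simp
  also have "\<dots> < ?X" using assms(1) by (intro real_sqrt_less_mono) simp
  finally show pos: "0 < s" by (simp add: s_def)
  have X1: "?X \<le> 1" by simp
  then show "s \<le> 1" unfolding s_def using abs_ge_zero[of u] by linarith
  \<comment> \<open>The bound \<open>3/4\<close> is large enough for two perpendicular strips to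
    cover the disk and small enough to keep the half-chord \<open>?X\<close> away from 0.\<close>
  have half: "1/2 \<le> ?X"
    using v2 by (intro real_le_rsqrt) (simp add: power2_eq_square)
  have eq: "1 - (u\<^sup>2 + v\<^sup>2) = s * (?X + \<bar>u\<bar>)"
    using X2 by (simp add: s_def power2_eq_square algebra_simps)
  have "s * (1/2) \<le> s * (?X + \<bar>u\<bar>)"
    using pos half by (intro mult_left_mono) auto
  then show "s \<le> 2 * (1 - (u\<^sup>2 + v\<^sup>2))" unfolding eq by simp
  have "?X + \<bar>u\<bar> \<le> 2"
    using pos X1 unfolding s_def by linarith
  then have "s * (?X + \<bar>u\<bar>) \<le> s * 2"
    using pos by (intro mult_left_mono) auto
  then show "1 - (u\<^sup>2 + v\<^sup>2) \<le> 2 * s" unfolding eq by simp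
qed

text \<open>Up to constants \<open>d\<close> dominates \<open>1 - a\<close>,
  \<open>1 - cmod z\<close> and \<open>\<bar>y\<bar>\<close>, hence also
  \<open>1 - a + \<bar>y\<bar>\<close> and, in the strip, \<open>1 - a\<close> plus the horizontal
  distance to the circle. Splitting the exponent between the last two separates the variables, so
  that one-dimensional integrals remain. Outside the strip \<open>\<bar>y\<bar>\<close> bounds
  \<open>d\<close> away from 0, and the coordinates may be exchanged freely.\<close>

lemma kernel_pointwise_bound:
  fixes x y a \<beta> c1 c2 :: real
  assumes xy: "x\<^sup>2 + y\<^sup>2 < 1" and a: "0 \<le> a" "a < 1"
    and c: "0 \<le> c1" "0 \<le> c2"
  defines "d \<equiv> cmod (1 - Complex x y * of_real a)"
    and "\<Phi> \<equiv> \<lambda>u. u powr \<beta> * (1 - a + u) powr (- c1) * indicator {0<..} u :: real"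
    and "\<Psi> \<equiv> \<lambda>v. (1 - a + \<bar>v\<bar>) powr (- c2)"
  shows "(1 - (x\<^sup>2 + y\<^sup>2)) powr \<beta> * d powr (- (c1 + c2))
    \<le> 2 powr \<bar>\<beta>\<bar> * 8 powr (c1 + c2) *
      (\<Phi> (sqrt (1 - y\<^sup>2) - \<bar>x\<bar>) * \<Psi> y + \<Phi> (sqrt (1 - x\<^sup>2) - \<bar>y\<bar>) * \<Psi> x)"
proof -
  define z where "z = Complex x y"
  have cz2: "(cmod z)\<^sup>2 = x\<^sup>2 + y\<^sup>2" by (simp add: z_def cmod_def)
  have cz: "cmod z < 1"
    using cz2 xy by (metis abs_norm_cancel abs_square_less_1)
  have "1 - a * cmod z \<le> d"
    using norm_triangle_ineq2[of 1 "z * of_real a"] a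
    by (simp add: d_def z_def norm_mult mult.commute)
  moreover have "a * cmod z \<le> a * 1" "a * cmod z \<le> 1 * cmod z"
    using mult_left_mono[of "cmod z" 1 a] mult_right_mono[of a 1 "cmod z"] a cz norm_ge_zero[of z]
    by linarith+
  ultimately have d1: "1 - a \<le> d" and d2: "1 - cmod z \<le> d" by auto
  have d_pos: "0 < d" using d1 a by simp
  \<comment> \<open>The imaginary part of \<open>1 - z * a\<close> has modulus
    \<open>a * \<bar>y\<bar>\<close>, which is of no use for small \<open>a\<close>; there
    \<open>1 - a\<close> is large instead.\<close>
  have d3: "\<bar>y\<bar> \<le> 2 * d"
  proof (cases "a \<ge> 1/2")
    case True
    have "\<bar>Im (1 - Complex x y * of_real a)\<bar> \<le> d" unfolding d_def by (rule abs_Im_le_cmod)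
    then have "\<bar>y\<bar> * a \<le> d" using a by (simp add: abs_mult)
    moreover have "\<bar>y\<bar> * (1/2) \<le> \<bar>y\<bar> * a" using True by (intro mult_left_mono) auto
    ultimately show ?thesis by simp
  next
    case False
    have "y\<^sup>2 \<le> 1" using xy zero_le_power2[of x] by linarith
    then have "\<bar>y\<bar> \<le> 1" by (simp add: abs_square_le_1)
    with False d1 show ?thesis by simp
  qed
  have gen: "(1 - (x\<^sup>2 + y\<^sup>2)) powr \<beta> * d powr (- (c1 + c2))
      \<le> 2 powr \<bar>\<beta>\<bar> * 8 powr (c1 + c2) * (\<Phi> (sqrt (1 - v\<^sup>2) - \<bar>u\<bar>) * \<Psi> v)"
    if uv: "u\<^sup>2 + v\<^sup>2 = x\<^sup>2 + y\<^sup>2" "\<bar>v\<bar> \<le> 3/4"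
      and du: "1 - a + (sqrt (1 - v\<^sup>2) - \<bar>u\<bar>) \<le> 8 * d" and dv: "1 - a + \<bar>v\<bar> \<le> 8 * d" for u v
  proof -
    define s where "s = sqrt (1 - v\<^sup>2) - \<bar>u\<bar>"
    note s = strip_comparison[of u v, folded s_def, unfolded uv(1), OF xy uv(2)]
    have "(1 - (x\<^sup>2 + y\<^sup>2)) powr \<beta> \<le> 2 powr \<bar>\<beta>\<bar> * s powr \<beta>"
      using s xy by (intro powr_le_comparable) auto
    moreover have "(8 * d) powr (- c1) \<le> (1 - a + s) powr (- c1)"
      using du s(1) a c by (intro powr_mono2') (auto simp: s_def)
    moreover have "(8 * d) powr (- c2) \<le> \<Psi> v"
      unfolding \<Psi>_def using dv a c by (intro powr_mono2') auto
    ultimately have "(1 - (x\<^sup>2 + y\<^sup>2)) powr \<beta> * ((8 * d) powr (- c1) * (8 * d) powr (- c2))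
        \<le> (2 powr \<bar>\<beta>\<bar> * s powr \<beta>) * ((1 - a + s) powr (- c1) * \<Psi> v)"
      by (intro mult_mono) (auto simp: \<Psi>_def)
    moreover have "d powr (- (c1 + c2))
        = 8 powr (c1 + c2) * ((8 * d) powr (- c1) * (8 * d) powr (- c2))"
      using d_pos by (simp add: powr_add[symmetric] powr_mult powr_minus field_simps)
    ultimately have "(1 - (x\<^sup>2 + y\<^sup>2)) powr \<beta> * d powr (- (c1 + c2))
        \<le> 8 powr (c1 + c2) * ((2 powr \<bar>\<beta>\<bar> * s powr \<beta>) * ((1 - a + s) powr (- c1) * \<Psi> v))"
      by (simp add: mult_ac)
    then show ?thesis
      using s(1) by (simp add: \<Phi>_def s_def[symmetric] mult_ac)
  qed
  have nn: "0 \<le> \<Phi> u * \<Psi> v" for u v by (simp add: \<Phi>_def \<Psi>_def)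
  show ?thesis
  proof (cases "\<bar>y\<bar> \<le> 3/4")
    case True
    note s = strip_comparison[of x y, OF xy True]
    have "sqrt (1 - y\<^sup>2) - \<bar>x\<bar> \<le> 4 * (1 - cmod z)"
      using s(3) rho_bounds(2)[of z] cz cz2 by (simp add: rho_def)
    also have "\<dots> \<le> 4 * d" using d2 by simp
    finally have "sqrt (1 - y\<^sup>2) - \<bar>x\<bar> \<le> 4 * d" .
    then have "(1 - (x\<^sup>2 + y\<^sup>2)) powr \<beta> * d powr (- (c1 + c2))
      \<le> 2 powr \<bar>\<beta>\<bar> * 8 powr (c1 + c2) * (\<Phi> (sqrt (1 - y\<^sup>2) - \<bar>x\<bar>) * \<Psi> y)"
      using d1 d3 d_pos by (intro gen True) auto
    also have "\<dots> \<le> 2 powr \<bar>\<beta>\<bar> * 8 powr (c1 + c2) *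
      (\<Phi> (sqrt (1 - y\<^sup>2) - \<bar>x\<bar>) * \<Psi> y + \<Phi> (sqrt (1 - x\<^sup>2) - \<bar>y\<bar>) * \<Psi> x)"
      using nn by (intro mult_left_mono) auto
    finally show ?thesis .
  next
    case False
    have "(3/4)\<^sup>2 \<le> \<bar>y\<bar>\<^sup>2" using False by (intro power_mono) auto
    then have "\<bar>x\<bar>\<^sup>2 \<le> (3/4)\<^sup>2" using xy by (simp add: power2_eq_square)
    then have x: "\<bar>x\<bar> \<le> 3/4" by (rule power2_le_imp_le) simp
    have xy': "y\<^sup>2 + x\<^sup>2 < 1" using xy by simp
    note s = strip_comparison[of y x, OF xy' x]
    have "(1 - (x\<^sup>2 + y\<^sup>2)) powr \<beta> * d powr (- (c1 + c2))
      \<le> 2 powr \<bar>\<beta>\<bar> * 8 powr (c1 + c2) * (\<Phi> (sqrt (1 - x\<^sup>2) - \<bar>y\<bar>) * \<Psi> x)"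
      using d3 False a x s(2) by (intro gen) auto
    also have "\<dots> \<le> 2 powr \<bar>\<beta>\<bar> * 8 powr (c1 + c2) *
      (\<Phi> (sqrt (1 - y\<^sup>2) - \<bar>x\<bar>) * \<Psi> y + \<Phi> (sqrt (1 - x\<^sup>2) - \<bar>y\<bar>) * \<Psi> x)"
      using nn by (intro mult_left_mono) auto
    finally show ?thesis .
  qed
qed


lemma kernel_integral_real_parameter:
  fixes \<beta> c :: real
  assumes "-1 < \<beta>" "2 + \<beta> < c"
  shows "\<exists>C\<ge>0. \<forall>a. 0 \<le> a \<and> a < 1 \<longrightarrow>
    (\<integral>\<^sup>+z. ennreal (rho z powr \<beta> * cmod (1 - z * of_real a) powr (- c)) * indicator unit_disk z \<partial>lborel)
    \<le> ennreal (C * (1 - a) powr (2 + \<beta> - c))"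
proof -
  \<comment> \<open>The excess of \<open>c\<close> over the critical value
    \<open>2 + \<beta>\<close> is shared equally: the integral against \<open>u powr \<beta>\<close>
    needs an exponent above \<open>1 + \<beta>\<close>, the one without weight needs an exponent
    above 1.\<close>
  define \<delta> where "\<delta> = (c - 2 - \<beta>) / 2"
  define c1 where "c1 = 1 + \<beta> + \<delta>"
  define c2 where "c2 = 1 + \<delta>"
  have \<delta>: "\<delta> > 0" and c12: "c = c1 + c2" "0 \<le> c1" "0 \<le> c2" "1 + \<beta> < c1" "1 + 0 < c2"
    using assms by (auto simp: \<delta>_def c1_def c2_def field_simps)
  obtain C1 where C1: "C1 \<ge> 0"
    "\<And>\<epsilon>. \<epsilon> > 0 \<Longrightarrow> (\<integral>\<^sup>+u. ennreal (u powr \<beta> * (\<epsilon> + u) powr (- c1) * indicator {0<..} u) \<partial>lborel)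
      \<le> ennreal (C1 * \<epsilon> powr (1 + \<beta> - c1))"
    using powr_kernel_integral_real[OF assms(1) c12(4)] by blast
  obtain C2 where C2: "C2 \<ge> 0"
    "\<And>\<epsilon>. \<epsilon> > 0 \<Longrightarrow> (\<integral>\<^sup>+u. ennreal (u powr 0 * (\<epsilon> + u) powr (- c2) * indicator {0<..} u) \<partial>lborel)
      \<le> ennreal (C2 * \<epsilon> powr (1 + 0 - c2))"
    using powr_kernel_integral_real[of 0 c2] c12(5) by auto
  define M where "M = 2 powr \<bar>\<beta>\<bar> * 8 powr (c1 + c2)"
  have M0: "M \<ge> 0" by (simp add: M_def)
  show ?thesis
  proof (intro exI conjI allI impI)
    show "0 \<le> M * (2 * (2 * C1 * (2 * C2)))" using C1 C2 M0 by simp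
    fix a :: real assume a: "0 \<le> a \<and> a < 1"
    define \<epsilon> where "\<epsilon> = 1 - a"
    have \<epsilon>: "\<epsilon> > 0" using a by (simp add: \<epsilon>_def)
    define \<Phi> where "\<Phi> u = u powr \<beta> * (\<epsilon> + u) powr (- c1) * indicator {0<..} u" for u :: real
    define \<Psi> where "\<Psi> v = (\<epsilon> + \<bar>v\<bar>) powr (- c2)" for v :: real
    have [measurable]: "\<Phi> \<in> borel_measurable borel" "\<Psi> \<in> borel_measurable borel"
      unfolding \<Phi>_def \<Psi>_def by measurable
    have nn: "0 \<le> \<Phi> u" "0 \<le> \<Psi> u" for u by (simp_all add: \<Phi>_def \<Psi>_def)
    have int\<Phi>: "(\<integral>\<^sup>+u. ennreal (\<Phi> (X - \<bar>u\<bar>)) \<partial>lborel) \<le> ennreal (2 * C1 * \<epsilon> powr (1 + \<beta> - c1))" for X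
    proof -
      have "(\<integral>\<^sup>+u. ennreal (\<Phi> (X - \<bar>u\<bar>)) \<partial>lborel) \<le> 2 * (\<integral>\<^sup>+u. ennreal (\<Phi> u) \<partial>lborel)"
        by (rule nn_integral_abs_le[where F="\<lambda>u. ennreal (\<Phi> u)"]) measurable
      also have "\<dots> \<le> 2 * ennreal (C1 * \<epsilon> powr (1 + \<beta> - c1))"
        using C1(2)[OF \<epsilon>] unfolding \<Phi>_def by (intro mult_left_mono) auto
      also have "\<dots> = ennreal (2 * C1 * \<epsilon> powr (1 + \<beta> - c1))"
        using C1(1) by (simp add: ennreal_mult' mult.assoc)
      finally show ?thesis .
    qed
    have int\<Psi>: "(\<integral>\<^sup>+v. ennreal (\<Psi> v) \<partial>lborel) \<le> ennreal (2 * C2 * \<epsilon> powr (1 - c2))"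
    proof -
      let ?G = "\<lambda>u. ennreal ((\<epsilon> + u) powr (- c2) * indicator {0<..} u)"
      \<comment> \<open>The half-line integrand vanishes at 0 while \<open>\<Psi>\<close> does not,
        so the comparison holds off a null set.\<close>
      have "AE v in lborel. v \<noteq> (0::real)"
        by (rule AE_lborel_singleton)
      then have "(\<integral>\<^sup>+v. ennreal (\<Psi> v) \<partial>lborel) \<le> (\<integral>\<^sup>+v. ?G (0 + 1 * v) + ?G (0 + (-1) * v) \<partial>lborel)"
        by (intro nn_integral_mono_AE) (auto simp: \<Psi>_def abs_if)
      also have "\<dots> = (\<integral>\<^sup>+v. ?G (0 + 1 * v) \<partial>lborel) + (\<integral>\<^sup>+v. ?G (0 + (-1) * v) \<partial>lborel)"
        by (rule nn_integral_add) auto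
      also have "\<dots> = 2 * (\<integral>\<^sup>+v. ?G v \<partial>lborel)"
        using nn_integral_real_affine[of ?G 1 0] nn_integral_real_affine[of ?G "-1" 0]
        by (simp add: mult_2)
      also have "(\<integral>\<^sup>+v. ?G v \<partial>lborel) = (\<integral>\<^sup>+u. ennreal (u powr 0 * (\<epsilon> + u) powr (- c2) * indicator {0<..} u) \<partial>lborel)"
        by (intro nn_integral_cong) (auto simp: indicator_def)
      also have "2 * \<dots> \<le> 2 * ennreal (C2 * \<epsilon> powr (1 + 0 - c2))"
        using C2(2)[OF \<epsilon>] by (intro mult_left_mono) auto
      also have "\<dots> = ennreal (2 * C2 * \<epsilon> powr (1 - c2))"
        using C2(1) by (simp add: ennreal_mult' mult.assoc)
      finally show ?thesis .
    qed
    have iter: "(\<integral>\<^sup>+y. \<integral>\<^sup>+x. ennreal (\<Phi> (sqrt (1 - y\<^sup>2) - \<bar>x\<bar>) * \<Psi> y) \<partial>lborel \<partial>lborel)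
        \<le> ennreal (2 * C1 * (2 * C2) * \<epsilon> powr (2 + \<beta> - c))"
    proof -
      have "(\<integral>\<^sup>+x. ennreal (\<Phi> (sqrt (1 - y\<^sup>2) - \<bar>x\<bar>) * \<Psi> y) \<partial>lborel)
          \<le> ennreal (2 * C1 * \<epsilon> powr (1 + \<beta> - c1)) * ennreal (\<Psi> y)" for y
        using mult_right_mono[OF int\<Phi>[of "sqrt (1 - y\<^sup>2)"], of "ennreal (\<Psi> y)"] nn
        by (simp add: ennreal_mult nn_integral_multc)
      then have "(\<integral>\<^sup>+y. \<integral>\<^sup>+x. ennreal (\<Phi> (sqrt (1 - y\<^sup>2) - \<bar>x\<bar>) * \<Psi> y) \<partial>lborel \<partial>lborel)
          \<le> (\<integral>\<^sup>+y. ennreal (2 * C1 * \<epsilon> powr (1 + \<beta> - c1)) * ennreal (\<Psi> y) \<partial>lborel)"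
        by (intro nn_integral_mono)
      also have "\<dots> = ennreal (2 * C1 * \<epsilon> powr (1 + \<beta> - c1)) * (\<integral>\<^sup>+y. ennreal (\<Psi> y) \<partial>lborel)"
        by (rule nn_integral_cmult) measurable
      also have "\<dots> \<le> ennreal (2 * C1 * \<epsilon> powr (1 + \<beta> - c1)) * ennreal (2 * C2 * \<epsilon> powr (1 - c2))"
        by (intro mult_left_mono int\<Psi>) simp
      also have "\<dots> = ennreal (2 * C1 * (2 * C2) * (\<epsilon> powr (1 + \<beta> - c1) * \<epsilon> powr (1 - c2)))"
        using C1(1) C2(1) by (simp add: ennreal_mult[symmetric] mult_ac)
      also have "\<epsilon> powr (1 + \<beta> - c1) * \<epsilon> powr (1 - c2) = \<epsilon> powr (2 + \<beta> - c)"
        unfolding powr_add[symmetric] using c12(1) by (simp add: algebra_simps)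
      finally show ?thesis .
    qed
    let ?F = "\<lambda>z. ennreal (rho z powr \<beta> * cmod (1 - z * of_real a) powr (- c)) * indicator unit_disk z"
    define G1 where "G1 z = ennreal (\<Phi> (sqrt (1 - (Im z)\<^sup>2) - \<bar>Re z\<bar>) * \<Psi> (Im z))" for z
    define G2 where "G2 z = ennreal (\<Phi> (sqrt (1 - (Re z)\<^sup>2) - \<bar>Im z\<bar>) * \<Psi> (Re z))" for z
    have [measurable]: "G1 \<in> borel_measurable borel" "G2 \<in> borel_measurable borel"
      unfolding G1_def G2_def by measurable
    have pw: "?F z \<le> ennreal M * (G1 z + G2 z)" for z
    proof (cases "z \<in> unit_disk")
      case True
      have cz: "(cmod z)\<^sup>2 = (Re z)\<^sup>2 + (Im z)\<^sup>2" by (simp add: cmod_def)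
      have "(cmod z)\<^sup>2 < 1" using True by (simp add: abs_square_less_1)
      with cz have lt: "(Re z)\<^sup>2 + (Im z)\<^sup>2 < 1" by simp
      have "rho z powr \<beta> * cmod (1 - z * of_real a) powr (- c)
          \<le> M * (\<Phi> (sqrt (1 - (Im z)\<^sup>2) - \<bar>Re z\<bar>) * \<Psi> (Im z)
              + \<Phi> (sqrt (1 - (Re z)\<^sup>2) - \<bar>Im z\<bar>) * \<Psi> (Re z))"
        using kernel_pointwise_bound[OF lt, of a c1 c2 \<beta>] a c12
        unfolding M_def \<Phi>_def \<Psi>_def \<epsilon>_def by (simp add: rho_def cz)
      then have "?F z \<le> ennreal (M * (\<Phi> (sqrt (1 - (Im z)\<^sup>2) - \<bar>Re z\<bar>) * \<Psi> (Im z)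
              + \<Phi> (sqrt (1 - (Re z)\<^sup>2) - \<bar>Im z\<bar>) * \<Psi> (Re z)))"
        using True by (simp add: ennreal_leI)
      also have "\<dots> = ennreal M * (G1 z + G2 z)"
        unfolding G1_def G2_def using nn M0 by (simp add: ennreal_mult)
      finally show ?thesis .
    qed simp
    have "(\<integral>\<^sup>+z. ?F z \<partial>lborel) \<le> (\<integral>\<^sup>+z. ennreal M * (G1 z + G2 z) \<partial>lborel)"
      by (intro nn_integral_mono pw)
    also have "\<dots> = ennreal M * ((\<integral>\<^sup>+z. G1 z \<partial>lborel) + (\<integral>\<^sup>+z. G2 z \<partial>lborel))"
      by (simp add: nn_integral_cmult nn_integral_add)
    also have "(\<integral>\<^sup>+z. G1 z \<partial>lborel) = (\<integral>\<^sup>+y. \<integral>\<^sup>+x. ennreal (\<Phi> (sqrt (1 - y\<^sup>2) - \<bar>x\<bar>) * \<Psi> y) \<partial>lborel \<partial>lborel)"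
      by (subst nn_integral_lborel_complex(2)) (simp_all add: G1_def)
    also have "(\<integral>\<^sup>+z. G2 z \<partial>lborel) = (\<integral>\<^sup>+y. \<integral>\<^sup>+x. ennreal (\<Phi> (sqrt (1 - y\<^sup>2) - \<bar>x\<bar>) * \<Psi> y) \<partial>lborel \<partial>lborel)"
      by (subst nn_integral_lborel_complex(1)) (simp_all add: G2_def)
    also have "ennreal M * ((\<integral>\<^sup>+y. \<integral>\<^sup>+x. ennreal (\<Phi> (sqrt (1 - y\<^sup>2) - \<bar>x\<bar>) * \<Psi> y) \<partial>lborel \<partial>lborel)
          + (\<integral>\<^sup>+y. \<integral>\<^sup>+x. ennreal (\<Phi> (sqrt (1 - y\<^sup>2) - \<bar>x\<bar>) * \<Psi> y) \<partial>lborel \<partial>lborel))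
        \<le> ennreal M * (ennreal (2 * C1 * (2 * C2) * \<epsilon> powr (2 + \<beta> - c))
          + ennreal (2 * C1 * (2 * C2) * \<epsilon> powr (2 + \<beta> - c)))"
      by (intro mult_left_mono add_mono iter) simp
    also have "\<dots> = ennreal (M * (2 * (2 * C1 * (2 * C2))) * (1 - a) powr (2 + \<beta> - c))"
      using C1(1) C2(1) M0
      by (simp add: ennreal_mult[symmetric] ennreal_plus[symmetric] \<epsilon>_def algebra_simps del: ennreal_plus)
    finally show "(\<integral>\<^sup>+z. ?F z \<partial>lborel)
        \<le> ennreal (M * (2 * (2 * C1 * (2 * C2))) * (1 - a) powr (2 + \<beta> - c))" .
  qed
qed

text \<open>The upper bound in the Forelli-Rudin estimates, in the range where the integral grows. A
  rotation turns \<open>w\<close> into its modulus and preserves both the disk and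
  \<open>rho\<close>, which reduces the claim to a real parameter.\<close>

lemma disk_kernel_estimate:
  fixes \<beta> c :: real
  assumes "-1 < \<beta>" "2 + \<beta> < c"
  shows "\<exists>C\<ge>0. \<forall>w\<in>unit_disk.
    (\<integral>\<^sup>+z. ennreal (rho z powr \<beta> * cmod (1 - z * cnj w) powr (- c)) \<partial>disk_area)
    \<le> ennreal (C * rho w powr (2 + \<beta> - c))"
proof -
  obtain C where C: "C \<ge> 0" "\<And>a. 0 \<le> a \<Longrightarrow> a < 1 \<Longrightarrow>
    (\<integral>\<^sup>+z. ennreal (rho z powr \<beta> * cmod (1 - z * of_real a) powr (- c)) * indicator unit_disk z \<partial>lborel)
    \<le> ennreal (C * (1 - a) powr (2 + \<beta> - c))"
    using kernel_integral_real_parameter[OF assms] by blast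
  show ?thesis
  proof (intro exI conjI ballI)
    let ?C = "1 / pi * (C * 2 powr \<bar>2 + \<beta> - c\<bar>)"
    show "0 \<le> ?C" using C(1) by simp
    fix w :: complex assume w: "w \<in> unit_disk"
    \<comment> \<open>\<open>sgn 0\<close> is 0 and not unimodular, whence the separate value at the
      origin.\<close>
    define e where "e = (if w = 0 then 1 else sgn w)"
    have e: "cmod e = 1"
      by (simp add: e_def norm_sgn)
    have we: "w = e * of_real (cmod w)"
      unfolding e_def sgn_eq by simp
    have ee: "e * cnj e = 1"
      using e complex_norm_square[of e] by simp
    have ker: "1 - e * z * cnj w = 1 - z * of_real (cmod w)" for z
    proof -
      have "cnj w = cnj e * of_real (cmod w)"
        using arg_cong[OF we, of cnj] unfolding complex_cnj_mult complex_cnj_complex_of_real .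
      then have "e * z * cnj w = e * cnj e * z * of_real (cmod w)"
        by (simp only: mult_ac)
      then show ?thesis by (simp add: ee)
    qed
    have [measurable]: "unit_disk \<in> sets borel"
      by simp
    let ?F = "\<lambda>z. ennreal (rho z powr \<beta> * cmod (1 - z * cnj w) powr (- c))"
    have "(\<integral>\<^sup>+z. ?F z \<partial>disk_area) = ennreal (1 / pi) * (\<integral>\<^sup>+z. ?F z * indicator unit_disk z \<partial>lborel)"
      by (rule nn_integral_disk_area) (rule measurable_restrict_space1, measurable)
    also have "(\<integral>\<^sup>+z. ?F z * indicator unit_disk z \<partial>lborel)
        = (\<integral>\<^sup>+z. ?F (e * z) * indicator unit_disk (e * z) \<partial>lborel)"
      by (rule nn_integral_lborel_rotate[OF _ e, symmetric]) measurable
    also have "\<dots> = (\<integral>\<^sup>+z. ennreal (rho z powr \<beta> * cmod (1 - z * of_real (cmod w)) powr (- c)) * indicator unit_disk z \<partial>lborel)"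
      by (intro nn_integral_cong) (simp add: ker rho_def norm_mult e indicator_def)
    also have "\<dots> \<le> ennreal (C * (1 - cmod w) powr (2 + \<beta> - c))"
      using w by (intro C(2)) auto
    also have "\<dots> \<le> ennreal (C * (2 powr \<bar>2 + \<beta> - c\<bar> * rho w powr (2 + \<beta> - c)))"
      using w rho_bounds[OF w] rho_pos[OF w] C(1)
      by (intro ennreal_leI mult_left_mono powr_le_comparable) auto
    also have "ennreal (1 / pi) * \<dots> = ennreal (?C * rho w powr (2 + \<beta> - c))"
      using C(1) by (simp add: ennreal_mult[symmetric] mult.assoc)
    finally show "(\<integral>\<^sup>+z. ?F z \<partial>disk_area) \<le> ennreal (?C * rho w powr (2 + \<beta> - c))"
      by (simp add: mult_left_mono)
  qed
qed

section \<open>Mean values of holomorphic functions\<close>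

text \<open>Taylor polynomials converge uniformly on smaller closed disks. This is the source of all
  polynomial approximation below: in the mean value property, in the density of the polynomials and
  in the identification of the extended operator on test functions.\<close>

lemma holomorphic_ball_uniform_polynomials:
  assumes "f holomorphic_on ball 0 R" "0 \<le> r" "r < R"
  shows "\<exists>P :: nat \<Rightarrow> complex poly. uniform_limit (cball 0 r) (\<lambda>n z. poly (P n) z) f sequentially"
proof -
  define a where "a n = (deriv ^^ n) f 0 / fact n" for n
  have sums: "(\<lambda>n. a n * z ^ n) sums f z" if "z \<in> ball 0 R" for z
    using holomorphic_power_series[OF assms(1) that] by (simp add: a_def)
  define s where "s = (r + R) / 2"
  have s: "r < s" "s < R" "0 < s" using assms by (auto simp: s_def)
  have "summable (\<lambda>n. a n * complex_of_real s ^ n)"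
    using sums[of "of_real s"] s by (auto simp: sums_iff)
  from conv_radius_geI[OF this] s have "ereal r < conv_radius a"
    by (metis abs_of_pos less_ereal.simps(1) norm_of_real order_less_le_trans)
  from powser_uniform_limit[OF this, of 0]
  have "uniform_limit (cball 0 r) (\<lambda>n z. \<Sum>i<n. a i * z ^ i) (\<lambda>z. \<Sum>i. a i * z ^ i) sequentially"
    by simp
  also have "?this \<longleftrightarrow> uniform_limit (cball 0 r) (\<lambda>n z. poly (\<Sum>i<n. monom (a i) i) z) f sequentially"
  proof (rule uniform_limit_cong')
    fix z assume "z \<in> cball (0::complex) r"
    then show "(\<Sum>i. a i * z ^ i) = f z"
      using sums[of z] assms by (simp add: sums_iff)
  qed (simp add: poly_sum poly_monom)
  finally have "uniform_limit (cball 0 r) (\<lambda>n z. poly (\<Sum>i<n. monom (a i) i) z) f sequentially" .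
  then show ?thesis by (intro exI[of _ "\<lambda>n. \<Sum>i<n. monom (a i) i"])
qed

text \<open>Rotation invariance in the form that applies to Bochner integrals of complex-valued
  functions.\<close>

lemma lborel_distr_rotate:
  assumes "cmod c = 1"
  shows "distr lborel borel (\<lambda>z. c * z) = (lborel :: complex measure)"
proof (rule measure_eqI)
  fix A :: "complex set" assume "A \<in> sets (distr lborel borel (\<lambda>z. c * z))"
  then have [measurable]: "A \<in> sets borel" by simp
  have "emeasure (distr lborel borel (\<lambda>z. c * z)) A
      = (\<integral>\<^sup>+z. indicator A z \<partial>distr lborel borel (\<lambda>z. c * z))"
    by simp
  also have "\<dots> = (\<integral>\<^sup>+z. indicator A (c * z) \<partial>lborel)"
    by (rule nn_integral_distr) auto
  also have "\<dots> = (\<integral>\<^sup>+z. indicator A z \<partial>lborel)"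
    by (rule nn_integral_lborel_rotate[OF _ assms]) auto
  finally show "emeasure (distr lborel borel (\<lambda>z. c * z)) A = emeasure lborel A"
    by simp
qed simp

lemma integrable_cball_poly:
  fixes p :: "complex poly"
  shows "integrable lborel (\<lambda>z. indicator (cball 0 r) z *\<^sub>R poly p z)"
  by (intro borel_integrable_compact continuous_intros) simp

text \<open>The integral of \<open>z ^ n\<close> changes its sign under the rotation by \<open>cis (pi / n)\<close>.\<close>

lemma integral_cball_power:
  assumes "0 < n"
  shows "(\<integral>z. indicator (cball 0 r) z *\<^sub>R z ^ n \<partial>lborel) = (0::complex)"
proof -
  define c where "c = cis (pi / n)"
  have c: "cmod c = 1" by (simp add: c_def)
  have "c ^ n = cis (real n * (pi / real n))"
    unfolding c_def by (rule Complex.DeMoivre)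
  then have cn: "c ^ n = -1"
    using assms by simp
  let ?h = "\<lambda>z::complex. indicator (cball 0 r) z *\<^sub>R z ^ n"
  have [measurable]: "?h \<in> borel_measurable borel"
    by (intro borel_measurable_scaleR borel_measurable_indicator borel_measurable_continuous_onI
        continuous_intros) simp
  have "(\<integral>z. ?h z \<partial>lborel) = (\<integral>z. ?h z \<partial>distr lborel borel (\<lambda>z. c * z))"
    by (simp add: lborel_distr_rotate c)
  also have "\<dots> = (\<integral>z. ?h (c * z) \<partial>lborel)"
    by (rule integral_distr) auto
  also have "\<dots> = (\<integral>z. - ?h z \<partial>lborel)"
    by (intro Bochner_Integration.integral_cong)
      (auto simp: indicator_def norm_mult c power_mult_distrib cn)
  also have "\<dots> = - (\<integral>z. ?h z \<partial>lborel)" by simp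
  finally show ?thesis by simp
qed

lemma emeasure_cball_complex:
  assumes "0 \<le> r"
  shows "emeasure lborel (cball (w :: complex) r) = ennreal (pi * r\<^sup>2)"
  using assms by (simp add: emeasure_cball unit_ball_vol_2)

lemma integral_cball_poly:
  fixes p :: "complex poly"
  assumes "0 \<le> r"
  shows "(\<integral>z. indicator (cball 0 r) z *\<^sub>R poly p z \<partial>lborel) = of_real (pi * r\<^sup>2) * poly p 0"
proof -
  have int: "integrable lborel (\<lambda>z. indicator (cball 0 r) z *\<^sub>R ((z::complex) ^ i))" for i :: nat and r
    using integrable_cball_poly[of r "monom 1 i"] by (simp add: poly_monom)
  have int2: "integrable lborel (\<lambda>z. coeff p i * (indicator (cball 0 r) z *\<^sub>R (z ^ i)))" for i
    by (intro integrable_mult_right int)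
  have "(\<integral>z. indicator (cball 0 r) z *\<^sub>R poly p z \<partial>lborel)
      = (\<integral>z. (\<Sum>i\<le>degree p. coeff p i * (indicator (cball 0 r) z *\<^sub>R (z ^ i))) \<partial>lborel)"
    by (intro Bochner_Integration.integral_cong)
      (simp_all add: poly_altdef scaleR_sum_right)
  also have "\<dots> = (\<Sum>i\<le>degree p. coeff p i * (\<integral>z. indicator (cball 0 r) z *\<^sub>R (z ^ i) \<partial>lborel))"
    using int2 by (simp only: Bochner_Integration.integral_sum integral_mult_right_zero)
  also have "\<dots> = (\<Sum>i\<in>{0}. coeff p i * (\<integral>z. indicator (cball 0 r) z *\<^sub>R (z ^ i) \<partial>lborel))"
    using integral_cball_power by (intro sum.mono_neutral_right) auto
  also have "\<dots> = coeff p 0 * of_real (measure lborel (cball (0::complex) r))"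
  proof -
    have "has_bochner_integral lborel (\<lambda>z. indicator (cball (0::complex) r) z *\<^sub>R (1::complex))
        (measure lborel (cball (0::complex) r) *\<^sub>R 1)"
      by (rule has_bochner_integral_indicator) (simp_all add: emeasure_cball_complex[OF assms])
    from has_bochner_integral_integral_eq[OF this] show ?thesis by (simp add: scaleR_conv_of_real)
  qed
  also have "measure lborel (cball (0::complex) r) = pi * r\<^sup>2"
    using emeasure_cball_complex[OF assms] by (simp add: measure_def)
  finally show ?thesis by (simp add: poly_0_coeff_0 mult.commute)
qed

lemma poly_mean_value:
  fixes p :: "complex poly"
  assumes "0 \<le> r"
  shows "ennreal (pi * r\<^sup>2 * cmod (poly p 0))
    \<le> (\<integral>\<^sup>+z. ennreal (cmod (poly p z)) * indicator (cball 0 r) z \<partial>lborel)"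
proof -
  have "ennreal (pi * r\<^sup>2 * cmod (poly p 0))
      = ennreal (cmod (\<integral>z. indicator (cball 0 r) z *\<^sub>R poly p z \<partial>lborel))"
    unfolding integral_cball_poly[OF assms] by (simp add: norm_mult norm_power)
  also have "\<dots> \<le> (\<integral>\<^sup>+z. ennreal (cmod (indicator (cball 0 r) z *\<^sub>R poly p z)) \<partial>lborel)"
    by (rule integral_norm_bound_ennreal[OF integrable_cball_poly])
  also have "\<dots> = (\<integral>\<^sup>+z. ennreal (cmod (poly p z)) * indicator (cball 0 r) z \<partial>lborel)"
    by (intro nn_integral_cong) (simp add: indicator_def)
  finally show ?thesis .
qed

lemma holomorphic_mean_value_origin:
  assumes "f holomorphic_on ball 0 R" "0 \<le> r" "r < R"
  shows "ennreal (pi * r\<^sup>2 * cmod (f 0))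
    \<le> (\<integral>\<^sup>+z. ennreal (cmod (f z)) * indicator (cball 0 r) z \<partial>lborel)"
proof -
  define V where "V = pi * r\<^sup>2"
  have V: "0 \<le> V" by (simp add: V_def)
  show ?thesis
    unfolding V_def[symmetric]
  proof (rule ennreal_le_epsilon)
    let ?I = "\<integral>\<^sup>+z. ennreal (cmod (f z)) * indicator (cball 0 r) z \<partial>lborel"
    fix \<epsilon> :: real assume "0 < \<epsilon>"
    \<comment> \<open>The approximation error enters twice, at the centre and under the integral,
      each time multiplied by the area \<open>V\<close>. The summand 1 keeps the denominator
      positive when \<open>V = 0\<close>.\<close>
    define \<delta> where "\<delta> = \<epsilon> / (2 * V + 1)"
    have \<delta>: "0 < \<delta>" "2 * V * \<delta> \<le> \<epsilon>"
      using \<open>0 < \<epsilon>\<close> V by (auto simp: \<delta>_def field_simps intro!: divide_pos_pos add_nonneg_pos mult_left_mono)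
    obtain P :: "nat \<Rightarrow> complex poly" where "uniform_limit (cball 0 r) (\<lambda>n z. poly (P n) z) f sequentially"
      using holomorphic_ball_uniform_polynomials[OF assms] by blast
    from uniform_limitD[OF this \<delta>(1)] obtain n where n: "\<And>z. z \<in> cball 0 r \<Longrightarrow> dist (poly (P n) z) (f z) < \<delta>"
      using eventually_happens by (metis (no_types, lifting) sequentially_bot)
    have cont: "continuous_on (cball 0 r) f"
      using assms by (intro holomorphic_on_imp_continuous_on holomorphic_on_subset[OF assms(1)]) auto
    have meas: "(\<lambda>z. ennreal (cmod (f z)) * indicator (cball 0 r) z) \<in> borel_measurable borel"
    proof -
      have "(\<lambda>z. indicator (cball 0 r) z *\<^sub>R f z) \<in> borel_measurable borel"
        using borel_measurable_continuous_on_indicator[OF _ cont] by simp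
      then have "(\<lambda>z. ennreal (cmod (indicator (cball 0 r) z *\<^sub>R f z))) \<in> borel_measurable borel"
        by measurable
      also have "(\<lambda>z. ennreal (cmod (indicator (cball 0 r) z *\<^sub>R f z)))
          = (\<lambda>z. ennreal (cmod (f z)) * indicator (cball 0 r) z)"
        by (auto simp: indicator_def)
      finally show ?thesis .
    qed
    have "cmod (f 0) \<le> cmod (poly (P n) 0) + \<delta>"
      using n[of 0] assms norm_triangle_ineq2[of "f 0" "poly (P n) 0"]
      by (simp add: dist_norm norm_minus_commute)
    then have "V * cmod (f 0) \<le> V * (cmod (poly (P n) 0) + \<delta>)"
      using V by (rule mult_left_mono)
    then have "ennreal (V * cmod (f 0)) \<le> ennreal (V * cmod (poly (P n) 0) + V * \<delta>)"
      by (intro ennreal_leI) (simp add: distrib_left)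
    also have "\<dots> = ennreal (V * cmod (poly (P n) 0)) + ennreal (V * \<delta>)"
      using \<delta> V by (intro ennreal_plus) auto
    finally have "ennreal (V * cmod (f 0)) \<le> ennreal (V * cmod (poly (P n) 0)) + ennreal (V * \<delta>)" .
    also have "ennreal (V * cmod (poly (P n) 0))
        \<le> (\<integral>\<^sup>+z. ennreal (cmod (poly (P n) z)) * indicator (cball 0 r) z \<partial>lborel)"
      unfolding V_def by (rule poly_mean_value[OF assms(2)])
    also have "\<dots> \<le> (\<integral>\<^sup>+z. ennreal (cmod (f z)) * indicator (cball 0 r) z
        + ennreal \<delta> * indicator (cball 0 r) z \<partial>lborel)"
    proof (rule nn_integral_mono)
      fix z
      show "ennreal (cmod (poly (P n) z)) * indicator (cball 0 r) z
          \<le> ennreal (cmod (f z)) * indicator (cball 0 r) z + ennreal \<delta> * indicator (cball 0 r) z"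
      proof (cases "z \<in> cball 0 r")
        case True
        have "cmod (poly (P n) z) \<le> cmod (f z) + \<delta>"
          using n[OF True] norm_triangle_ineq2[of "poly (P n) z" "f z"] by (simp add: dist_norm)
        then show ?thesis
          using True \<delta> by (simp add: ennreal_plus[symmetric] ennreal_leI del: ennreal_plus)
      qed simp
    qed
    also have "\<dots> = ?I + ennreal \<delta> * emeasure lborel (cball (0::complex) r)"
      using meas by (subst nn_integral_add)
        (auto simp: nn_integral_cmult_indicator intro!: borel_measurable_times_ennreal borel_measurable_indicator)
    also have "\<dots> = ?I + ennreal (V * \<delta>)"
      unfolding emeasure_cball_complex[OF assms(2)] V_def[symmetric] using V \<delta> by (simp add: ennreal_mult' mult.commute)
    finally have "ennreal (V * cmod (f 0)) \<le> ?I + (ennreal (V * \<delta>) + ennreal (V * \<delta>))"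
      by (simp add: add.assoc)
    also have "ennreal (V * \<delta>) + ennreal (V * \<delta>) = ennreal (2 * V * \<delta>)"
      using \<delta> V by (subst ennreal_plus[symmetric]) (auto simp: mult.assoc simp del: ennreal_plus intro!: mult_nonneg_nonneg)
    also have "\<dots> \<le> ennreal \<epsilon>" using \<delta>(2) by (rule ennreal_leI)
    finally show "ennreal (V * cmod (f 0)) \<le> ?I + ennreal \<epsilon>"
      by (simp add: add_left_mono)
  qed
qed

text \<open>The version at the origin requires a concentric open disk of larger radius; compactness
  of \<open>cball w r\<close> provides one inside \<open>S\<close>, and translation does the
  rest.\<close>

lemma holomorphic_mean_value:
  assumes "f holomorphic_on S" "open S" "cball w r \<subseteq> S" "0 \<le> r"
  shows "ennreal (pi * r\<^sup>2 * cmod (f w))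
    \<le> (\<integral>\<^sup>+z. ennreal (cmod (f z)) * indicator (cball w r) z \<partial>lborel)"
proof -
  obtain e where e: "e > 0" "(\<Union>x\<in>cball w r. ball x e) \<subseteq> S"
    using compact_subset_open_imp_ball_epsilon_subset[OF compact_cball assms(2,3)] by metis
  have sub: "ball w (r + e) \<subseteq> S"
  proof
    fix z assume z: "z \<in> ball w (r + e)"
    show "z \<in> S"
    proof (cases "z \<in> cball w r")
      case False
      then have d: "dist w z > r" by simp
      then have "w \<noteq> z" using assms(4) by auto
      \<comment> \<open>The radial projection of \<open>z\<close> to the closed disk; its distance
        from \<open>z\<close> is \<open>dist w z - r\<close>, which is less than
        \<open>e\<close>.\<close>
      define y where "y = w + of_real (r / dist w z) * (z - w)"
      have "dist w y = r"
        using d assms(4) by (auto simp: y_def dist_norm norm_mult norm_minus_commute norm_divide)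
      have "y - z = of_real (r / dist w z - 1) * (z - w)"
        by (simp add: y_def algebra_simps)
      then have "dist y z = \<bar>r / dist w z - 1\<bar> * dist w z"
        by (simp only: dist_norm norm_mult norm_of_real) (simp add: norm_minus_commute)
      moreover have "\<bar>r / dist w z - 1\<bar> = (dist w z - r) / dist w z"
        using d assms(4) \<open>w \<noteq> z\<close> by (auto simp: abs_if field_simps)
      ultimately have "dist y z = dist w z - r"
        using \<open>w \<noteq> z\<close> by simp
      with \<open>dist w y = r\<close> have "y \<in> cball w r" "z \<in> ball y e" using z by auto
      then show ?thesis using e(2) by blast
    qed (use assms(3) in auto)
  qed
  have hol: "(\<lambda>z. f (w + z)) holomorphic_on ball 0 (r + e)"
    using assms(1) sub
    by (intro holomorphic_on_compose_gen[of "\<lambda>z. w + z" _ f, unfolded o_def] holomorphic_intros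
        holomorphic_on_subset[OF assms(1)]) (auto simp: dist_norm)
  have cont: "continuous_on (cball w r) f"
    using assms by (intro holomorphic_on_imp_continuous_on holomorphic_on_subset[OF assms(1)]) auto
  have "(\<lambda>z. indicator (cball w r) z *\<^sub>R f z) \<in> borel_measurable borel"
    using borel_measurable_continuous_on_indicator[OF _ cont] by simp
  then have "(\<lambda>z. ennreal (cmod (indicator (cball w r) z *\<^sub>R f z))) \<in> borel_measurable borel"
    by measurable
  also have "(\<lambda>z. ennreal (cmod (indicator (cball w r) z *\<^sub>R f z)))
      = (\<lambda>z. ennreal (cmod (f z)) * indicator (cball w r) z)"
    by (auto simp: indicator_def)
  finally have meas: "(\<lambda>z. ennreal (cmod (f z)) * indicator (cball w r) z) \<in> borel_measurable borel" .
  have "ennreal (pi * r\<^sup>2 * cmod (f (w + 0)))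
    \<le> (\<integral>\<^sup>+z. ennreal (cmod (f (w + z))) * indicator (cball 0 r) z \<partial>lborel)"
    using e assms(4) by (intro holomorphic_mean_value_origin[OF hol]) auto
  also have "\<dots> = (\<integral>\<^sup>+z. ennreal (cmod (f (w + z))) * indicator (cball w r) (w + z) \<partial>lborel)"
    by (intro nn_integral_cong) (simp add: indicator_def dist_norm)
  also have "\<dots> = (\<integral>\<^sup>+z. ennreal (cmod (f z)) * indicator (cball w r) z \<partial>distr lborel borel ((+) w))"
    using meas by (subst nn_integral_distr) auto
  finally show ?thesis by (simp add: lborel_distr_plus)
qed

section \<open>Sub-mean value estimates\<close>

lemma borel_measurable_cnj [measurable]: "cnj \<in> borel_measurable borel"
  by (intro borel_measurable_continuous_onI continuous_intros)

lemma borel_measurable_disk_area_continuous: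
  assumes "continuous_on unit_disk f"
  shows "f \<in> borel_measurable disk_area"
  using borel_measurable_continuous_on_restrict[OF assms] by (simp cong: measurable_cong_sets add: sets_disk_area)

text \<open>The graph of the convex function \<open>h powr p\<close> lies above its tangent at
  \<open>h = m\<close>. Integrating this line at a suitable \<open>m\<close> proves both the Jensen
  and the Minkowski inequality needed below.\<close>

lemma powr_tangent_le:
  fixes h m p :: real
  assumes "1 < p" "0 \<le> h" "0 \<le> m"
  shows "p * m powr (p - 1) * h \<le> h powr p + (p - 1) * m powr p"
proof -
  have "h * m powr (p - 1) \<le> h powr p / p + (m powr (p - 1)) powr (p / (p - 1)) / (p / (p - 1))"
    using assms by (intro Youngs_inequality) (auto simp: field_simps)
  also have "(m powr (p - 1)) powr (p / (p - 1)) = m powr p"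
    using assms by (simp add: powr_powr)
  finally show ?thesis
    using assms by (simp add: field_simps)
qed

lemma measurable_cball_powr:
  assumes "continuous_on (cball w r) f" "0 < p"
  shows "(\<lambda>z. ennreal (cmod (f z) powr p) * indicator (cball w r) z) \<in> borel_measurable borel"
proof -
  have "(\<lambda>z. indicator (cball w r) z *\<^sub>R f z) \<in> borel_measurable borel"
    using borel_measurable_continuous_on_indicator[OF _ assms(1)] by simp
  then have "(\<lambda>z. ennreal (cmod (indicator (cball w r) z *\<^sub>R f z) powr p)) \<in> borel_measurable borel"
    by measurable
  also have "(\<lambda>z. ennreal (cmod (indicator (cball w r) z *\<^sub>R f z) powr p))
      = (\<lambda>z. ennreal (cmod (f z) powr p) * indicator (cball w r) z)"
    using assms(2) by (auto simp: indicator_def)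
  finally show ?thesis .
qed

text \<open>Jensen's inequality by the tangent at \<open>m = cmod (f w)\<close>: the mean value
  inequality for the first power bounds the linear term from below by \<open>p * m powr p\<close>
  times the area, of which \<open>p - 1\<close> parts cancel.\<close>

lemma submean_powr_ge_1:
  assumes f: "f holomorphic_on S" "open S" "cball w r \<subseteq> S" "0 < r" and p: "1 < p"
  shows "ennreal (r\<^sup>2 * cmod (f w) powr p)
    \<le> (\<integral>\<^sup>+z. ennreal (cmod (f z) powr p) * indicator (cball w r) z \<partial>lborel)" (is "_ \<le> ?I")
proof (cases "?I = \<infinity>")
  case False
  then obtain i where i: "?I = ennreal i" "0 \<le> i"
    by (cases ?I rule: ennreal_cases) (simp_all only: infinity_ennreal_def simp_thms)
  define m where "m = cmod (f w)"
  define V where "V = pi * r\<^sup>2"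
  have V: "0 \<le> V" "r\<^sup>2 \<le> V"
    using pi_ge_two by (auto simp: V_def mult_le_cancel_right1)
  have m: "0 \<le> m" by (simp add: m_def)
  have cont: "continuous_on (cball w r) f"
    using f by (intro holomorphic_on_imp_continuous_on holomorphic_on_subset[OF f(1)]) auto
  have k: "0 \<le> p * m powr (p - 1)" using p by simp
  have meas: "(\<lambda>z. ennreal (cmod (f z)) * indicator (cball w r) z) \<in> borel_measurable borel"
    using measurable_cball_powr[OF cont, of 1] by simp
  note meas_p = measurable_cball_powr[OF cont, of p]
  have "ennreal (p * m powr (p - 1)) * ennreal (V * m)
      \<le> ennreal (p * m powr (p - 1)) * (\<integral>\<^sup>+z. ennreal (cmod (f z)) * indicator (cball w r) z \<partial>lborel)"
    unfolding V_def m_def using f by (intro mult_left_mono holomorphic_mean_value) auto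
  also have "\<dots> = (\<integral>\<^sup>+z. ennreal (p * m powr (p - 1)) * (ennreal (cmod (f z)) * indicator (cball w r) z) \<partial>lborel)"
    using meas by (simp add: nn_integral_cmult)
  also have "\<dots> \<le> (\<integral>\<^sup>+z. ennreal (cmod (f z) powr p) * indicator (cball w r) z
      + ennreal ((p - 1) * m powr p) * indicator (cball w r) z \<partial>lborel)"
  proof (rule nn_integral_mono)
    fix z
    have "p * m powr (p - 1) * cmod (f z) \<le> cmod (f z) powr p + (p - 1) * m powr p"
      using p m by (intro powr_tangent_le) auto
    then have "ennreal (p * m powr (p - 1)) * ennreal (cmod (f z))
        \<le> ennreal (cmod (f z) powr p) + ennreal ((p - 1) * m powr p)"
      using p by (simp add: ennreal_mult[symmetric] ennreal_plus[symmetric] ennreal_leI del: ennreal_plus)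
    then show "ennreal (p * m powr (p - 1)) * (ennreal (cmod (f z)) * indicator (cball w r) z)
        \<le> ennreal (cmod (f z) powr p) * indicator (cball w r) z
          + ennreal ((p - 1) * m powr p) * indicator (cball w r) z"
      by (simp add: indicator_def)
  qed
  also have "\<dots> = ?I + (\<integral>\<^sup>+z. ennreal ((p - 1) * m powr p) * indicator (cball w r) z \<partial>lborel)"
  proof (rule nn_integral_add)
    show "(\<lambda>z. ennreal (cmod (f z) powr p) * indicator (cball w r) z) \<in> borel_measurable lborel"
      using meas_p p by simp
    show "(\<lambda>z. ennreal ((p - 1) * m powr p) * indicator (cball w r) z) \<in> borel_measurable lborel"
      by (intro borel_measurable_times_ennreal borel_measurable_const borel_measurable_indicator) simp
  qed
  also have "(\<integral>\<^sup>+z. ennreal ((p - 1) * m powr p) * indicator (cball w r) z \<partial>lborel)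
      = ennreal ((p - 1) * m powr p) * ennreal V"
    unfolding V_def using f(4) by (subst nn_integral_cmult_indicator) (simp_all add: emeasure_cball_complex)
  also have "?I + ennreal ((p - 1) * m powr p) * ennreal V = ennreal (i + (p - 1) * m powr p * V)"
    unfolding i(1) using p i(2) V by (simp add: ennreal_mult[symmetric] ennreal_plus[symmetric] del: ennreal_plus)
  finally have "p * m powr (p - 1) * (V * m) \<le> i + (p - 1) * m powr p * V"
    using p m V i(2) by (simp add: ennreal_mult[symmetric] del: ennreal_plus)
  moreover have "p * m powr (p - 1) * (V * m) = p * m powr p * V"
  proof -
    have "m powr (p - 1) * m = m powr p"
      using powr_mult_base[OF m, of "p - 1"] by (simp add: mult.commute)
    moreover have "p * m powr (p - 1) * (V * m) = p * (m powr (p - 1) * m) * V"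
      by (simp only: mult_ac)
    ultimately show ?thesis by (simp only:)
  qed
  ultimately have "p * m powr p * V \<le> i + (p - 1) * m powr p * V" by (simp only:)
  then have "m powr p * V \<le> i" by (simp add: algebra_simps)
  moreover have "r\<^sup>2 * m powr p \<le> m powr p * V"
    using mult_right_mono[OF V(2), of "m powr p"] by (simp add: mult.commute)
  ultimately show ?thesis
    using i by (simp add: m_def ennreal_leI)
qed simp

text \<open>For \<open>p \<le> 1\<close> evaluate the mean value inequality for the first power at a maximum point
  \<open>z\<^sub>0\<close> of \<open>(r - dist w z) powr (2 / p) * cmod (f z)\<close>: on the disk around \<open>z\<^sub>0\<close> of half
  the distance to the circle the modulus is at most \<open>2 powr (2 / p)\<close> times its value at
  \<open>z\<^sub>0\<close>, which turns the first power into the \<open>p\<close>-th power.\<close>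

lemma submean_powr_le_1:
  assumes f: "f holomorphic_on S" "open S" "cball w r \<subseteq> S" "0 < r" and p: "0 < p" "p \<le> 1"
  shows "ennreal (r\<^sup>2 * cmod (f w) powr p)
    \<le> ennreal (4 * 2 powr (2 / p)) * (\<integral>\<^sup>+z. ennreal (cmod (f z) powr p) * indicator (cball w r) z \<partial>lborel)"
    (is "_ \<le> _ * ?I")
proof (cases "?I = \<infinity>")
  case True
  then show ?thesis by (simp add: ennreal_mult_top)
next
  case False
  then obtain i where i: "?I = ennreal i" "0 \<le> i"
    by (cases ?I rule: ennreal_cases) (simp_all only: infinity_ennreal_def simp_thms)
  have cont: "continuous_on (cball w r) f"
    using f by (intro holomorphic_on_imp_continuous_on holomorphic_on_subset[OF f(1)]) auto
  define \<phi> where "\<phi> z = (r - dist w z) powr (2 / p) * cmod (f z)" for z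
  have "continuous_on (cball w r) \<phi>"
    unfolding \<phi>_def using p by (intro continuous_intros cont continuous_on_powr') auto
  then obtain z0 where z0: "z0 \<in> cball w r" "\<And>z. z \<in> cball w r \<Longrightarrow> \<phi> z \<le> \<phi> z0"
    using continuous_attains_sup[of "cball w r" \<phi>] f(4) by auto
  define d where "d = r - dist w z0"
  define m where "m = cmod (f z0)"
  have d0: "0 \<le> d" using z0 by (simp add: d_def)
  have m0: "0 \<le> m" by (simp add: m_def)
  have \<phi>w: "r powr (2 / p) * cmod (f w) \<le> d powr (2 / p) * m"
    using z0(2)[of w] f(4) by (simp add: \<phi>_def d_def m_def)
  \<comment> \<open>The exponent \<open>2 / p\<close> of the distance is chosen so that the
    \<open>p\<close>-th power produces a squared radius, that is, an area.\<close>
  have powp: "(x powr (2 / p) * y) powr p = x\<^sup>2 * y powr p" if "0 \<le> x" "0 \<le> y" for x y :: real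
    using that p by (simp add: powr_mult powr_powr powr_numeral)
  have "r\<^sup>2 * cmod (f w) powr p \<le> d\<^sup>2 * m powr p"
    using powr_mono2[OF _ _ \<phi>w, of p] p f(4) d0 m0 by (simp add: powp)
  moreover have "d\<^sup>2 * m powr p \<le> 4 * 2 powr (2 / p) * i"
  proof (cases "d = 0 \<or> m = 0")
    case True
    then show ?thesis using i(2) by auto
  next
    case False
    then have d: "0 < d" and m: "0 < m" using d0 m0 by auto
    define L where "L = 2 powr (2 / p) * m"
    have L: "0 < L" using m by (simp add: L_def)
    have sub: "cball z0 (d / 2) \<subseteq> cball w r"
    proof
      fix z assume "z \<in> cball z0 (d / 2)"
      then show "z \<in> cball w r"
        using dist_triangle[of w z z0] d by (simp add: d_def)
    qed
    have pw: "cmod (f z) \<le> L powr (1 - p) * cmod (f z) powr p" if z: "z \<in> cball z0 (d / 2)" for z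
    proof -
      have "d / 2 \<le> r - dist w z"
        using z dist_triangle[of w z z0] d by (simp add: d_def)
      then have "(d / 2) powr (2 / p) * cmod (f z) \<le> \<phi> z"
        unfolding \<phi>_def using d p by (intro mult_right_mono powr_mono2) auto
      also have "\<dots> \<le> \<phi> z0" using z sub by (intro z0(2)) auto
      also have "\<dots> = d powr (2 / p) * m" by (simp add: \<phi>_def d_def m_def)
      finally have "cmod (f z) \<le> L"
        using d by (simp add: L_def powr_divide field_simps)
      then have "cmod (f z) powr (1 - p) \<le> L powr (1 - p)"
        using p by (intro powr_mono2) auto
      then have "cmod (f z) powr (1 - p) * cmod (f z) powr p \<le> L powr (1 - p) * cmod (f z) powr p"
        by (rule mult_right_mono) simp
      then show ?thesis by (simp add: powr_add[symmetric])
    qed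
    have "ennreal (pi * (d / 2)\<^sup>2 * m)
        \<le> (\<integral>\<^sup>+z. ennreal (cmod (f z)) * indicator (cball z0 (d / 2)) z \<partial>lborel)"
      unfolding m_def using sub f d by (intro holomorphic_mean_value[OF f(1,2)]) auto
    also have "\<dots> \<le> (\<integral>\<^sup>+z. ennreal (L powr (1 - p)) * (ennreal (cmod (f z) powr p) * indicator (cball w r) z) \<partial>lborel)"
    proof (rule nn_integral_mono)
      fix z
      show "ennreal (cmod (f z)) * indicator (cball z0 (d / 2)) z
          \<le> ennreal (L powr (1 - p)) * (ennreal (cmod (f z) powr p) * indicator (cball w r) z)"
        using pw[of z] sub by (auto simp: indicator_def ennreal_mult[symmetric] intro!: ennreal_leI)
    qed
    also have "\<dots> = ennreal (L powr (1 - p)) * ?I"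
      by (rule nn_integral_cmult) (simp add: measurable_cball_powr[OF cont p(1)])
    also have "\<dots> = ennreal (L powr (1 - p) * i)"
      using i by (simp add: ennreal_mult)
    finally have "pi * (d / 2)\<^sup>2 * m \<le> L powr (1 - p) * i"
      using i(2) by simp
    moreover have "L powr (1 - p) * m powr p \<le> 2 powr (2 / p) * m"
    proof -
      have "L powr (1 - p) * m powr p \<le> L powr (1 - p) * L powr p"
        using m p by (intro mult_left_mono powr_mono2) (auto simp: L_def mult_le_cancel_right1 intro!: ge_one_powr_ge_zero)
      also have "\<dots> = L" using L by (simp add: powr_add[symmetric])
      finally show ?thesis by (simp add: L_def)
    qed
    ultimately have "(L powr (1 - p) * m powr p) * (d\<^sup>2 * 3 / 4) \<le> 2 powr (2 / p) * (L powr (1 - p) * i)"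
    proof -
      assume 1: "pi * (d / 2)\<^sup>2 * m \<le> L powr (1 - p) * i"
        and 2: "L powr (1 - p) * m powr p \<le> 2 powr (2 / p) * m"
      have "(L powr (1 - p) * m powr p) * (d\<^sup>2 * 3 / 4) \<le> 2 powr (2 / p) * m * (d\<^sup>2 * 3 / 4)"
        by (intro mult_right_mono 2) auto
      also have "\<dots> \<le> 2 powr (2 / p) * (pi * (d / 2)\<^sup>2 * m)"
      proof -
        have "(2 powr (2 / p) * m * (d\<^sup>2 / 4)) * 3 \<le> (2 powr (2 / p) * m * (d\<^sup>2 / 4)) * pi"
          using m pi_gt3 by (intro mult_left_mono) auto
        then show ?thesis by (simp add: power2_eq_square mult_ac)
      qed
      also have "\<dots> \<le> 2 powr (2 / p) * (L powr (1 - p) * i)"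
        by (intro mult_left_mono 1) auto
      finally show ?thesis .
    qed
    then have "L powr (1 - p) * (m powr p * (d\<^sup>2 * 3 / 4)) \<le> L powr (1 - p) * (2 powr (2 / p) * i)"
      by (simp add: mult_ac)
    then have "m powr p * (d\<^sup>2 * 3 / 4) \<le> 2 powr (2 / p) * i"
      using L by simp
    moreover have "0 \<le> 2 powr (2 / p) * i" using i by simp
    ultimately show ?thesis by (simp add: mult_ac)
  qed
  ultimately have "r\<^sup>2 * cmod (f w) powr p \<le> 4 * 2 powr (2 / p) * i" by linarith
  then show ?thesis
    unfolding i(1) using i(2) by (simp add: ennreal_mult[symmetric] ennreal_leI)
qed

lemma submean_powr:
  assumes p: "0 < p"
  shows "\<exists>C>0. \<forall>f S w r. f holomorphic_on S \<longrightarrow> open S \<longrightarrow> cball w r \<subseteq> S \<longrightarrow> 0 < r \<longrightarrow>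
    ennreal (r\<^sup>2 * cmod (f w) powr p)
    \<le> ennreal C * (\<integral>\<^sup>+z. ennreal (cmod (f z) powr p) * indicator (cball w r) z \<partial>lborel)"
proof (cases "p \<le> 1")
  case True
  show ?thesis
    using submean_powr_le_1[OF _ _ _ _ p True] by (intro exI[of _ "4 * 2 powr (2 / p)"]) simp
next
  case False
  then show ?thesis
    using submean_powr_ge_1[of _ _ _ _ p] by (intro exI[of _ 1]) simp
qed

text \<open>Averaging over the disk of radius \<open>(1 - cmod w) / 2\<close> around \<open>w\<close>; there
  \<open>rho z\<close> and \<open>cmod (1 - w * cnj z)\<close> are comparable to \<open>rho w\<close>, so the kernel may replace the
  indicator function of that disk.\<close>

lemma submean_kernel:
  assumes p: "0 < p" and c: "0 < c"
  shows "\<exists>C>0. \<forall>f w. f holomorphic_on unit_disk \<longrightarrow> w \<in> unit_disk \<longrightarrow>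
    ennreal (cmod (f w) powr p * rho w powr (- \<tau>))
    \<le> ennreal C * (\<integral>\<^sup>+z. ennreal (cmod (f z) powr p * rho z powr (c - 2 - \<tau>) * cmod (1 - w * cnj z) powr (- c))
        * indicator {z. 3 * cmod w - 1 \<le> 2 * cmod z} z \<partial>disk_area)"
proof -
  obtain C where C: "C > 0" "\<And>f S w r. f holomorphic_on S \<Longrightarrow> open S \<Longrightarrow> cball w r \<subseteq> S \<Longrightarrow> 0 < r \<Longrightarrow>
    ennreal (r\<^sup>2 * cmod (f w) powr p)
    \<le> ennreal C * (\<integral>\<^sup>+z. ennreal (cmod (f z) powr p) * indicator (cball w r) z \<partial>lborel)"
    using submean_powr[OF p] by blast
  \<comment> \<open>The factors come from \<open>l \<le> 4 * r\<close> squared, from comparing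
    \<open>rho z\<close> with \<open>l\<close>, and from bounding the modulus in the kernel by
    \<open>2 * l\<close>.\<close>
  define M where "M = 16 * 4 powr \<bar>c - 2 - \<tau>\<bar> * 2 powr c"
  have M: "M > 0" by (simp add: M_def)
  show ?thesis
  proof (intro exI conjI allI impI)
    show "0 < pi * (M * C)" using M C by simp
    fix f w assume f: "f holomorphic_on unit_disk" and w: "w \<in> unit_disk"
    define r where "r = (1 - cmod w) / 2"
    define l where "l = rho w"
    have r: "0 < r" using w by (simp add: r_def)
    have l: "0 < l" "l \<le> 4 * r" "2 * r \<le> l"
      using rho_pos[OF w] rho_bounds[OF w] by (auto simp: l_def r_def)
    have inball: "z \<in> unit_disk" "3 * cmod w - 1 \<le> 2 * cmod z"
        "l \<le> 4 * rho z" "rho z \<le> 4 * l" "cmod (1 - w * cnj z) \<le> 2 * l" "0 < cmod (1 - w * cnj z)"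
      if z: "z \<in> cball w r" for z
    proof -
      have d: "cmod (z - w) \<le> r" using z by (simp add: dist_norm norm_minus_commute)
      have a: "cmod z \<le> cmod w + r" "cmod w \<le> cmod z + r"
        using d norm_triangle_ineq2[of z w] norm_triangle_ineq3[of z w] by linarith+
      show zD: "z \<in> unit_disk" using a w by (simp add: r_def field_simps)
      \<comment> \<open>The averaging disk lies outside the radius
        \<open>(3 * cmod w - 1) / 2\<close>, which tends to 1 with \<open>cmod w\<close>. Keeping
        track of this lets tails be estimated by tails.\<close>
      show "3 * cmod w - 1 \<le> 2 * cmod z" using a by (simp add: r_def field_simps)
      have b: "r \<le> 1 - cmod z" "1 - cmod z \<le> 3 * r"
        using a by (auto simp: r_def field_simps)
      show "l \<le> 4 * rho z" using l rho_bounds[OF zD] b by linarith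
      have "rho z \<le> 2 * (3 * r)" using rho_bounds(2)[OF zD] b by simp
      then show "rho z \<le> 4 * l" using l by simp
      have "1 - w * cnj z = of_real l - w * cnj (z - w)"
        by (simp add: l_def rho_def complex_norm_square algebra_simps del: of_real_power)
      then have "cmod (1 - w * cnj z) \<le> l + cmod w * cmod (z - w)"
        using norm_triangle_ineq4[of "of_real l" "w * cnj (z - w)"] l
        by (simp only: norm_mult complex_mod_cnj norm_of_real abs_of_pos)
      also have "cmod w * cmod (z - w) \<le> 1 * r" using w d by (intro mult_mono) auto
      finally show "cmod (1 - w * cnj z) \<le> 2 * l" using l r by linarith
      have "cmod (w * cnj z) < 1"
        using w zD mult_strict_mono[of "cmod w" 1 "cmod z" 1] by (simp add: norm_mult)
      then show "0 < cmod (1 - w * cnj z)" by auto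
    qed
    have sub: "cball w r \<subseteq> unit_disk" using inball(1) by blast
    define F where "F z = ennreal (cmod (f z) powr p * rho z powr (c - 2 - \<tau>) * cmod (1 - w * cnj z) powr (- c))
        * indicator {z. 3 * cmod w - 1 \<le> 2 * cmod z} z" for z
    have measF: "F \<in> borel_measurable (restrict_space borel unit_disk)"
    proof -
      have [measurable]: "f \<in> borel_measurable (restrict_space borel unit_disk)"
        by (intro borel_measurable_continuous_on_restrict holomorphic_on_imp_continuous_on f)
      have m1: "(\<lambda>z. ennreal (cmod (f z) powr p)) \<in> borel_measurable (restrict_space borel unit_disk)"
        by measurable
      have "(\<lambda>z. ennreal (rho z powr (c - 2 - \<tau>) * cmod (1 - w * cnj z) powr (- c))) \<in> borel_measurable borel"
        by measurable
      moreover have "{z. 3 * cmod w - 1 \<le> 2 * cmod z} \<in> sets borel"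
        by (intro borel_closed closed_Collect_le continuous_intros)
      ultimately have m2: "(\<lambda>z. ennreal (rho z powr (c - 2 - \<tau>) * cmod (1 - w * cnj z) powr (- c))
          * indicator {z. 3 * cmod w - 1 \<le> 2 * cmod z} z) \<in> borel_measurable borel"
        by (intro borel_measurable_times_ennreal borel_measurable_indicator)
      have "(\<lambda>z. ennreal (cmod (f z) powr p) * (ennreal (rho z powr (c - 2 - \<tau>) * cmod (1 - w * cnj z) powr (- c))
          * indicator {z. 3 * cmod w - 1 \<le> 2 * cmod z} z)) \<in> borel_measurable (restrict_space borel unit_disk)"
        by (rule borel_measurable_times_ennreal[OF m1 measurable_restrict_space1[OF m2]])
      then show ?thesis
        unfolding F_def by (simp add: ennreal_mult mult_ac)
    qed
    have key: "ennreal (l powr (- \<tau>)) * (ennreal (cmod (f z) powr p) * indicator (cball w r) z)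
        \<le> ennreal (M * r\<^sup>2) * (F z * indicator unit_disk z)" for z
    proof (cases "z \<in> cball w r")
      case True
      note b = inball[OF True]
      have "l powr (c - 2 - \<tau>) \<le> 4 powr \<bar>c - 2 - \<tau>\<bar> * rho z powr (c - 2 - \<tau>)"
        using b l rho_pos[OF b(1)] by (intro powr_le_comparable) auto
      moreover have "(2 * l) powr (- c) \<le> cmod (1 - w * cnj z) powr (- c)"
        using b c l by (intro powr_mono2') auto
      ultimately have "l powr (c - 2 - \<tau>) * (2 * l) powr (- c)
          \<le> 4 powr \<bar>c - 2 - \<tau>\<bar> * rho z powr (c - 2 - \<tau>) * cmod (1 - w * cnj z) powr (- c)"
        by (intro mult_mono) auto
      moreover have "l powr (c - 2 - \<tau>) * (2 * l) powr (- c) = 2 powr (- c) * (l powr (- \<tau>) * l powr (- 2))"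
        using l by (simp add: powr_mult powr_add[symmetric]) (rule arg_cong, simp)
      ultimately have "2 powr (- c) * (l powr (- \<tau>) * l powr (- 2))
          \<le> 4 powr \<bar>c - 2 - \<tau>\<bar> * rho z powr (c - 2 - \<tau>) * cmod (1 - w * cnj z) powr (- c)"
        by (simp only:)
      then have "2 powr c * (2 powr (- c) * (l powr (- \<tau>) * l powr (- 2)))
          \<le> 2 powr c * (4 powr \<bar>c - 2 - \<tau>\<bar> * rho z powr (c - 2 - \<tau>) * cmod (1 - w * cnj z) powr (- c))"
        by (rule mult_left_mono) simp
      moreover have "2 powr c * (2 powr (- c) * x) = x" for x :: real
        by (simp add: powr_minus)
      ultimately have "l powr (- \<tau>) * l powr (- 2)
          \<le> 2 powr c * (4 powr \<bar>c - 2 - \<tau>\<bar> * rho z powr (c - 2 - \<tau>) * cmod (1 - w * cnj z) powr (- c))"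
        by (simp only:)
      then have "l\<^sup>2 * (l powr (- \<tau>) * l powr (- 2))
          \<le> l\<^sup>2 * (2 powr c * (4 powr \<bar>c - 2 - \<tau>\<bar> * rho z powr (c - 2 - \<tau>) * cmod (1 - w * cnj z) powr (- c)))"
        by (rule mult_left_mono) simp
      moreover have "l\<^sup>2 * (x * l powr (- 2)) = x" for x
        using l by (simp add: powr_minus powr_numeral divide_inverse)
      ultimately have "l powr (- \<tau>)
          \<le> l\<^sup>2 * (2 powr c * (4 powr \<bar>c - 2 - \<tau>\<bar> * rho z powr (c - 2 - \<tau>) * cmod (1 - w * cnj z) powr (- c)))"
        by (simp only:)
      also have "\<dots> \<le> (4 * r)\<^sup>2 * (2 powr c * (4 powr \<bar>c - 2 - \<tau>\<bar> * rho z powr (c - 2 - \<tau>) * cmod (1 - w * cnj z) powr (- c)))"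
        using l by (intro mult_right_mono power_mono) auto
      also have "\<dots> = M * r\<^sup>2 * (rho z powr (c - 2 - \<tau>) * cmod (1 - w * cnj z) powr (- c))"
        by (simp add: M_def power2_eq_square)
      finally have "l powr (- \<tau>) * cmod (f z) powr p
          \<le> M * r\<^sup>2 * (rho z powr (c - 2 - \<tau>) * cmod (1 - w * cnj z) powr (- c)) * cmod (f z) powr p"
        by (rule mult_right_mono) simp
      then have "ennreal (l powr (- \<tau>) * cmod (f z) powr p)
          \<le> ennreal (M * r\<^sup>2 * (cmod (f z) powr p * rho z powr (c - 2 - \<tau>) * cmod (1 - w * cnj z) powr (- c)))"
        by (intro ennreal_leI) (simp add: mult_ac)
      then show ?thesis
        using True b M by (simp add: F_def ennreal_mult)
    qed simp
    have "ennreal (r\<^sup>2) * ennreal (cmod (f w) powr p * rho w powr (- \<tau>))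
        = ennreal (l powr (- \<tau>)) * ennreal (r\<^sup>2 * cmod (f w) powr p)"
      by (simp add: l_def ennreal_mult[symmetric] mult_ac)
    also have "\<dots> \<le> ennreal (l powr (- \<tau>)) * (ennreal C * (\<integral>\<^sup>+z. ennreal (cmod (f z) powr p) * indicator (cball w r) z \<partial>lborel))"
      by (intro mult_left_mono C(2)[OF f _ sub r]) auto
    also have "\<dots> = ennreal C * (\<integral>\<^sup>+z. ennreal (l powr (- \<tau>)) * (ennreal (cmod (f z) powr p) * indicator (cball w r) z) \<partial>lborel)"
    proof -
      have "continuous_on (cball w r) f"
        using sub by (intro holomorphic_on_imp_continuous_on holomorphic_on_subset[OF f])
      from measurable_cball_powr[OF this p] show ?thesis
        by (subst nn_integral_cmult) (auto simp: mult.left_commute)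
    qed
    also have "\<dots> \<le> ennreal C * (\<integral>\<^sup>+z. ennreal (M * r\<^sup>2) * (F z * indicator unit_disk z) \<partial>lborel)"
      by (intro mult_left_mono nn_integral_mono key) simp
    also have "\<dots> = ennreal C * (ennreal (M * r\<^sup>2) * (\<integral>\<^sup>+z. F z * indicator unit_disk z \<partial>lborel))"
    proof -
      have "(\<lambda>z. F z * indicator unit_disk z) \<in> borel_measurable borel"
        using measF by (subst (asm) borel_measurable_restrict_space_iff_ennreal) auto
      then show ?thesis by (simp add: nn_integral_cmult)
    qed
    also have "\<dots> = ennreal (r\<^sup>2) * (ennreal (pi * (M * C)) * (ennreal (1 / pi) * (\<integral>\<^sup>+z. F z * indicator unit_disk z \<partial>lborel)))"
    proof -
      have "ennreal (M * r\<^sup>2) * ennreal C = ennreal (r\<^sup>2) * (ennreal (pi * (M * C)) * ennreal (1 / pi))"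
        using M C by (simp add: ennreal_mult[symmetric] mult_ac)
      from arg_cong[OF this, of "\<lambda>x. x * (\<integral>\<^sup>+z. F z * indicator unit_disk z \<partial>lborel)"]
      show ?thesis by (simp only: mult_ac)
    qed
    also have "\<dots> = ennreal (r\<^sup>2) * (ennreal (pi * (M * C)) * (\<integral>\<^sup>+z. F z \<partial>disk_area))"
      by (simp add: nn_integral_disk_area[OF measF])
    finally have "ennreal (cmod (f w) powr p * rho w powr (- \<tau>)) \<le> ennreal (pi * (M * C)) * (\<integral>\<^sup>+z. F z \<partial>disk_area)"
      using r by (simp add: ennreal_mult_le_mult_iff)
    then show "ennreal (cmod (f w) powr p * rho w powr (- \<tau>))
      \<le> ennreal (pi * (M * C)) * (\<integral>\<^sup>+z. ennreal (cmod (f z) powr p * rho z powr (c - 2 - \<tau>) * cmod (1 - w * cnj z) powr (- c))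
        * indicator {z. 3 * cmod w - 1 \<le> 2 * cmod z} z \<partial>disk_area)"
      by (simp add: F_def)
  qed
qed

section \<open>Carleson embedding\<close>

abbreviation kern :: "real \<Rightarrow> complex \<Rightarrow> complex \<Rightarrow> real" where
  "kern c w z \<equiv> cmod (1 - w * cnj z) powr c"

abbreviation dens :: "real \<Rightarrow> real \<Rightarrow> (complex \<Rightarrow> complex) \<Rightarrow> complex \<Rightarrow> real" where
  "dens p \<alpha> f z \<equiv> cmod (f z) powr p * rho z powr \<alpha>"

lemma space_disk_measure: "finite_borel_measure_on_disk \<mu> \<Longrightarrow> space \<mu> = unit_disk"
  by (auto simp: finite_borel_measure_on_disk_def space_restrict_space dest: sets_eq_imp_space_eq)

lemma disk_measure_measurable:
  assumes "finite_borel_measure_on_disk \<mu>" "f \<in> borel_measurable borel"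
  shows "f \<in> borel_measurable \<mu>"
  using assms(1) measurable_restrict_space1[OF assms(2), of unit_disk]
  by (simp add: finite_borel_measure_on_disk_def cong: measurable_cong_sets)

lemma disk_measure_measurable_holomorphic:
  assumes "finite_borel_measure_on_disk \<mu>" "f holomorphic_on unit_disk"
  shows "f \<in> borel_measurable \<mu>"
  using assms(1) borel_measurable_continuous_on_restrict[OF holomorphic_on_imp_continuous_on[OF assms(2)]]
  by (simp add: finite_borel_measure_on_disk_def cong: measurable_cong_sets)

lemma finite_borel_measure_disk_area: "finite_borel_measure_on_disk disk_area"
  unfolding finite_borel_measure_on_disk_def using sets_disk_area disk_area.finite_measure_axioms by simp

lemma measurable_kernel_comp:
  assumes [measurable]: "X \<in> borel_measurable N" "Y \<in> borel_measurable N"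
  shows "(\<lambda>x. ennreal (kern a (X x) (Y x))) \<in> borel_measurable N"
  by measurable

lemma disk_tonelli:
  assumes \<mu>: "finite_borel_measure_on_disk \<mu>" and \<nu>: "finite_borel_measure_on_disk \<nu>"
    and F: "F \<in> borel_measurable \<mu>" and G: "G \<in> borel_measurable \<nu>"
  shows "(\<integral>\<^sup>+w. F w * (\<integral>\<^sup>+z. G z * ennreal (kern a w z) \<partial>\<nu>) \<partial>\<mu>)
    = (\<integral>\<^sup>+z. G z * (\<integral>\<^sup>+w. F w * ennreal (kern a w z) \<partial>\<mu>) \<partial>\<nu>)"
proof -
  interpret \<mu>: finite_measure \<mu> using \<mu> by (simp add: finite_borel_measure_on_disk_def)
  interpret \<nu>: finite_measure \<nu> using \<nu> by (simp add: finite_borel_measure_on_disk_def)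
  interpret pair_sigma_finite \<mu> \<nu> by standard
  have id\<mu>: "(\<lambda>w. w) \<in> borel_measurable \<mu>" and id\<nu>: "(\<lambda>w. w) \<in> borel_measurable \<nu>"
    using \<mu> \<nu> by (auto intro: disk_measure_measurable)
  have k: "(\<lambda>x. ennreal (kern a (fst x) (snd x))) \<in> borel_measurable (\<mu> \<Otimes>\<^sub>M \<nu>)"
    by (intro measurable_kernel_comp measurable_compose[OF measurable_fst id\<mu>]
        measurable_compose[OF measurable_snd id\<nu>])
  have m: "(\<lambda>(w, z). F w * (G z * ennreal (kern a w z))) \<in> borel_measurable (\<mu> \<Otimes>\<^sub>M \<nu>)"
    unfolding case_prod_beta'
    by (intro borel_measurable_times_ennreal k measurable_compose[OF measurable_fst F]
        measurable_compose[OF measurable_snd G])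
  have k1: "(\<lambda>z. ennreal (kern a w z)) \<in> borel_measurable \<nu>" for w
    by (intro measurable_kernel_comp id\<nu>) simp
  have k2: "(\<lambda>w. ennreal (kern a w z)) \<in> borel_measurable \<mu>" for z
    by (intro measurable_kernel_comp id\<mu>) simp
  have "(\<integral>\<^sup>+w. F w * (\<integral>\<^sup>+z. G z * ennreal (kern a w z) \<partial>\<nu>) \<partial>\<mu>)
      = (\<integral>\<^sup>+w. \<integral>\<^sup>+z. F w * (G z * ennreal (kern a w z)) \<partial>\<nu> \<partial>\<mu>)"
    by (intro nn_integral_cong nn_integral_cmult[symmetric] borel_measurable_times_ennreal G k1)
  also have "\<dots> = (\<integral>\<^sup>+z. \<integral>\<^sup>+w. F w * (G z * ennreal (kern a w z)) \<partial>\<mu> \<partial>\<nu>)"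
    by (rule Fubini'[OF m, symmetric])
  also have "\<dots> = (\<integral>\<^sup>+z. \<integral>\<^sup>+w. G z * (F w * ennreal (kern a w z)) \<partial>\<mu> \<partial>\<nu>)"
    by (simp only: mult_ac)
  also have "\<dots> = (\<integral>\<^sup>+z. G z * (\<integral>\<^sup>+w. F w * ennreal (kern a w z) \<partial>\<mu>) \<partial>\<nu>)"
    by (intro nn_integral_cong nn_integral_cmult borel_measurable_times_ennreal F k2)
  finally show ?thesis .
qed

text \<open>The \<open>p\<close>-th power of the norm up to the constant \<open>1 + \<alpha>\<close>
  of the weight. As an extended integral it makes sense for every function, so that membership in
  the space becomes finiteness and truncated functions have a mass as well.\<close>

definition bergman_mass :: "real \<Rightarrow> real \<Rightarrow> (complex \<Rightarrow> complex) \<Rightarrow> ennreal" where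
  "bergman_mass p \<alpha> f = (\<integral>\<^sup>+z. ennreal (dens p \<alpha> f z) \<partial>disk_area)"

lemma measurable_bergman_integrand:
  assumes "finite_borel_measure_on_disk \<mu>" "f \<in> borel_measurable \<mu>"
  shows "(\<lambda>z. cmod (f z) powr p * rho z powr \<alpha>) \<in> borel_measurable \<mu>"
proof -
  have [measurable]: "rho \<in> borel_measurable \<mu>" "f \<in> borel_measurable \<mu>"
    using assms by (auto intro: disk_measure_measurable)
  show ?thesis by measurable
qed

lemma kernel_lower_bound:
  assumes "z \<in> unit_disk" "w \<in> unit_disk"
  shows "1 - cmod z \<le> cmod (1 - z * cnj w)" "1 - cmod w \<le> cmod (1 - z * cnj w)"
    "0 < cmod (1 - z * cnj w)" "0 < Re (1 - z * cnj w)" "cmod (1 - z * cnj w) \<le> 2"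
proof -
  have a: "cmod z * cmod w \<le> cmod z * 1" "cmod z * cmod w \<le> 1 * cmod w"
    using assms mult_left_mono[of "cmod w" 1 "cmod z"] mult_right_mono[of "cmod z" 1 "cmod w"] by auto
  have b: "1 - cmod z * cmod w \<le> cmod (1 - z * cnj w)"
    using norm_triangle_ineq2[of 1 "z * cnj w"] by (simp add: norm_mult)
  show "1 - cmod z \<le> cmod (1 - z * cnj w)" "1 - cmod w \<le> cmod (1 - z * cnj w)"
    using a b by linarith+
  then show "0 < cmod (1 - z * cnj w)" using assms by auto
  have "Re (z * cnj w) \<le> cmod z * cmod w"
    using complex_Re_le_cmod[of "z * cnj w"] by (simp only: norm_mult complex_mod_cnj)
  then show "0 < Re (1 - z * cnj w)" using a assms by (simp del: times_complex.sel)
  have "cmod (1 - z * cnj w) \<le> 1 + cmod z * cmod w"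
    using norm_triangle_ineq4[of 1 "z * cnj w"] by (simp add: norm_mult)
  then show "cmod (1 - z * cnj w) \<le> 2" using a assms by simp
qed

text \<open>With kernel exponent \<open>2 + \<alpha>\<close> and \<open>\<tau> = 0\<close> the power
  of \<open>rho\<close> left in \<open>submean_kernel\<close> is exactly the weight, and the kernel
  is replaced by its maximum, of order \<open>rho w powr (- (2 + \<alpha>))\<close>.\<close>

lemma bergman_pointwise_estimate:
  assumes p: "0 < p" and \<alpha>: "-1 < \<alpha>"
  shows "\<exists>C>0. \<forall>f w. f holomorphic_on unit_disk \<longrightarrow> w \<in> unit_disk \<longrightarrow>
    ennreal (cmod (f w) powr p) \<le> ennreal (C * rho w powr (- (2 + \<alpha>))) * bergman_mass p \<alpha> f"
proof -
  obtain C where C: "C > 0" "\<And>f w. f holomorphic_on unit_disk \<Longrightarrow> w \<in> unit_disk \<Longrightarrow>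
    ennreal (dens p (- 0) f w)
    \<le> ennreal C * (\<integral>\<^sup>+z. ennreal (dens p ((2 + \<alpha>) - 2 - 0) f z * kern (- (2 + \<alpha>)) w z)
        * indicator {z. 3 * cmod w - 1 \<le> 2 * cmod z} z \<partial>disk_area)"
    using submean_kernel[OF p, of "2 + \<alpha>" 0] \<alpha> by auto
  show ?thesis
  proof (intro exI[of _ "C * 2 powr (2 + \<alpha>)"] conjI allI impI)
    show "0 < C * 2 powr (2 + \<alpha>)" using C by simp
    fix f w assume f: "f holomorphic_on unit_disk" and w: "w \<in> unit_disk"
    have rw: "0 < rho w" by (rule rho_pos[OF w])
    have "ennreal (cmod (f w) powr p)
        \<le> ennreal C * (\<integral>\<^sup>+z. ennreal (dens p \<alpha> f z * kern (- (2 + \<alpha>)) w z)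
        * indicator {z. 3 * cmod w - 1 \<le> 2 * cmod z} z \<partial>disk_area)"
      using C(2)[OF f w] rw by simp
    also have "\<dots> \<le> ennreal C * (\<integral>\<^sup>+z. ennreal (2 powr (2 + \<alpha>) * rho w powr (- (2 + \<alpha>))) * ennreal (dens p \<alpha> f z) \<partial>disk_area)"
    proof (intro mult_left_mono nn_integral_mono)
      fix z assume "z \<in> space disk_area"
      then have z: "z \<in> unit_disk" by simp
      have "rho w / 2 \<le> cmod (1 - w * cnj z)"
        using kernel_lower_bound(1)[OF w z] rho_bounds(2)[OF w] by argo
      then have "kern (- (2 + \<alpha>)) w z \<le> (rho w / 2) powr (- (2 + \<alpha>))"
        using rw \<alpha> by (intro powr_mono2') auto
      also have "\<dots> = 2 powr (2 + \<alpha>) * rho w powr (- (2 + \<alpha>))"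
        using rw unfolding powr_minus by (simp add: powr_divide field_simps)
      finally have "dens p \<alpha> f z * kern (- (2 + \<alpha>)) w z
          \<le> cmod (f z) powr p * rho z powr \<alpha> * (2 powr (2 + \<alpha>) * rho w powr (- (2 + \<alpha>)))"
        by (rule mult_left_mono) simp
      then show "ennreal (dens p \<alpha> f z * kern (- (2 + \<alpha>)) w z)
        * indicator {z. 3 * cmod w - 1 \<le> 2 * cmod z} z
        \<le> ennreal (2 powr (2 + \<alpha>) * rho w powr (- (2 + \<alpha>))) * ennreal (dens p \<alpha> f z)"
        by (auto simp: ennreal_mult[symmetric] mult_ac indicator_def intro!: ennreal_leI)
    qed simp
    also have "\<dots> = ennreal C * (ennreal (2 powr (2 + \<alpha>) * rho w powr (- (2 + \<alpha>))) * bergman_mass p \<alpha> f)"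
      unfolding bergman_mass_def
      by (subst nn_integral_cmult)
        (intro measurable_compose[OF _ measurable_ennreal] measurable_bergman_integrand finite_borel_measure_disk_area
          borel_measurable_disk_area_continuous holomorphic_on_imp_continuous_on f, rule refl)
    also have "\<dots> = ennreal (C * 2 powr (2 + \<alpha>) * rho w powr (- (2 + \<alpha>))) * bergman_mass p \<alpha> f"
      using C by (simp add: ennreal_mult mult_ac)
    finally show "ennreal (cmod (f w) powr p)
      \<le> ennreal (C * 2 powr (2 + \<alpha>) * rho w powr (- (2 + \<alpha>))) * bergman_mass p \<alpha> f" .
  qed
qed

text \<open>The kernel condition on \<open>\<nu>\<close> replaces the usual condition on the measure of hyperbolic
  disks; its homogeneity is independent of the free exponent \<open>c\<close>.\<close>

lemma carleson_embedding:
  assumes p: "0 < p" "p \<le> s" and \<alpha>: "-1 < \<alpha>" and c: "0 < c"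
    and A: "A = (2 + \<alpha>) * s / p + \<sigma>"
  shows "\<exists>C>0. \<forall>\<nu> K R f m. finite_borel_measure_on_disk \<nu> \<longrightarrow> 0 \<le> K \<longrightarrow> f holomorphic_on unit_disk \<longrightarrow>
    (\<forall>z\<in>unit_disk. 3 * R - 1 \<le> 2 * cmod z \<longrightarrow>
      (\<integral>\<^sup>+w. ennreal (kern (- c) w z) \<partial>\<nu>) \<le> ennreal (K * rho z powr (A - c))) \<longrightarrow>
    0 \<le> m \<longrightarrow> bergman_mass p \<alpha> f \<le> ennreal m \<longrightarrow>
    (\<integral>\<^sup>+w. ennreal (dens s (- \<sigma>) f w) * indicator {w. R \<le> cmod w} w \<partial>\<nu>)
    \<le> ennreal (C * K * m powr ((s - p) / p)) *
      (\<integral>\<^sup>+z. ennreal (dens p \<alpha> f z) * indicator {z. 3 * R - 1 \<le> 2 * cmod z} z \<partial>disk_area)"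
proof -
  \<comment> \<open>Of the \<open>s\<close> powers of \<open>cmod (f w)\<close>,
    \<open>s - p\<close> are estimated pointwise, which costs
    \<open>rho w powr (- ((2 + \<alpha>) * ((s - p) / p)))\<close>, and the other \<open>p\<close>
    are averaged against the kernel. \<open>\<tau>\<close> collects all powers of \<open>rho\<close>
    at \<open>w\<close>.\<close>
  define \<tau> where "\<tau> = \<sigma> + (2 + \<alpha>) * ((s - p) / p)"
  have \<tau>: "A = \<tau> + (2 + \<alpha>)" using p by (simp add: A \<tau>_def field_simps)
  obtain C1 where C1: "C1 > 0" "\<And>f w. f holomorphic_on unit_disk \<Longrightarrow> w \<in> unit_disk \<Longrightarrow>
    ennreal (cmod (f w) powr p) \<le> ennreal (C1 * rho w powr (- (2 + \<alpha>))) * bergman_mass p \<alpha> f"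
    using bergman_pointwise_estimate[OF p(1) \<alpha>] by blast
  obtain C2 where C2: "C2 > 0" "\<And>f w. f holomorphic_on unit_disk \<Longrightarrow> w \<in> unit_disk \<Longrightarrow>
    ennreal (dens p (- \<tau>) f w)
    \<le> ennreal C2 * (\<integral>\<^sup>+z. ennreal (dens p (c - 2 - \<tau>) f z * kern (- c) w z)
        * indicator {z. 3 * cmod w - 1 \<le> 2 * cmod z} z \<partial>disk_area)"
    using submean_kernel[OF p(1) c, of \<tau>] by blast
  show ?thesis
  proof (intro exI[of _ "C1 powr ((s - p) / p) * C2"] conjI allI impI)
    show "0 < C1 powr ((s - p) / p) * C2" using C1 C2 by simp
    fix \<nu> :: "complex measure" and K R m :: real and f
    assume \<nu>: "finite_borel_measure_on_disk \<nu>" and K: "0 \<le> K" and f: "f holomorphic_on unit_disk"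
      and ker: "\<forall>z\<in>unit_disk. 3 * R - 1 \<le> 2 * cmod z \<longrightarrow>
        (\<integral>\<^sup>+w. ennreal (kern (- c) w z) \<partial>\<nu>) \<le> ennreal (K * rho z powr (A - c))"
      and m: "0 \<le> m" "bergman_mass p \<alpha> f \<le> ennreal m"
    define E where "E = {z :: complex. 3 * R - 1 \<le> 2 * cmod z}"
    have E: "E \<in> sets borel"
      unfolding E_def by (intro borel_closed closed_Collect_le continuous_intros)
    define B where "B = (C1 * m) powr ((s - p) / p)"
    define G where "G z = ennreal (dens p (c - 2 - \<tau>) f z) * indicator E z" for z
    have fm: "f \<in> borel_measurable disk_area"
      by (intro borel_measurable_disk_area_continuous holomorphic_on_imp_continuous_on f)
    have Gm: "G \<in> borel_measurable disk_area"
      unfolding G_def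
      by (intro borel_measurable_times_ennreal measurable_compose[OF _ measurable_ennreal]
          measurable_bergman_integrand finite_borel_measure_disk_area fm disk_area_measurableI borel_measurable_indicator E)
    have integrand: "ennreal (dens s (- \<sigma>) f w) * indicator {w. R \<le> cmod w} w
        \<le> ennreal (B * C2) * (\<integral>\<^sup>+z. G z * ennreal (kern (- c) w z) \<partial>disk_area)"
      if "w \<in> space \<nu>" for w
    proof (cases "R \<le> cmod w \<and> f w \<noteq> 0")
      case False
      then show ?thesis using p by (auto simp: indicator_def)
    next
      case True
      have w: "w \<in> unit_disk" using that space_disk_measure[OF \<nu>] by simp
      have rw: "0 < rho w" by (rule rho_pos[OF w])
      have "ennreal (cmod (f w) powr p) \<le> ennreal (C1 * rho w powr (- (2 + \<alpha>))) * ennreal m"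
        by (rule order_trans[OF C1(2)[OF f w] mult_left_mono[OF m(2)]]) simp
      then have "cmod (f w) powr p \<le> (C1 * m) * rho w powr (- (2 + \<alpha>))"
        using C1 m by (simp add: ennreal_mult[symmetric] mult_ac)
      then have "(cmod (f w) powr p) powr ((s - p) / p) \<le> ((C1 * m) * rho w powr (- (2 + \<alpha>))) powr ((s - p) / p)"
        using p by (intro powr_mono2) auto
      also have "(cmod (f w) powr p) powr ((s - p) / p) = cmod (f w) powr (s - p)"
        using p by (simp add: powr_powr)
      also have "((C1 * m) * rho w powr (- (2 + \<alpha>))) powr ((s - p) / p)
          = B * rho w powr (- ((2 + \<alpha>) * ((s - p) / p)))"
        using C1 m by (simp only: B_def powr_mult powr_powr mult_nonneg_nonneg powr_ge_zero less_imp_le mult_minus_left)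
      finally have 1: "cmod (f w) powr (s - p) \<le> B * rho w powr (- ((2 + \<alpha>) * ((s - p) / p)))" .
      have "dens s (- \<sigma>) f w
          = cmod (f w) powr (s - p) * (dens p (- \<sigma>) f w)"
        using True by (simp add: powr_add[symmetric] mult.assoc[symmetric])
      also have "\<dots> \<le> B * rho w powr (- ((2 + \<alpha>) * ((s - p) / p))) * (dens p (- \<sigma>) f w)"
        by (intro mult_right_mono 1) simp
      also have "\<dots> = B * (cmod (f w) powr p * (rho w powr (- ((2 + \<alpha>) * ((s - p) / p))) * rho w powr (- \<sigma>)))"
        by (simp only: mult_ac)
      also have "rho w powr (- ((2 + \<alpha>) * ((s - p) / p))) * rho w powr (- \<sigma>) = rho w powr (- \<tau>)"
        unfolding powr_add[symmetric] \<tau>_def by (rule arg_cong) simp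
      finally have "ennreal (dens s (- \<sigma>) f w)
          \<le> ennreal B * ennreal (dens p (- \<tau>) f w)"
        by (simp add: B_def ennreal_mult[symmetric] ennreal_leI)
      also have "\<dots> \<le> ennreal B * (ennreal C2 * (\<integral>\<^sup>+z. ennreal (dens p (c - 2 - \<tau>) f z * kern (- c) w z)
        * indicator {z. 3 * cmod w - 1 \<le> 2 * cmod z} z \<partial>disk_area))"
        by (intro mult_left_mono C2(2) f w) simp
      also have "\<dots> \<le> ennreal B * (ennreal C2 * (\<integral>\<^sup>+z. G z * ennreal (kern (- c) w z) \<partial>disk_area))"
      proof (intro mult_left_mono nn_integral_mono)
        fix z
        show "ennreal (dens p (c - 2 - \<tau>) f z * kern (- c) w z)
          * indicator {z. 3 * cmod w - 1 \<le> 2 * cmod z} z \<le> G z * ennreal (kern (- c) w z)"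
          using True by (auto simp: G_def E_def indicator_def ennreal_mult)
      qed auto
      finally show ?thesis
        using True C2(1) by (simp add: indicator_def B_def ennreal_mult mult.assoc)
    qed
    have "(\<integral>\<^sup>+w. ennreal (dens s (- \<sigma>) f w) * indicator {w. R \<le> cmod w} w \<partial>\<nu>)
        \<le> (\<integral>\<^sup>+w. ennreal (B * C2) * (\<integral>\<^sup>+z. G z * ennreal (kern (- c) w z) \<partial>disk_area) \<partial>\<nu>)"
      by (intro nn_integral_mono integrand)
    also have "\<dots> = (\<integral>\<^sup>+z. G z * (\<integral>\<^sup>+w. ennreal (B * C2) * ennreal (kern (- c) w z) \<partial>\<nu>) \<partial>disk_area)"
      by (intro disk_tonelli \<nu> finite_borel_measure_disk_area Gm) simp
    also have "\<dots> \<le> (\<integral>\<^sup>+z. ennreal (B * C2 * K) * (ennreal (dens p \<alpha> f z) * indicator E z) \<partial>disk_area)"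
    proof (rule nn_integral_mono)
      fix z assume "z \<in> space disk_area"
      then have z: "z \<in> unit_disk" by simp
      have id\<nu>: "(\<lambda>w. w) \<in> borel_measurable \<nu>"
        using \<nu> by (rule disk_measure_measurable) simp
      have "(\<integral>\<^sup>+w. ennreal (B * C2) * ennreal (kern (- c) w z) \<partial>\<nu>)
          = ennreal (B * C2) * (\<integral>\<^sup>+w. ennreal (kern (- c) w z) \<partial>\<nu>)"
        by (intro nn_integral_cmult measurable_kernel_comp id\<nu>) simp
      then have "G z * (\<integral>\<^sup>+w. ennreal (B * C2) * ennreal (kern (- c) w z) \<partial>\<nu>)
          = G z * (ennreal (B * C2) * (\<integral>\<^sup>+w. ennreal (kern (- c) w z) \<partial>\<nu>))"
        by (simp only:)
      \<comment> \<open>\<open>G\<close> vanishes off \<open>E\<close>, so the kernel condition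
        enters only on the annulus where it is assumed.\<close>
      also have "\<dots> \<le> G z * (ennreal (B * C2) * ennreal (K * rho z powr (A - c)))"
        using ker z by (cases "z \<in> E") (auto simp: G_def E_def intro!: mult_left_mono)
      also have "\<dots> \<le> ennreal (B * C2 * K) * (ennreal (dens p \<alpha> f z) * indicator E z)"
      proof -
        have "rho z powr (c - 2 - \<tau>) * rho z powr (A - c) = rho z powr \<alpha>"
          unfolding powr_add[symmetric] \<tau> by (rule arg_cong) simp
        then have eq: "(dens p (c - 2 - \<tau>) f z) * ((B * C2) * (K * rho z powr (A - c)))
            = B * C2 * K * (dens p \<alpha> f z)"
          by (simp add: mult_ac)
        have "0 \<le> B * C2" using C2 by (simp add: B_def)
        then show ?thesis
          using K by (auto simp: G_def indicator_def ennreal_mult[symmetric] eq)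
      qed
      finally show "G z * (\<integral>\<^sup>+w. ennreal (B * C2) * ennreal (kern (- c) w z) \<partial>\<nu>)
        \<le> ennreal (B * C2 * K) * (ennreal (dens p \<alpha> f z) * indicator E z)" .
    qed
    also have "\<dots> = ennreal (B * C2 * K) * (\<integral>\<^sup>+z. ennreal (dens p \<alpha> f z) * indicator E z \<partial>disk_area)"
      by (intro nn_integral_cmult borel_measurable_times_ennreal measurable_compose[OF _ measurable_ennreal]
          measurable_bergman_integrand finite_borel_measure_disk_area fm disk_area_measurableI borel_measurable_indicator E)
    also have "B * C2 * K = C1 powr ((s - p) / p) * C2 * K * m powr ((s - p) / p)"
      using C1 m by (simp add: B_def powr_mult)
    finally show "(\<integral>\<^sup>+w. ennreal (dens s (- \<sigma>) f w) * indicator {w. R \<le> cmod w} w \<partial>\<nu>)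
      \<le> ennreal (C1 powr ((s - p) / p) * C2 * K * m powr ((s - p) / p)) *
        (\<integral>\<^sup>+z. ennreal (dens p \<alpha> f z) * indicator {z. 3 * R - 1 \<le> 2 * cmod z} z \<partial>disk_area)"
      by (simp only: E_def)
  qed
qed

section \<open>Bergman norms and Toeplitz operators\<close>

lemma weight_nonneg: "-1 < \<alpha> \<Longrightarrow> 0 \<le> weight \<alpha> z"
  by (simp add: weight_eq)

lemma measurable_disk_area_holomorphic:
  "f holomorphic_on unit_disk \<Longrightarrow> f \<in> borel_measurable disk_area"
  by (intro borel_measurable_disk_area_continuous holomorphic_on_imp_continuous_on)

lemma measurable_mass_integrand:
  assumes "f \<in> borel_measurable disk_area"
  shows "(\<lambda>z. ennreal (dens p \<alpha> f z)) \<in> borel_measurable disk_area"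
  by (intro measurable_compose[OF _ measurable_ennreal] measurable_bergman_integrand
      finite_borel_measure_disk_area assms)

lemma nn_integral_weight:
  assumes "f \<in> borel_measurable disk_area" "-1 < \<alpha>"
  shows "(\<integral>\<^sup>+z. ennreal (cmod (f z) powr p * weight \<alpha> z) \<partial>disk_area) = ennreal (1 + \<alpha>) * bergman_mass p \<alpha> f"
proof -
  have "(\<integral>\<^sup>+z. ennreal (cmod (f z) powr p * weight \<alpha> z) \<partial>disk_area)
      = (\<integral>\<^sup>+z. ennreal (1 + \<alpha>) * ennreal (dens p \<alpha> f z) \<partial>disk_area)"
    using assms(2) by (intro nn_integral_cong) (simp add: weight_eq ennreal_mult[symmetric] mult_ac)
  also have "\<dots> = ennreal (1 + \<alpha>) * bergman_mass p \<alpha> f"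
    unfolding bergman_mass_def by (rule nn_integral_cmult[OF measurable_mass_integrand[OF assms(1)]])
  finally show ?thesis .
qed

lemma measurable_weight_integrand:
  assumes "f \<in> borel_measurable disk_area"
  shows "(\<lambda>z. cmod (f z) powr p * weight \<alpha> z) \<in> borel_measurable disk_area"
proof -
  have "(\<lambda>z. (1 + \<alpha>) * (dens p \<alpha> f z)) \<in> borel_measurable disk_area"
    by (intro borel_measurable_times borel_measurable_const measurable_bergman_integrand
      finite_borel_measure_disk_area assms)
  then show ?thesis by (simp add: weight_eq mult_ac)
qed

lemma bergman_space_iff:
  assumes "-1 < \<alpha>"
  shows "f \<in> bergman_space p \<alpha> \<longleftrightarrow> f holomorphic_on unit_disk \<and> bergman_mass p \<alpha> f < \<infinity>"
proof (cases "f holomorphic_on unit_disk")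
  case True
  note m = measurable_disk_area_holomorphic[OF True]
  have "integrable disk_area (\<lambda>z. cmod (f z) powr p * weight \<alpha> z) \<longleftrightarrow>
      (\<integral>\<^sup>+z. ennreal (cmod (f z) powr p * weight \<alpha> z) \<partial>disk_area) < \<infinity>"
    using measurable_weight_integrand[OF m, of p \<alpha>] weight_nonneg[OF assms]
    by (simp add: integrable_iff_bounded abs_mult)
  also have "\<dots> \<longleftrightarrow> bergman_mass p \<alpha> f < \<infinity>"
    unfolding nn_integral_weight[OF m assms] using assms by (auto simp: ennreal_mult_less_top)
  finally show ?thesis using True by (simp add: bergman_space_def)
qed (simp add: bergman_space_def)

lemma bergman_spaceD:
  assumes "f \<in> bergman_space p \<alpha>"
  shows "f holomorphic_on unit_disk"
  using assms by (simp add: bergman_space_def)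

lemma bergman_norm_nonneg: "0 \<le> bergman_norm p \<alpha> f"
  by (simp add: bergman_norm_def)

text \<open>Valid for infinite mass as well: \<open>enn2real\<close> then gives 0, and so does the
  Bochner integral of a non-integrable function.\<close>

lemma bergman_norm_eq:
  assumes "f \<in> borel_measurable disk_area" "-1 < \<alpha>"
  shows "bergman_norm p \<alpha> f = ((1 + \<alpha>) * enn2real (bergman_mass p \<alpha> f)) powr (1 / p)"
proof -
  have "(\<integral>z. cmod (f z) powr p * weight \<alpha> z \<partial>disk_area)
      = enn2real (\<integral>\<^sup>+z. ennreal (cmod (f z) powr p * weight \<alpha> z) \<partial>disk_area)"
    using measurable_weight_integrand[OF assms(1)] weight_nonneg[OF assms(2)]
    by (intro integral_eq_nn_integral) auto
  also have "\<dots> = (1 + \<alpha>) * enn2real (bergman_mass p \<alpha> f)"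
    unfolding nn_integral_weight[OF assms] using assms(2) by (simp add: enn2real_mult)
  finally show ?thesis by (simp add: bergman_norm_def)
qed

lemma bergman_mass_eq_norm:
  assumes "f \<in> bergman_space p \<alpha>" "0 < p" "-1 < \<alpha>"
  shows "bergman_mass p \<alpha> f = ennreal (bergman_norm p \<alpha> f powr p / (1 + \<alpha>))"
proof -
  have f: "f holomorphic_on unit_disk" "bergman_mass p \<alpha> f < \<infinity>"
    using assms by (simp_all add: bergman_space_iff)
  have "bergman_norm p \<alpha> f powr p = (1 + \<alpha>) * enn2real (bergman_mass p \<alpha> f)"
    using assms by (simp add: bergman_norm_eq measurable_disk_area_holomorphic f powr_powr)
  then show ?thesis using assms f(2) by simp
qed

lemma bergman_norm_le:
  assumes "f holomorphic_on unit_disk" "0 < p" "-1 < \<alpha>" "0 \<le> m" "bergman_mass p \<alpha> f \<le> ennreal m"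
  shows "f \<in> bergman_space p \<alpha>" "bergman_norm p \<alpha> f \<le> ((1 + \<alpha>) * m) powr (1 / p)"
proof -
  show "f \<in> bergman_space p \<alpha>"
    using assms by (auto simp: bergman_space_iff intro: order_le_less_trans)
  have "enn2real (bergman_mass p \<alpha> f) \<le> m"
    using enn2real_mono[OF assms(5)] assms(4) by simp
  then show "bergman_norm p \<alpha> f \<le> ((1 + \<alpha>) * m) powr (1 / p)"
    using assms by (subst bergman_norm_eq) (auto intro!: powr_mono2 mult_left_mono measurable_disk_area_holomorphic)
qed

text \<open>A substitute for convexity that holds for all positive exponents, below and above
  1.\<close>

lemma powr_add_le:
  fixes a b p :: real
  assumes "0 < p" "0 \<le> a" "0 \<le> b"
  shows "(a + b) powr p \<le> 2 powr p * (a powr p + b powr p)"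
proof -
  have "(a + b) powr p \<le> (2 * max a b) powr p"
    using assms by (intro powr_mono2) auto
  also have "\<dots> = 2 powr p * max a b powr p"
    using assms by (simp add: powr_mult)
  also have "max a b powr p \<le> a powr p + b powr p"
    by (auto simp: max_def)
  finally show ?thesis by simp
qed

lemma bergman_mass_diff:
  assumes "f \<in> borel_measurable disk_area" "g \<in> borel_measurable disk_area" "0 < p"
  shows "bergman_mass p \<alpha> (\<lambda>z. f z - g z) \<le> ennreal (2 powr p) * (bergman_mass p \<alpha> f + bergman_mass p \<alpha> g)"
proof -
  have "bergman_mass p \<alpha> (\<lambda>z. f z - g z)
      \<le> (\<integral>\<^sup>+z. ennreal (2 powr p) * (ennreal (dens p \<alpha> f z) + ennreal (dens p \<alpha> g z)) \<partial>disk_area)"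
    unfolding bergman_mass_def
  proof (rule nn_integral_mono)
    fix z
    have "cmod (f z - g z) powr p \<le> (cmod (f z) + cmod (g z)) powr p"
      using assms(3) by (intro powr_mono2 norm_triangle_ineq4) auto
    also have "\<dots> \<le> 2 powr p * (cmod (f z) powr p + cmod (g z) powr p)"
      using assms(3) by (intro powr_add_le) auto
    finally have "cmod (f z - g z) powr p * rho z powr \<alpha>
        \<le> 2 powr p * (cmod (f z) powr p + cmod (g z) powr p) * rho z powr \<alpha>"
      by (rule mult_right_mono) simp
    then show "ennreal (cmod (f z - g z) powr p * rho z powr \<alpha>)
        \<le> ennreal (2 powr p) * (ennreal (dens p \<alpha> f z) + ennreal (dens p \<alpha> g z))"
      by (simp add: ennreal_mult[symmetric] ennreal_plus[symmetric] algebra_simps ennreal_leI del: ennreal_plus)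
  qed
  also have "\<dots> = ennreal (2 powr p) * (bergman_mass p \<alpha> f + bergman_mass p \<alpha> g)"
    unfolding bergman_mass_def
    by (simp only: nn_integral_cmult nn_integral_add borel_measurable_add measurable_mass_integrand assms
        borel_measurable_add)
  finally show ?thesis .
qed

text \<open>A triangle inequality up to a constant, which serves the source space with
  \<open>p \<le> 1\<close> and the target space with \<open>q > 1\<close> alike. Its uses concern
  only boundedness and convergence to 0, so the constant is harmless.\<close>

lemma bergman_diff:
  assumes f: "f \<in> bergman_space p \<alpha>" and g: "g \<in> bergman_space p \<alpha>" and p: "0 < p" and \<alpha>: "-1 < \<alpha>"
  shows "(\<lambda>z. f z - g z) \<in> bergman_space p \<alpha>"
    and "bergman_norm p \<alpha> (\<lambda>z. f z - g z) \<le> 2 * 2 powr (1 / p) * (bergman_norm p \<alpha> f + bergman_norm p \<alpha> g)"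
proof -
  define a where "a = bergman_norm p \<alpha> f"
  define b where "b = bergman_norm p \<alpha> g"
  have ab: "0 \<le> a" "0 \<le> b" by (simp_all add: a_def b_def bergman_norm_nonneg)
  define m where "m = 2 powr p * (2 * (a + b) powr p / (1 + \<alpha>))"
  have m: "0 \<le> m" using \<alpha> by (simp add: m_def)
  have hol: "(\<lambda>z. f z - g z) holomorphic_on unit_disk"
    using bergman_spaceD[OF f] bergman_spaceD[OF g] by (rule holomorphic_on_diff)
  have "bergman_mass p \<alpha> (\<lambda>z. f z - g z) \<le> ennreal (2 powr p) * (bergman_mass p \<alpha> f + bergman_mass p \<alpha> g)"
    using f g p by (intro bergman_mass_diff measurable_disk_area_holomorphic bergman_spaceD)
  also have "\<dots> = ennreal (2 powr p * (a powr p / (1 + \<alpha>) + b powr p / (1 + \<alpha>)))"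
    using \<alpha> by (simp add: bergman_mass_eq_norm[OF f p \<alpha>] bergman_mass_eq_norm[OF g p \<alpha>] a_def b_def
        ennreal_mult ennreal_plus)
  also have "\<dots> \<le> ennreal m"
  proof -
    have "a powr p \<le> (a + b) powr p" "b powr p \<le> (a + b) powr p"
      using ab p by (auto intro: powr_mono2)
    then have "a powr p / (1 + \<alpha>) + b powr p / (1 + \<alpha>) \<le> 2 * (a + b) powr p / (1 + \<alpha>)"
      using \<alpha> by (simp add: add_divide_distrib[symmetric] divide_right_mono)
    then show ?thesis
      unfolding m_def by (intro ennreal_leI mult_left_mono) auto
  qed
  finally have le: "bergman_mass p \<alpha> (\<lambda>z. f z - g z) \<le> ennreal m" .
  show "(\<lambda>z. f z - g z) \<in> bergman_space p \<alpha>"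
    by (rule bergman_norm_le[OF hol p \<alpha> m le])
  have "bergman_norm p \<alpha> (\<lambda>z. f z - g z) \<le> ((1 + \<alpha>) * m) powr (1 / p)"
    by (rule bergman_norm_le[OF hol p \<alpha> m le])
  also have "(1 + \<alpha>) * m = 2 powr p * (2 * (a + b) powr p)"
    using \<alpha> by (simp add: m_def)
  also have "\<dots> powr (1 / p) = 2 * 2 powr (1 / p) * (a + b)"
    using ab p by (simp add: powr_mult powr_powr)
  finally show "bergman_norm p \<alpha> (\<lambda>z. f z - g z) \<le> 2 * 2 powr (1 / p) * (bergman_norm p \<alpha> f + bergman_norm p \<alpha> g)"
    by (simp add: a_def b_def)
qed

lemma bergman_norm_cong_AE:
  assumes "f \<in> borel_measurable disk_area" "g \<in> borel_measurable disk_area" "-1 < \<alpha>"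
    and "AE z in disk_area. f z = g z"
  shows "bergman_norm p \<alpha> f = bergman_norm p \<alpha> g"
proof -
  have "bergman_mass p \<alpha> f = bergman_mass p \<alpha> g"
    unfolding bergman_mass_def using assms(4) by (intro nn_integral_cong_AE) auto
  then show ?thesis by (simp add: bergman_norm_eq assms)
qed

lemma bergman_norm_eq_0_AE:
  assumes "f \<in> bergman_space p \<alpha>" "0 < p" "-1 < \<alpha>" "bergman_norm p \<alpha> f = 0"
  shows "AE z in disk_area. f z = 0"
proof -
  have "bergman_mass p \<alpha> f = 0"
    using bergman_mass_eq_norm[OF assms(1-3)] assms(4) by simp
  then have "AE z in disk_area. ennreal (dens p \<alpha> f z) = 0"
    unfolding bergman_mass_def
    by (subst (asm) nn_integral_0_iff_AE)
      (intro measurable_mass_integrand measurable_disk_area_holomorphic bergman_spaceD[OF assms(1)])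
  then show ?thesis
  proof (rule AE_mp, intro AE_I2 impI)
    fix z assume "z \<in> space disk_area" and 0: "ennreal (dens p \<alpha> f z) = 0"
    then have "0 < rho z" by (simp add: rho_pos)
    with 0 show "f z = 0" by (auto simp: ennreal_eq_0_iff mult_le_0_iff)
  qed
qed

lemma bergman_mass_bounded_function:
  assumes \<alpha>: "-1 < \<alpha>" and p: "0 < p"
  shows "\<exists>C>0. \<forall>f b. (\<forall>z\<in>unit_disk. cmod (f z) \<le> b) \<longrightarrow> bergman_mass p \<alpha> f \<le> ennreal (C * b powr p)"
proof -
  obtain C where C: "C \<ge> 0" "\<And>w. w \<in> unit_disk \<Longrightarrow>
    (\<integral>\<^sup>+z. ennreal (rho z powr \<alpha> * kern (- (3 + \<alpha>)) z w) \<partial>disk_area)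
    \<le> ennreal (C * rho w powr (2 + \<alpha> - (3 + \<alpha>)))"
    using disk_kernel_estimate[OF \<alpha>, of "3 + \<alpha>"] by auto
  \<comment> \<open>At \<open>w = 0\<close> the kernel is 1, so the kernel estimate contains the
    finiteness of the total weight.\<close>
  have total: "(\<integral>\<^sup>+z. ennreal (rho z powr \<alpha>) \<partial>disk_area) \<le> ennreal C"
    using C(2)[of 0] by (simp add: rho_def)
  show ?thesis
  proof (intro exI[of _ "C + 1"] conjI allI impI)
    show "0 < C + 1" using C by simp
    fix f :: "complex \<Rightarrow> complex" and b assume b: "\<forall>z\<in>unit_disk. cmod (f z) \<le> b"
    have "bergman_mass p \<alpha> f \<le> (\<integral>\<^sup>+z. ennreal (b powr p) * ennreal (rho z powr \<alpha>) \<partial>disk_area)"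
      unfolding bergman_mass_def
    proof (rule nn_integral_mono)
      fix z assume "z \<in> space disk_area"
      then have "cmod (f z) powr p \<le> b powr p"
        using b p by (intro powr_mono2) auto
      then show "ennreal (dens p \<alpha> f z) \<le> ennreal (b powr p) * ennreal (rho z powr \<alpha>)"
        by (simp add: ennreal_mult[symmetric] mult_right_mono ennreal_leI)
    qed
    also have "\<dots> = ennreal (b powr p) * (\<integral>\<^sup>+z. ennreal (rho z powr \<alpha>) \<partial>disk_area)"
      by (rule nn_integral_cmult) (intro disk_area_measurableI, measurable)
    also have "\<dots> \<le> ennreal (b powr p) * ennreal (C + 1)"
      using C(1) by (intro mult_left_mono order_trans[OF total]) (auto intro: ennreal_leI)
    also have "\<dots> = ennreal ((C + 1) * b powr p)"
      using C(1) by (simp add: ennreal_mult[symmetric] mult.commute del: ennreal_plus)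
    finally show "bergman_mass p \<alpha> f \<le> ennreal ((C + 1) * b powr p)" .
  qed
qed

section \<open>Norms of Toeplitz images\<close>

lemma cmod_powr_of_real: "cmod (z powr complex_of_real a) = cmod z powr a"
  by (simp add: norm_powr_real_powr')

text \<open>Where the integrand is not integrable, \<open>toeplitz\<close> takes the default value 0
  and the bound is trivial; it thus holds for arbitrary functions.\<close>

lemma cmod_toeplitz_le:
  "ennreal (cmod (toeplitz \<mu> \<beta> f z))
    \<le> (\<integral>\<^sup>+w. ennreal (cmod (f w) * kern (- (2 + \<beta>)) z w) \<partial>\<mu>)"
proof (cases "integrable \<mu> (\<lambda>w. f w / (1 - z * cnj w) powr complex_of_real (2 + \<beta>))")
  case True
  have "ennreal (cmod (toeplitz \<mu> \<beta> f z))
      \<le> (\<integral>\<^sup>+w. ennreal (cmod (f w / (1 - z * cnj w) powr complex_of_real (2 + \<beta>))) \<partial>\<mu>)"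
    unfolding toeplitz_def by (rule integral_norm_bound_ennreal[OF True])
  also have "\<dots> = (\<integral>\<^sup>+w. ennreal (cmod (f w) * kern (- (2 + \<beta>)) z w) \<partial>\<mu>)"
    by (simp only: norm_divide cmod_powr_of_real powr_minus_divide times_divide_eq_right mult_1_right)
  finally show ?thesis .
qed (simp add: toeplitz_def not_integrable_integral_eq)

text \<open>Minkowski's integral inequality for the kernel functions, in the form of the convexity
  inequality with respect to the measure \<open>cmod (f w) * rho w powr (- \<sigma>)\<close> times \<open>\<mu>\<close>; the
  \<open>L\<^sup>q\<close> norm of the kernel at \<open>w\<close> is comparable to \<open>rho w powr (- \<sigma>)\<close>.\<close>

lemma toeplitz_mass_bound:
  assumes q: "1 < q" and \<beta>: "-1 < \<beta>" and \<sigma>: "\<sigma> = (2 + \<beta>) * (1 - 1 / q)"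
  shows "\<exists>C>0. \<forall>\<mu> f L. finite_borel_measure_on_disk \<mu> \<longrightarrow> f \<in> borel_measurable \<mu> \<longrightarrow> 0 < L \<longrightarrow>
    (\<integral>\<^sup>+w. ennreal (cmod (f w) * rho w powr (- \<sigma>)) \<partial>\<mu>) \<le> ennreal L \<longrightarrow>
    bergman_mass q \<beta> (toeplitz \<mu> \<beta> f) \<le> ennreal (C * L powr q)"
proof -
  define \<gamma> where "\<gamma> = 2 + \<beta>"
  have \<gamma>1: "1 < \<gamma>" using \<beta> by (simp add: \<gamma>_def)
  have "\<gamma> * 1 < \<gamma> * q" using q \<gamma>1 by (intro mult_strict_left_mono) auto
  then have \<gamma>: "\<sigma> * q = \<gamma> * q - \<gamma>" "2 + \<beta> < \<gamma> * q"
    using q by (auto simp: \<gamma>_def \<sigma> field_simps)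
  obtain C where C: "C \<ge> 0" "\<And>w. w \<in> unit_disk \<Longrightarrow>
    (\<integral>\<^sup>+z. ennreal (rho z powr \<beta> * kern (- (\<gamma> * q)) z w) \<partial>disk_area)
    \<le> ennreal (C * rho w powr (2 + \<beta> - \<gamma> * q))"
    using disk_kernel_estimate[OF \<beta> \<gamma>(2)] by auto
  show ?thesis
  proof (intro exI[of _ "C + 1"] conjI allI impI)
    show "0 < C + 1" using C by simp
    fix \<mu> f and L :: real
    assume \<mu>: "finite_borel_measure_on_disk \<mu>" and f: "f \<in> borel_measurable \<mu>" and L: "0 < L"
      and I: "(\<integral>\<^sup>+w. ennreal (cmod (f w) * rho w powr (- \<sigma>)) \<partial>\<mu>) \<le> ennreal L"
    note mi = measurable_bergman_integrand[OF \<mu> f, of 1]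
    have id\<mu>: "(\<lambda>w. w) \<in> borel_measurable \<mu>" using \<mu> by (rule disk_measure_measurable) simp
    define k where "k w = ennreal (cmod (f w) * rho w powr (- \<sigma>))" for w
    have km: "k \<in> borel_measurable \<mu>"
      unfolding k_def using measurable_compose[OF mi measurable_ennreal] by simp
    define G where "G w = ennreal (cmod (f w) * rho w powr (- \<sigma> + \<sigma> * q))" for w
    have Gm: "G \<in> borel_measurable \<mu>"
      unfolding G_def using measurable_compose[OF mi measurable_ennreal] by simp
    have kerm: "(\<lambda>w. ennreal (kern a z w)) \<in> borel_measurable \<mu>" for z a
      by (intro measurable_kernel_comp id\<mu>) simp
    have pt: "ennreal (cmod (toeplitz \<mu> \<beta> f z) powr q)
        \<le> ennreal (L powr (q - 1)) * (\<integral>\<^sup>+w. G w * ennreal (kern (- (\<gamma> * q)) z w) \<partial>\<mu>)" (is "_ \<le> _ * ?J")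
      if z: "z \<in> unit_disk" for z
    proof (cases "?J = \<infinity>")
      case False
      then obtain j where j: "?J = ennreal j" "0 \<le> j"
        by (cases ?J rule: ennreal_cases) (simp_all only: infinity_ennreal_def simp_thms)
      define M where "M = cmod (toeplitz \<mu> \<beta> f z)"
      \<comment> \<open>With respect to the density \<open>k\<close>, whose total mass is at most
        \<open>L\<close>, the integral of \<open>h\<close> below dominates \<open>M\<close>. The
        tangent is taken at \<open>M / L\<close>, with the upper bound \<open>L\<close> in place of
        the true mass, so that any positive bound may serve.\<close>
      define m where "m = M / L"
      have m: "0 \<le> m" "M = m * L" using L by (simp_all add: m_def M_def)
      have "ennreal (q * m powr (q - 1)) * ennreal M
          \<le> ennreal (q * m powr (q - 1)) * (\<integral>\<^sup>+w. ennreal (cmod (f w) * kern (- \<gamma>) z w) \<partial>\<mu>)"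
        unfolding M_def \<gamma>_def by (intro mult_left_mono cmod_toeplitz_le) simp
      also have "\<dots> = (\<integral>\<^sup>+w. ennreal (q * m powr (q - 1)) * ennreal (cmod (f w) * kern (- \<gamma>) z w) \<partial>\<mu>)"
      proof (rule nn_integral_cmult[symmetric])
        have "(\<lambda>w. ennreal (cmod (f w)) * ennreal (kern (- \<gamma>) z w)) \<in> borel_measurable \<mu>"
          using f by (intro borel_measurable_times_ennreal kerm) measurable
        then show "(\<lambda>w. ennreal (cmod (f w) * kern (- \<gamma>) z w)) \<in> borel_measurable \<mu>"
          by (simp add: ennreal_mult)
      qed
      also have "\<dots> \<le> (\<integral>\<^sup>+w. G w * ennreal (kern (- (\<gamma> * q)) z w) + ennreal ((q - 1) * m powr q) * k w \<partial>\<mu>)"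
      proof (rule nn_integral_mono)
        fix w assume "w \<in> space \<mu>"
        then have w: "w \<in> unit_disk" by (simp add: space_disk_measure[OF \<mu>])
        define h where "h = rho w powr \<sigma> * kern (- \<gamma>) z w"
        have rw: "0 < rho w" by (rule rho_pos[OF w])
        have hq: "h powr q = rho w powr (\<sigma> * q) * kern (- (\<gamma> * q)) z w"
          by (simp add: h_def powr_mult powr_powr)
        have "q * m powr (q - 1) * h \<le> h powr q + (q - 1) * m powr q"
          using q m by (intro powr_tangent_le) (auto simp: h_def)
        then have "cmod (f w) * rho w powr (- \<sigma>) * (q * m powr (q - 1) * h)
            \<le> cmod (f w) * rho w powr (- \<sigma>) * (h powr q + (q - 1) * m powr q)"
          by (rule mult_left_mono) simp
        also have "cmod (f w) * rho w powr (- \<sigma>) * (q * m powr (q - 1) * h)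
            = q * m powr (q - 1) * (cmod (f w) * kern (- \<gamma>) z w)"
          using rw by (simp add: h_def powr_minus)
        also have "cmod (f w) * rho w powr (- \<sigma>) * (h powr q + (q - 1) * m powr q)
            = (cmod (f w) * (rho w powr (- \<sigma>) * rho w powr (\<sigma> * q))) * kern (- (\<gamma> * q)) z w
              + (q - 1) * m powr q * (cmod (f w) * rho w powr (- \<sigma>))"
          unfolding hq by (simp only: distrib_left mult_ac)
        also have "rho w powr (- \<sigma>) * rho w powr (\<sigma> * q) = rho w powr (- \<sigma> + \<sigma> * q)"
          by (simp only: powr_add)
        finally have "ennreal (q * m powr (q - 1) * (cmod (f w) * kern (- \<gamma>) z w))
          \<le> ennreal (cmod (f w) * rho w powr (- \<sigma> + \<sigma> * q) * kern (- (\<gamma> * q)) z w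
              + (q - 1) * m powr q * (cmod (f w) * rho w powr (- \<sigma>)))"
          by (rule ennreal_leI)
        then show "ennreal (q * m powr (q - 1)) * ennreal (cmod (f w) * kern (- \<gamma>) z w)
          \<le> G w * ennreal (kern (- (\<gamma> * q)) z w) + ennreal ((q - 1) * m powr q) * k w"
          using q unfolding G_def k_def
          by (subst ennreal_mult[symmetric] ennreal_plus[symmetric], simp, simp)+ simp
      qed
      also have "\<dots> = ?J + ennreal ((q - 1) * m powr q) * (\<integral>\<^sup>+w. k w \<partial>\<mu>)"
        by (subst nn_integral_add) (intro borel_measurable_times_ennreal borel_measurable_const Gm km kerm
            | simp add: nn_integral_cmult km)+
      also have "\<dots> \<le> ennreal j + ennreal ((q - 1) * m powr q) * ennreal L"
        unfolding j(1) using I by (intro add_left_mono mult_left_mono) (simp_all add: k_def)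
      finally have "q * m powr (q - 1) * M \<le> j + (q - 1) * m powr q * L"
        using q L j(2) by (simp add: ennreal_mult[symmetric] ennreal_plus[symmetric] M_def del: ennreal_plus)
      moreover have "q * m powr (q - 1) * M = q * m powr q * L"
      proof -
        have "m powr (q - 1) * m = m powr q"
          using powr_mult_base[OF m(1), of "q - 1"] by (simp add: mult.commute)
        moreover have "q * m powr (q - 1) * M = q * (m powr (q - 1) * m) * L"
          unfolding m(2) by (simp only: mult_ac)
        ultimately show ?thesis by (simp only:)
      qed
      ultimately have "q * m powr q * L \<le> j + (q - 1) * m powr q * L" by (simp only:)
      then have "m powr q * L \<le> j" by (simp add: algebra_simps)
      then have "L powr (q - 1) * (m powr q * L) \<le> L powr (q - 1) * j"
        by (rule mult_left_mono) simp
      moreover have "L powr (q - 1) * (m powr q * L) = M powr q"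
        using L by (simp add: m_def powr_divide powr_diff M_def)
      ultimately show ?thesis
        unfolding j(1) using j(2) by (simp add: M_def ennreal_mult[symmetric] ennreal_leI)
    next
      case True
      then show ?thesis using L by (simp add: ennreal_mult_top)
    qed
    define D where "D = L powr (q - 1)"
    have "bergman_mass q \<beta> (toeplitz \<mu> \<beta> f)
        \<le> (\<integral>\<^sup>+z. ennreal (D * rho z powr \<beta>) * (\<integral>\<^sup>+w. G w * ennreal (kern (- (\<gamma> * q)) z w) \<partial>\<mu>) \<partial>disk_area)"
      unfolding bergman_mass_def
    proof (rule nn_integral_mono)
      fix z assume "z \<in> space disk_area"
      then have z: "z \<in> unit_disk" by simp
      show "ennreal (cmod (toeplitz \<mu> \<beta> f z) powr q * rho z powr \<beta>)
        \<le> ennreal (D * rho z powr \<beta>) * (\<integral>\<^sup>+w. G w * ennreal (kern (- (\<gamma> * q)) z w) \<partial>\<mu>)"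
        using mult_left_mono[OF pt[OF z], of "ennreal (rho z powr \<beta>)"]
        by (simp add: ennreal_mult D_def mult_ac)
    qed
    also have "\<dots> = (\<integral>\<^sup>+w. G w * (\<integral>\<^sup>+z. ennreal (D * rho z powr \<beta>) * ennreal (kern (- (\<gamma> * q)) z w) \<partial>disk_area) \<partial>\<mu>)"
      by (intro disk_tonelli \<mu> finite_borel_measure_disk_area Gm disk_area_measurableI) measurable
    also have "\<dots> \<le> (\<integral>\<^sup>+w. ennreal (D * C) * k w \<partial>\<mu>)"
    proof (rule nn_integral_mono)
      fix w assume "w \<in> space \<mu>"
      then have w: "w \<in> unit_disk" by (simp add: space_disk_measure[OF \<mu>])
      have rw: "0 < rho w" by (rule rho_pos[OF w])
      have "(\<integral>\<^sup>+z. ennreal (D * rho z powr \<beta>) * ennreal (kern (- (\<gamma> * q)) z w) \<partial>disk_area)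
          = (\<integral>\<^sup>+z. ennreal D * ennreal (rho z powr \<beta> * kern (- (\<gamma> * q)) z w) \<partial>disk_area)"
        by (simp add: ennreal_mult D_def mult.assoc)
      also have "\<dots> = ennreal D * (\<integral>\<^sup>+z. ennreal (rho z powr \<beta> * kern (- (\<gamma> * q)) z w) \<partial>disk_area)"
        by (intro nn_integral_cmult disk_area_measurableI) measurable
      finally have "G w * (\<integral>\<^sup>+z. ennreal (D * rho z powr \<beta>) * ennreal (kern (- (\<gamma> * q)) z w) \<partial>disk_area)
          \<le> G w * (ennreal D * ennreal (C * rho w powr (2 + \<beta> - \<gamma> * q)))"
        using C(2)[OF w] by (simp only: mult_left_mono zero_le)
      also have "\<dots> = ennreal (D * C * (cmod (f w) * (rho w powr (- \<sigma> + \<sigma> * q) * rho w powr (2 + \<beta> - \<gamma> * q))))"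
        using C(1) by (simp add: G_def D_def ennreal_mult[symmetric] mult_ac)
      \<comment> \<open>The power \<open>\<sigma> * q\<close> that \<open>G\<close> carries is
        cancelled by the kernel estimate: \<open>\<sigma> * q = \<gamma> * q - \<gamma>\<close> and
        \<open>\<gamma> = 2 + \<beta>\<close>.\<close>
      also have "rho w powr (- \<sigma> + \<sigma> * q) * rho w powr (2 + \<beta> - \<gamma> * q) = rho w powr (- \<sigma>)"
        unfolding powr_add[symmetric] using \<gamma>(1) by (intro arg_cong[of _ _ "\<lambda>x. rho w powr x"]) (simp add: \<gamma>_def)
      finally show "G w * (\<integral>\<^sup>+z. ennreal (D * rho z powr \<beta>) * ennreal (kern (- (\<gamma> * q)) z w) \<partial>disk_area)
          \<le> ennreal (D * C) * k w"
        using C(1) by (simp add: k_def D_def ennreal_mult)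
    qed
    also have "\<dots> = ennreal (D * C) * (\<integral>\<^sup>+w. k w \<partial>\<mu>)" by (rule nn_integral_cmult[OF km])
    also have "\<dots> \<le> ennreal (D * C) * ennreal L"
      using I by (intro mult_left_mono) (simp_all add: k_def)
    also have "\<dots> = ennreal (C * (L powr (q - 1) * L))"
      using C(1) L by (simp add: D_def ennreal_mult[symmetric] mult_ac)
    also have "L powr (q - 1) * L = L powr q"
      using powr_mult_base[of L "q - 1"] L by (simp add: mult.commute)
    also have "ennreal (C * L powr q) \<le> ennreal ((C + 1) * L powr q)"
      by (intro ennreal_leI mult_right_mono) auto
    finally show "bergman_mass q \<beta> (toeplitz \<mu> \<beta> f) \<le> ennreal ((C + 1) * L powr q)" .
  qed
qed

section \<open>Derivatives of Toeplitz images\<close>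

lemma toeplitz_kernel_not_nonpos:
  assumes "z \<in> unit_disk" "w \<in> unit_disk"
  shows "1 - z * cnj w \<notin> \<real>\<^sub>\<le>\<^sub>0"
  using kernel_lower_bound(4)[OF assms] by (auto simp: complex_nonpos_Reals_iff)

lemma toeplitz_kernel_nonzero:
  assumes "z \<in> unit_disk" "w \<in> unit_disk"
  shows "1 - z * cnj w \<noteq> 0"
  using kernel_lower_bound(3)[OF assms] by auto

lemma measurable_toeplitz_kernel:
  assumes "finite_borel_measure_on_disk \<mu>" "z \<in> unit_disk"
  shows "(\<lambda>w. (1 - z * cnj w) powr c) \<in> borel_measurable \<mu>"
proof -
  have "continuous_on unit_disk (\<lambda>w. (1 - z * cnj w) powr c)"
  proof (rule continuous_on_powr_complex)
    show "unit_disk \<subseteq> {w. 0 \<le> Re (1 - z * cnj w) \<or> Im (1 - z * cnj w) \<noteq> 0}"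
      by (intro subsetI CollectI disjI1 less_imp_le kernel_lower_bound(4) assms(2))
    show "0 < Re c" if "w \<in> unit_disk" "1 - z * cnj w = 0" for w
      using toeplitz_kernel_nonzero[OF assms(2) that(1)] that(2) by contradiction
  qed (intro continuous_intros)+
  from borel_measurable_continuous_on_restrict[OF this] assms(1) show ?thesis
    by (simp add: finite_borel_measure_on_disk_def cong: measurable_cong_sets)
qed

lemma integrable_toeplitz:
  assumes \<mu>: "finite_borel_measure_on_disk \<mu>" and h: "integrable \<mu> h" and z: "z \<in> unit_disk"
  shows "integrable \<mu> (\<lambda>w. h w * (1 - z * cnj w) powr complex_of_real c)"
proof (rule Bochner_Integration.integrable_bound)
  \<comment> \<open>The first term bounds the kernel for negative exponents, the second for the
    others.\<close>
  define B where "B = (1 - cmod z) powr c + 2 powr c"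
  show "integrable \<mu> (\<lambda>w. B * norm (h w))"
    using h by simp
  show "(\<lambda>w. h w * (1 - z * cnj w) powr complex_of_real c) \<in> borel_measurable \<mu>"
    by (intro borel_measurable_times measurable_toeplitz_kernel \<mu> z borel_measurable_integrable h)
  show "AE w in \<mu>. norm (h w * (1 - z * cnj w) powr complex_of_real c) \<le> norm (B * norm (h w))"
  proof (rule AE_I2)
    fix w assume "w \<in> space \<mu>"
    then have w: "w \<in> unit_disk" by (simp add: space_disk_measure[OF \<mu>])
    have k: "1 - cmod z \<le> cmod (1 - z * cnj w)" "cmod (1 - z * cnj w) \<le> 2"
      using kernel_lower_bound[OF z w] by auto
    have "kern c z w \<le> B"
    proof (cases "0 \<le> c")
      case True
      have "kern c z w \<le> 2 powr c"
        using True k by (intro powr_mono2) auto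
      then show ?thesis by (simp add: B_def add_increasing)
    next
      case False
      have "kern c z w \<le> (1 - cmod z) powr c"
        using False k z by (intro powr_mono2') auto
      then show ?thesis by (simp add: B_def add_increasing2)
    qed
    then have "cmod (h w) * kern c z w \<le> cmod (h w) * B"
      by (intro mult_left_mono) auto
    moreover have "0 \<le> B" by (simp add: B_def)
    ultimately show "norm (h w * (1 - z * cnj w) powr complex_of_real c) \<le> norm (B * norm (h w))"
      by (simp add: norm_mult cmod_powr_of_real mult.commute)
  qed
qed

lemma toeplitz_eq:
  "toeplitz \<mu> b h z = (\<integral>w. h w * (1 - z * cnj w) powr complex_of_real (- (2 + b)) \<partial>\<mu>)"
  unfolding toeplitz_def of_real_minus powr_minus_divide by simp

text \<open>The remainder is uniform in \<open>w\<close>, so it can be integrated and yields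
  differentiation under the integral sign. Halving the distance to the circle keeps the second
  derivative of the kernel bounded on the disk around \<open>z0\<close>.\<close>

lemma toeplitz_kernel_Taylor:
  assumes w: "w \<in> unit_disk" and z0: "z0 \<in> unit_disk" and z: "z \<in> ball z0 ((1 - cmod z0) / 2)" and \<gamma>: "0 < \<gamma>"
  defines "E \<equiv> \<lambda>c z. (1 - z * cnj w) powr complex_of_real c"
  shows "cmod (E (- \<gamma>) z - E (- \<gamma>) z0 - of_real \<gamma> * cnj w * E (- \<gamma> - 1) z0 * (z - z0))
    \<le> \<gamma> * (\<gamma> + 1) * ((1 - cmod z0) / 2) powr (- \<gamma> - 2) * cmod (z - z0) ^ 2"
proof -
  define r where "r = (1 - cmod z0) / 2"
  have r: "0 < r" using z0 by (simp add: r_def)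
  define F where "F i = (if i = 0 then E (- \<gamma>)
    else if i = 1 then (\<lambda>z. of_real \<gamma> * cnj w * E (- \<gamma> - 1) z)
    else (\<lambda>z. of_real (\<gamma> * (\<gamma> + 1)) * (cnj w)\<^sup>2 * E (- \<gamma> - 2) z))" for i :: nat
  have ball: "x \<in> unit_disk \<and> r \<le> 1 - cmod x" if "x \<in> ball z0 r" for x
  proof -
    have "cmod x \<le> cmod z0 + cmod (x - z0)" using norm_triangle_sub by blast
    then have "cmod x < cmod z0 + r" using that by (simp add: dist_norm norm_minus_commute)
    then show ?thesis using z0 by (simp add: r_def field_simps)
  qed
  have E: "(E c has_field_derivative - (of_real c * cnj w * E (c - 1) x)) (at x)" if "x \<in> unit_disk" for c x
    unfolding E_def using toeplitz_kernel_not_nonpos[OF that w]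
    by (auto intro!: derivative_eq_intros simp: field_simps)
  have "cmod (F 0 z - (\<Sum>i\<le>1. F i z0 * (z - z0) ^ i / fact i))
      \<le> (\<gamma> * (\<gamma> + 1) * r powr (- \<gamma> - 2)) * cmod (z - z0) ^ Suc 1 / fact 1"
  proof (rule field_Taylor[of "ball z0 r"])
    fix i x assume x: "x \<in> ball z0 r" and i: "i \<le> (1 :: nat)"
    have xd: "x \<in> unit_disk" using ball[OF x] by simp
    have "(F i has_field_derivative F (Suc i) x) (at x)"
    proof (cases "i = 0")
      case True
      then show ?thesis using E[OF xd, of "- \<gamma>"] by (simp add: F_def)
    next
      case False
      then have "i = 1" using i by simp
      then show ?thesis
        using DERIV_cmult[OF E[OF xd, of "- \<gamma> - 1"], of "of_real \<gamma> * cnj w"]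
        by (simp add: F_def power2_eq_square algebra_simps)
    qed
    then show "(F i has_field_derivative F (Suc i) x) (at x within ball z0 r)"
      by (rule has_field_derivative_at_within)
  next
    fix x assume x: "x \<in> ball z0 r"
    have xd: "x \<in> unit_disk" "r \<le> 1 - cmod x" using ball[OF x] by auto
    have "kern (- \<gamma> - 2) x w \<le> r powr (- \<gamma> - 2)"
      using kernel_lower_bound(1)[OF xd(1) w] xd(2) r \<gamma> by (intro powr_mono2') auto
    moreover have "cmod w ^ 2 \<le> 1" using w by (simp add: power_le_one)
    ultimately have "(\<gamma> * (\<gamma> + 1) * cmod w ^ 2) * kern (- \<gamma> - 2) x w
        \<le> (\<gamma> * (\<gamma> + 1) * 1) * r powr (- \<gamma> - 2)"
      using \<gamma> by (intro mult_mono mult_left_mono) auto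
    then show "cmod (F (Suc 1) x) \<le> \<gamma> * (\<gamma> + 1) * r powr (- \<gamma> - 2)"
      using \<gamma> by (simp add: F_def E_def norm_mult norm_power cmod_powr_of_real del: of_real_mult of_real_diff of_real_minus)
  qed (use r z in \<open>auto simp: r_def\<close>)
  then show ?thesis
    by (simp add: F_def r_def power2_eq_square diff_diff_eq)
qed

text \<open>A derivative raises the kernel exponent by 1 and multiplies the function by
  \<open>cnj w\<close>. The result is again a Toeplitz integral, with index \<open>b + 1\<close>, so
  that the rule can be iterated.\<close>

lemma toeplitz_has_field_derivative:
  assumes \<mu>: "finite_borel_measure_on_disk \<mu>" and h: "integrable \<mu> h" and z0: "z0 \<in> unit_disk" and b: "-2 < b"
  shows "(toeplitz \<mu> b h has_field_derivative of_real (2 + b) * toeplitz \<mu> (b + 1) (\<lambda>w. cnj w * h w) z0) (at z0)"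
proof -
  define r where "r = (1 - cmod z0) / 2"
  have r: "0 < r" using z0 by (simp add: r_def)
  define \<gamma> where "\<gamma> = 2 + b"
  have \<gamma>: "0 < \<gamma>" using b by (simp add: \<gamma>_def)
  define E where "E c z w = (1 - z * cnj w) powr complex_of_real c" for c z w
  define B where "B = \<gamma> * (\<gamma> + 1) * r powr (- \<gamma> - 2)"
  define D where "D = of_real \<gamma> * toeplitz \<mu> (b + 1) (\<lambda>w. cnj w * h w) z0"
  define N where "N = (\<integral>w. norm (h w) \<partial>\<mu>)"
  have hc: "integrable \<mu> (\<lambda>w. cnj w * h w)"
  proof (rule Bochner_Integration.integrable_bound[OF h])
    show "(\<lambda>w. cnj w * h w) \<in> borel_measurable \<mu>"
      by (intro borel_measurable_times disk_measure_measurable[OF \<mu>] borel_measurable_cnj borel_measurable_integrable h)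
    show "AE w in \<mu>. norm (cnj w * h w) \<le> norm (h w)"
      by (rule AE_I2) (simp add: space_disk_measure[OF \<mu>] norm_mult mult_left_le_one_le)
  qed
  have bound: "cmod (toeplitz \<mu> b h z - toeplitz \<mu> b h z0 - D * (z - z0)) \<le> B * N * cmod (z - z0) ^ 2"
    if z: "z \<in> ball z0 r" for z
  proof -
    have "cmod z \<le> cmod z0 + cmod (z - z0)" using norm_triangle_sub by blast
    then have "cmod z < cmod z0 + r" using z by (simp add: dist_norm norm_minus_commute)
    then have zd: "z \<in> unit_disk" using z0 by (simp add: r_def field_simps)
    have i1: "integrable \<mu> (\<lambda>w. h w * E (- \<gamma>) z w)" "integrable \<mu> (\<lambda>w. h w * E (- \<gamma>) z0 w)"
      unfolding E_def by (intro integrable_toeplitz \<mu> h zd z0)+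
    have i2: "integrable \<mu> (\<lambda>w. (cnj w * h w) * E (- \<gamma> - 1) z0 w)"
      unfolding E_def by (intro integrable_toeplitz \<mu> hc z0)
    have e1: "toeplitz \<mu> b h z = (\<integral>w. h w * E (- \<gamma>) z w \<partial>\<mu>)" "toeplitz \<mu> b h z0 = (\<integral>w. h w * E (- \<gamma>) z0 w \<partial>\<mu>)"
      by (simp_all add: toeplitz_eq E_def \<gamma>_def)
    have "- (2 + (b + 1)) = - \<gamma> - 1" by (simp add: \<gamma>_def)
    then have e2: "toeplitz \<mu> (b + 1) (\<lambda>w. cnj w * h w) z0 = (\<integral>w. (cnj w * h w) * E (- \<gamma> - 1) z0 w \<partial>\<mu>)"
      by (simp only: toeplitz_eq E_def)
    have eq: "toeplitz \<mu> b h z - toeplitz \<mu> b h z0 - D * (z - z0)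
        = (\<integral>w. h w * E (- \<gamma>) z w - h w * E (- \<gamma>) z0 w - of_real \<gamma> * (z - z0) * ((cnj w * h w) * E (- \<gamma> - 1) z0 w) \<partial>\<mu>)"
    proof -
      have "(\<integral>w. h w * E (- \<gamma>) z w - h w * E (- \<gamma>) z0 w - of_real \<gamma> * (z - z0) * ((cnj w * h w) * E (- \<gamma> - 1) z0 w) \<partial>\<mu>)
          = (\<integral>w. h w * E (- \<gamma>) z w \<partial>\<mu>) - (\<integral>w. h w * E (- \<gamma>) z0 w \<partial>\<mu>)
            - of_real \<gamma> * (z - z0) * (\<integral>w. (cnj w * h w) * E (- \<gamma> - 1) z0 w \<partial>\<mu>)"
        by (simp only: Bochner_Integration.integral_diff i1 i2 Bochner_Integration.integrable_diff
            integrable_mult_right integral_mult_right_zero)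
      then show ?thesis
        unfolding D_def e1 e2 by (simp only: mult_ac)
    qed
    have "cmod (toeplitz \<mu> b h z - toeplitz \<mu> b h z0 - D * (z - z0)) \<le> (\<integral>w. B * cmod (z - z0) ^ 2 * norm (h w) \<partial>\<mu>)"
      unfolding eq
    proof (rule Bochner_Integration.integral_norm_bound_integral)
      show "integrable \<mu> (\<lambda>w. h w * E (- \<gamma>) z w - h w * E (- \<gamma>) z0 w - of_real \<gamma> * (z - z0) * ((cnj w * h w) * E (- \<gamma> - 1) z0 w))"
        by (intro Bochner_Integration.integrable_diff i1 integrable_mult_right i2)
      show "integrable \<mu> (\<lambda>w. B * cmod (z - z0) ^ 2 * norm (h w))" using h by simp
      fix w assume "w \<in> space \<mu>"
      then have w: "w \<in> unit_disk" by (simp add: space_disk_measure[OF \<mu>])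
      have eq: "h w * E (- \<gamma>) z w - h w * E (- \<gamma>) z0 w - of_real \<gamma> * (z - z0) * ((cnj w * h w) * E (- \<gamma> - 1) z0 w)
          = h w * (E (- \<gamma>) z w - E (- \<gamma>) z0 w - of_real \<gamma> * cnj w * E (- \<gamma> - 1) z0 w * (z - z0))"
        by (simp only: algebra_simps)
      have "cmod (E (- \<gamma>) z w - E (- \<gamma>) z0 w - of_real \<gamma> * cnj w * E (- \<gamma> - 1) z0 w * (z - z0))
          \<le> B * cmod (z - z0) ^ 2"
        unfolding B_def r_def E_def by (rule toeplitz_kernel_Taylor[OF w z0 z[unfolded r_def] \<gamma>])
      then have "cmod (h w) * cmod (E (- \<gamma>) z w - E (- \<gamma>) z0 w - of_real \<gamma> * cnj w * E (- \<gamma> - 1) z0 w * (z - z0))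
          \<le> cmod (h w) * (B * cmod (z - z0) ^ 2)"
        by (rule mult_left_mono) simp
      then show "cmod (h w * E (- \<gamma>) z w - h w * E (- \<gamma>) z0 w - of_real \<gamma> * (z - z0) * ((cnj w * h w) * E (- \<gamma> - 1) z0 w))
          \<le> B * cmod (z - z0) ^ 2 * norm (h w)"
        unfolding eq norm_mult[of "h w"] by (simp only: mult_ac)
    qed
    also have "\<dots> = B * N * cmod (z - z0) ^ 2"
      unfolding N_def integral_mult_right_zero by (simp only: mult_ac)
    finally show ?thesis .
  qed
  have "((\<lambda>z. (toeplitz \<mu> b h z - toeplitz \<mu> b h z0) / (z - z0) - D) \<longlongrightarrow> 0) (at z0)"
  proof (rule Lim_null_comparison)
    show "\<forall>\<^sub>F z in at z0. norm ((toeplitz \<mu> b h z - toeplitz \<mu> b h z0) / (z - z0) - D) \<le> B * N * cmod (z - z0)"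
      unfolding eventually_at
    proof (intro exI[of _ r] conjI ballI impI)
      fix z assume z: "z \<noteq> z0 \<and> dist z z0 < r"
      then have "cmod (toeplitz \<mu> b h z - toeplitz \<mu> b h z0 - D * (z - z0)) \<le> B * N * cmod (z - z0) ^ 2"
        by (intro bound) (simp add: dist_commute)
      moreover have "(toeplitz \<mu> b h z - toeplitz \<mu> b h z0) / (z - z0) - D
          = (toeplitz \<mu> b h z - toeplitz \<mu> b h z0 - D * (z - z0)) / (z - z0)"
        using z by (simp add: field_simps)
      ultimately show "norm ((toeplitz \<mu> b h z - toeplitz \<mu> b h z0) / (z - z0) - D) \<le> B * N * cmod (z - z0)"
        using z by (simp add: norm_divide power2_eq_square pos_divide_le_eq mult.assoc)
    qed (use r in auto)
    have "((\<lambda>z. B * N * cmod (z - z0)) \<longlongrightarrow> B * N * cmod (z0 - z0)) (at z0)"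
      by (intro tendsto_intros)
    then show "((\<lambda>z. B * N * cmod (z - z0)) \<longlongrightarrow> 0) (at z0)" by simp
  qed
  then have "((\<lambda>z. (toeplitz \<mu> b h z - toeplitz \<mu> b h z0) / (z - z0)) \<longlongrightarrow> D) (at z0)"
    by (rule LIM_zero_cancel)
  then show ?thesis
    by (simp add: has_field_derivative_iff D_def \<gamma>_def)
qed

lemma toeplitz_holomorphic:
  assumes "finite_borel_measure_on_disk \<mu>" "integrable \<mu> h" "-2 < b"
  shows "toeplitz \<mu> b h holomorphic_on unit_disk"
  unfolding holomorphic_on_open[OF open_ball]
  by (intro ballI exI, rule toeplitz_has_field_derivative[OF assms(1,2) _ assms(3)])

lemma integrable_cnj_power_times:
  assumes \<mu>: "finite_borel_measure_on_disk \<mu>" and h: "integrable \<mu> h"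
  shows "integrable \<mu> (\<lambda>w. cnj w ^ N * h w)"
proof (rule Bochner_Integration.integrable_bound[OF h])
  show "(\<lambda>w. cnj w ^ N * h w) \<in> borel_measurable \<mu>"
    by (intro borel_measurable_times borel_measurable_power disk_measure_measurable[OF \<mu>]
        borel_measurable_cnj borel_measurable_integrable h)
  show "AE w in \<mu>. norm (cnj w ^ N * h w) \<le> norm (h w)"
    by (rule AE_I2) (simp add: space_disk_measure[OF \<mu>] norm_mult norm_power mult_left_le_one_le power_le_one)
qed

text \<open>Each differentiation contributes the current kernel exponent as a factor, whence the
  Pochhammer symbol.\<close>

lemma higher_deriv_toeplitz:
  assumes \<mu>: "finite_borel_measure_on_disk \<mu>" and h: "integrable \<mu> h" and b: "-2 < b" and z: "z \<in> unit_disk"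
  shows "(deriv ^^ N) (toeplitz \<mu> b h) z
    = of_real (pochhammer (2 + b) N) * toeplitz \<mu> (b + N) (\<lambda>w. cnj w ^ N * h w) z"
  using z
proof (induction N arbitrary: z)
  case (Suc N)
  have "(deriv ^^ Suc N) (toeplitz \<mu> b h) z = deriv ((deriv ^^ N) (toeplitz \<mu> b h)) z"
    by simp
  also have "\<dots> = deriv (\<lambda>z. of_real (pochhammer (2 + b) N) * toeplitz \<mu> (b + N) (\<lambda>w. cnj w ^ N * h w) z) z"
  proof (rule deriv_cong_ev)
    have "\<forall>\<^sub>F x in nhds z. x \<in> unit_disk"
      using Suc.prems by (intro eventually_nhds_in_open) auto
    then show "\<forall>\<^sub>F x in nhds z. (deriv ^^ N) (toeplitz \<mu> b h) x
        = of_real (pochhammer (2 + b) N) * toeplitz \<mu> (b + N) (\<lambda>w. cnj w ^ N * h w) x"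
      by eventually_elim (rule Suc.IH)
  qed simp
  also have "\<dots> = of_real (pochhammer (2 + b) N) * (of_real (2 + (b + N)) * toeplitz \<mu> (b + N + 1) (\<lambda>w. cnj w * (cnj w ^ N * h w)) z)"
    using b by (intro DERIV_imp_deriv DERIV_cmult toeplitz_has_field_derivative \<mu> integrable_cnj_power_times h Suc.prems) auto
  also have "\<dots> = of_real (pochhammer (2 + b) (Suc N)) * toeplitz \<mu> (b + Suc N) (\<lambda>w. cnj w ^ Suc N * h w) z"
    by (simp add: pochhammer_Suc mult_ac add_ac)
  finally show ?case .
qed simp

section \<open>Density of the polynomials\<close>

lemma measurable_indicator_closed:
  assumes "finite_borel_measure_on_disk \<mu>" "A \<in> sets borel"
  shows "(\<lambda>z. indicator A z :: ennreal) \<in> borel_measurable \<mu>"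
  by (rule disk_measure_measurable[OF assms(1)]) (rule borel_measurable_indicator[OF assms(2)])

text \<open>Dominated convergence: each point of the open disk eventually lies inside the radii
  \<open>r n\<close>, which tend to 1.\<close>

lemma mass_tail_small:
  assumes f: "f holomorphic_on unit_disk" and fin: "bergman_mass p \<alpha> f < \<infinity>" and \<epsilon>: "0 < \<epsilon>"
  shows "\<exists>R<1. 0 < R \<and> (\<integral>\<^sup>+z. ennreal (dens p \<alpha> f z) * indicator {z. R \<le> cmod z} z \<partial>disk_area) \<le> ennreal \<epsilon>"
proof -
  define F where "F z = ennreal (dens p \<alpha> f z)" for z
  \<comment> \<open>The summand 2 makes already the first radius positive.\<close>
  define r where "r n = 1 - 1 / (real n + 2)" for n
  have r: "0 < r n" "r n < 1" for n by (auto simp: r_def field_simps)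
  have rlim: "r \<longlonglongrightarrow> 1"
    unfolding r_def by real_asymp
  have Fm: "F \<in> borel_measurable disk_area"
    unfolding F_def by (intro measurable_mass_integrand measurable_disk_area_holomorphic f)
  have cl: "{z :: complex. R \<le> cmod z} \<in> sets borel" for R
    by (intro borel_closed closed_Collect_le continuous_intros)
  have "(\<lambda>n. \<integral>\<^sup>+z. F z * indicator {z. r n \<le> cmod z} z \<partial>disk_area) \<longlonglongrightarrow> (\<integral>\<^sup>+z. 0 \<partial>disk_area)"
  proof (rule nn_integral_dominated_convergence[where w=F])
    show "(\<lambda>z. F z * indicator {z. r n \<le> cmod z} z) \<in> borel_measurable disk_area" for n
      by (intro borel_measurable_times_ennreal Fm measurable_indicator_closed finite_borel_measure_disk_area cl)
    show "AE z in disk_area. F z * indicator {z. r n \<le> cmod z} z \<le> F z" for n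
      by (rule AE_I2) (simp add: indicator_def)
    show "(\<integral>\<^sup>+z. F z \<partial>disk_area) < \<infinity>" using fin by (simp add: bergman_mass_def F_def)
    show "AE z in disk_area. (\<lambda>n. F z * indicator {z. r n \<le> cmod z} z) \<longlonglongrightarrow> 0"
    proof (rule AE_I2)
      fix z assume "z \<in> space disk_area"
      then have "cmod z < 1" by simp
      from order_tendstoD(1)[OF rlim this] have "\<forall>\<^sub>F n in sequentially. F z * indicator {z. r n \<le> cmod z} z = 0"
        by (rule eventually_mono) (simp add: indicator_def)
      then show "(\<lambda>n. F z * indicator {z. r n \<le> cmod z} z) \<longlonglongrightarrow> 0"
        by (rule tendsto_eventually)
    qed
  qed (use Fm in auto)
  then have "\<forall>\<^sub>F n in sequentially. (\<integral>\<^sup>+z. F z * indicator {z. r n \<le> cmod z} z \<partial>disk_area) < ennreal \<epsilon>"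
    using \<epsilon> by (intro order_tendstoD(2)) auto
  then obtain n where "(\<integral>\<^sup>+z. F z * indicator {z. r n \<le> cmod z} z \<partial>disk_area) < ennreal \<epsilon>"
    by (auto simp: eventually_sequentially)
  then show ?thesis
    using r[of n] by (intro exI[of _ "r n"]) (auto simp: F_def)
qed

text \<open>The tails of the dilations \<open>\<lambda>z. f (r * z)\<close> are controlled by the tail of \<open>f\<close>, uniformly
  in \<open>r\<close>: this is the embedding for the image of the weight under \<open>z \<mapsto> r * z\<close>, whose kernel
  integrals are bounded by those of the weight.\<close>

lemma dilation_tail_bound:
  assumes p: "0 < p" and \<alpha>: "-1 < \<alpha>"
  shows "\<exists>C>0. \<forall>f R r. f holomorphic_on unit_disk \<longrightarrow> bergman_mass p \<alpha> f < \<infinity> \<longrightarrow> 0 < r \<longrightarrow> r < 1 \<longrightarrow>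
    (\<integral>\<^sup>+z. ennreal (cmod (f (of_real r * z)) powr p * rho z powr \<alpha>) * indicator {z. R \<le> r * cmod z} z \<partial>disk_area)
    \<le> ennreal C * (\<integral>\<^sup>+z. ennreal (dens p \<alpha> f z) * indicator {z. 3 * R - 1 \<le> 2 * cmod z} z \<partial>disk_area)"
proof -
  obtain K where K: "K \<ge> 0" "\<And>w. w \<in> unit_disk \<Longrightarrow>
    (\<integral>\<^sup>+z. ennreal (rho z powr \<alpha> * kern (- (3 + \<alpha>)) z w) \<partial>disk_area)
    \<le> ennreal (K * rho w powr (2 + \<alpha> - (3 + \<alpha>)))"
    using disk_kernel_estimate[OF \<alpha>, of "3 + \<alpha>"] by auto
  \<comment> \<open>The embedding with \<open>s = p\<close> and \<open>\<sigma> = 0\<close>, whose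
    critical exponent is \<open>2 + \<alpha>\<close>. Its constant does not depend on the measure,
    which below varies with \<open>r\<close>.\<close>
  have "2 + \<alpha> = (2 + \<alpha>) * p / p + 0" "0 < 3 + \<alpha>" using p \<alpha> by auto
  from carleson_embedding[OF p order_refl \<alpha> this(2) this(1)]
  obtain C where C: "C > 0" "\<And>\<nu> K R f m. finite_borel_measure_on_disk \<nu> \<Longrightarrow> 0 \<le> K \<Longrightarrow> f holomorphic_on unit_disk \<Longrightarrow>
    (\<And>z. z \<in> unit_disk \<Longrightarrow> 3 * R - 1 \<le> 2 * cmod z \<Longrightarrow>
      (\<integral>\<^sup>+w. ennreal (kern (- (3 + \<alpha>)) w z) \<partial>\<nu>) \<le> ennreal (K * rho z powr (2 + \<alpha> - (3 + \<alpha>)))) \<Longrightarrow>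
    0 \<le> m \<Longrightarrow> bergman_mass p \<alpha> f \<le> ennreal m \<Longrightarrow>
    (\<integral>\<^sup>+w. ennreal (dens p (- 0) f w) * indicator {w. R \<le> cmod w} w \<partial>\<nu>)
    \<le> ennreal (C * K * m powr ((p - p) / p)) *
      (\<integral>\<^sup>+z. ennreal (dens p \<alpha> f z) * indicator {z. 3 * R - 1 \<le> 2 * cmod z} z \<partial>disk_area)"
    by blast
  show ?thesis
  proof (intro exI[of _ "C * K + 1"] conjI allI impI)
    show "0 < C * K + 1" using C K by (simp add: add_nonneg_pos)
    fix f and R r :: real
    assume f: "f holomorphic_on unit_disk" and fin: "bergman_mass p \<alpha> f < \<infinity>" and r: "0 < r" "r < 1"
    define W where "W z = ennreal (rho z powr \<alpha>)" for z
    have Wm: "W \<in> borel_measurable disk_area"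
      unfolding W_def by (intro disk_area_measurableI) measurable
    have rz: "of_real r * z \<in> unit_disk" if "z \<in> unit_disk" for z :: complex
      using that r mult_strict_mono[of r 1 "cmod z" 1] by (simp add: norm_mult)
    have dil: "(\<lambda>z. of_real r * z) \<in> density disk_area W \<rightarrow>\<^sub>M restrict_space borel unit_disk"
      by (rule measurable_restrict_space2) (use rz disk_area_measurableI[of "\<lambda>z. of_real r * z"] in auto)
    define \<nu> where "\<nu> = distr (density disk_area W) (restrict_space borel unit_disk) (\<lambda>z. of_real r * z)"
    have int: "(\<integral>\<^sup>+w. G w \<partial>\<nu>) = (\<integral>\<^sup>+z. W z * G (of_real r * z) \<partial>disk_area)"
      if G: "G \<in> borel_measurable (restrict_space borel unit_disk)" for G
    proof -
      have "(\<integral>\<^sup>+w. G w \<partial>\<nu>) = (\<integral>\<^sup>+z. G (of_real r * z) \<partial>density disk_area W)"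
        unfolding \<nu>_def by (rule nn_integral_distr[OF dil]) (use G in simp)
      also have "\<dots> = (\<integral>\<^sup>+z. W z * G (of_real r * z) \<partial>disk_area)"
        using measurable_compose[OF dil G] by (intro nn_integral_density Wm) simp
      finally show ?thesis .
    qed
    have \<nu>: "finite_borel_measure_on_disk \<nu>"
    proof -
      have "emeasure \<nu> (space \<nu>) = (\<integral>\<^sup>+w. 1 \<partial>\<nu>)" by simp
      also have "\<dots> = (\<integral>\<^sup>+z. W z \<partial>disk_area)" by (subst int) simp_all
      also have "\<dots> \<le> ennreal K" using K(2)[of 0] by (simp add: W_def rho_def)
      finally have "emeasure \<nu> (space \<nu>) \<noteq> \<infinity>" by (auto simp: top_unique)
      then have "finite_measure \<nu>" by (rule finite_measureI)
      then show ?thesis by (simp add: finite_borel_measure_on_disk_def \<nu>_def)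
    qed
    have id: "(\<lambda>w. w) \<in> borel_measurable (restrict_space borel (unit_disk :: complex set))"
      by (rule measurable_restrict_space1) simp
    \<comment> \<open>The real factor \<open>r\<close> moves from one argument of the kernel to the
      other; it then pushes \<open>z\<close> inwards, where \<open>rho\<close> is larger and the
      kernel integral smaller.\<close>
    have ker: "(\<integral>\<^sup>+w. ennreal (kern (- (3 + \<alpha>)) w z) \<partial>\<nu>) \<le> ennreal (K * rho z powr (2 + \<alpha> - (3 + \<alpha>)))"
      if z: "z \<in> unit_disk" for z
    proof -
      have "(\<integral>\<^sup>+w. ennreal (kern (- (3 + \<alpha>)) w z) \<partial>\<nu>)
          = (\<integral>\<^sup>+w. W w * ennreal (kern (- (3 + \<alpha>)) (of_real r * w) z) \<partial>disk_area)"
        by (subst int) (intro measurable_kernel_comp id borel_measurable_const, rule refl)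
      also have "\<dots> = (\<integral>\<^sup>+w. ennreal (rho w powr \<alpha> * kern (- (3 + \<alpha>)) w (of_real r * z)) \<partial>disk_area)"
        by (simp add: W_def ennreal_mult mult_ac)
      also have "\<dots> \<le> ennreal (K * rho (of_real r * z) powr (2 + \<alpha> - (3 + \<alpha>)))"
        by (rule K(2)[OF rz[OF z]])
      also have "\<dots> \<le> ennreal (K * rho z powr (2 + \<alpha> - (3 + \<alpha>)))"
      proof (intro ennreal_leI mult_left_mono powr_mono2')
        have "cmod (of_real r * z) \<le> cmod z" using r by (simp add: norm_mult mult_left_le_one_le)
        then show "rho z \<le> rho (of_real r * z)" by (simp add: rho_def power_mono)
      qed (use K rho_pos[OF z] in auto)
      finally show ?thesis .
    qed
    define T where "T = (\<integral>\<^sup>+z. ennreal (dens p \<alpha> f z) * indicator {z. 3 * R - 1 \<le> 2 * cmod z} z \<partial>disk_area)"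
    have cl: "{z :: complex. R \<le> cmod z} \<in> sets borel" for R
      by (intro borel_closed closed_Collect_le continuous_intros)
    have fm: "f \<in> borel_measurable (restrict_space borel unit_disk)"
      by (intro borel_measurable_continuous_on_restrict holomorphic_on_imp_continuous_on f)
    have "(\<integral>\<^sup>+z. ennreal (cmod (f (of_real r * z)) powr p * rho z powr \<alpha>) * indicator {z. R \<le> r * cmod z} z \<partial>disk_area)
        = (\<integral>\<^sup>+z. W z * (ennreal (cmod (f (of_real r * z)) powr p) * indicator {z. R \<le> cmod z} (of_real r * z)) \<partial>disk_area)"
      using r by (intro nn_integral_cong) (simp add: W_def ennreal_mult mult_ac norm_mult indicator_def)
    also have "\<dots> = (\<integral>\<^sup>+w. ennreal (cmod (f w) powr p) * indicator {z. R \<le> cmod z} w \<partial>\<nu>)"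
    proof (rule int[symmetric])
      have 1: "(\<lambda>w. ennreal (cmod (f w) powr p)) \<in> borel_measurable (restrict_space borel unit_disk)"
        using fm by measurable
      show "(\<lambda>w. ennreal (cmod (f w) powr p) * indicator {z. R \<le> cmod z} w) \<in> borel_measurable (restrict_space borel unit_disk)"
        by (intro borel_measurable_times_ennreal 1 measurable_restrict_space1[OF borel_measurable_indicator[OF cl]])
    qed
    also have "\<dots> = (\<integral>\<^sup>+w. ennreal (dens p (- 0) f w) * indicator {z. R \<le> cmod z} w \<partial>\<nu>)"
    proof (rule nn_integral_cong)
      fix w assume "w \<in> space \<nu>"
      then have "0 < rho w" by (simp add: space_disk_measure[OF \<nu>] rho_pos)
      then show "ennreal (cmod (f w) powr p) * indicator {z. R \<le> cmod z} w
          = ennreal (dens p (- 0) f w) * indicator {z. R \<le> cmod z} w"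
        by simp
    qed
    also have "\<dots> \<le> ennreal (C * K * (enn2real (bergman_mass p \<alpha> f)) powr ((p - p) / p)) * T"
      unfolding T_def using fin K(1) by (intro C(2) \<nu> f ker) auto
    also have "\<dots> \<le> ennreal (C * K + 1) * T"
    proof (intro mult_right_mono ennreal_leI)
      \<comment> \<open>An inequality and not an equation, because \<open>0 powr 0\<close> is
        0.\<close>
      have "(enn2real (bergman_mass p \<alpha> f)) powr ((p - p) / p) \<le> 1"
        by (cases "enn2real (bergman_mass p \<alpha> f) = 0") simp_all
      then have "C * K * (enn2real (bergman_mass p \<alpha> f)) powr ((p - p) / p) \<le> C * K * 1"
        using C(1) K(1) by (intro mult_left_mono) auto
      then show "C * K * (enn2real (bergman_mass p \<alpha> f)) powr ((p - p) / p) \<le> C * K + 1" by simp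
    qed simp
    finally show "(\<integral>\<^sup>+z. ennreal (cmod (f (of_real r * z)) powr p * rho z powr \<alpha>) * indicator {z. R \<le> r * cmod z} z \<partial>disk_area)
      \<le> ennreal (C * K + 1) * (\<integral>\<^sup>+z. ennreal (dens p \<alpha> f z) * indicator {z. 3 * R - 1 \<le> 2 * cmod z} z \<partial>disk_area)"
      by (simp only: T_def)
  qed
qed

text \<open>The bound on bounded functions is assumed for arbitrary ones, because it is applied to
  the truncation of \<open>g\<close>, which is not holomorphic.\<close>

lemma bergman_mass_split:
  assumes g: "g \<in> borel_measurable disk_area" and le: "\<And>z. z \<in> unit_disk \<Longrightarrow> cmod z < R \<Longrightarrow> cmod (g z) \<le> b"
    and p: "0 < p" and C: "\<And>f. (\<And>z. z \<in> unit_disk \<Longrightarrow> cmod (f z) \<le> b) \<Longrightarrow> bergman_mass p \<alpha> f \<le> ennreal c" and b: "0 \<le> b"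
  shows "bergman_mass p \<alpha> g \<le> ennreal c
    + (\<integral>\<^sup>+z. ennreal (dens p \<alpha> g z) * indicator {z. R \<le> cmod z} z \<partial>disk_area)"
proof -
  have cl: "{z :: complex. R \<le> cmod z} \<in> sets borel"
    by (intro borel_closed closed_Collect_le continuous_intros)
  define h where "h z = (if cmod z < R then g z else 0)" for z
  have hm: "h \<in> borel_measurable disk_area"
  proof -
    have "(\<lambda>z. g z - indicator {z. R \<le> cmod z} z *\<^sub>R g z) \<in> borel_measurable disk_area"
      by (intro borel_measurable_diff borel_measurable_scaleR g disk_area_measurableI borel_measurable_indicator cl)
    also have "(\<lambda>z. g z - indicator {z. R \<le> cmod z} z *\<^sub>R g z) = h"
      by (auto simp: h_def indicator_def)
    finally show ?thesis .
  qed
  have "bergman_mass p \<alpha> g = (\<integral>\<^sup>+z. ennreal (dens p \<alpha> h z)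
      + ennreal (dens p \<alpha> g z) * indicator {z. R \<le> cmod z} z \<partial>disk_area)"
    unfolding bergman_mass_def using p by (intro nn_integral_cong) (auto simp: h_def indicator_def)
  also have "\<dots> = bergman_mass p \<alpha> h
      + (\<integral>\<^sup>+z. ennreal (dens p \<alpha> g z) * indicator {z. R \<le> cmod z} z \<partial>disk_area)"
    unfolding bergman_mass_def
    by (intro nn_integral_add measurable_mass_integrand hm borel_measurable_times_ennreal g
        measurable_indicator_closed finite_borel_measure_disk_area cl)
  also have "\<dots> \<le> ennreal c
      + (\<integral>\<^sup>+z. ennreal (dens p \<alpha> g z) * indicator {z. R \<le> cmod z} z \<partial>disk_area)"
    using le b by (intro add_right_mono C) (auto simp: h_def)
  finally show ?thesis .
qed

text \<open>A dilation \<open>f (r * z)\<close> is holomorphic past the closed disk and hence a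
  uniform limit of polynomials there. It is close to \<open>f\<close> on a compact disk by uniform
  continuity; near the circle both functions have small mass, the dilation because its tail is
  controlled by that of \<open>f\<close>.\<close>

lemma polynomial_approximation_mass:
  assumes p: "0 < p" and \<alpha>: "-1 < \<alpha>" and f: "f \<in> bergman_space p \<alpha>" and \<epsilon>: "0 < \<epsilon>"
  shows "\<exists>P. bergman_mass p \<alpha> (\<lambda>z. poly P z - f z) \<le> ennreal \<epsilon>"
proof -
  have hol: "f holomorphic_on unit_disk" and fin: "bergman_mass p \<alpha> f < \<infinity>"
    using f \<alpha> by (simp_all add: bergman_space_iff)
  obtain C where C: "C > 0" "\<And>R r. 0 < r \<Longrightarrow> r < 1 \<Longrightarrow>
    (\<integral>\<^sup>+z. ennreal (cmod (f (of_real r * z)) powr p * rho z powr \<alpha>) * indicator {z. R \<le> r * cmod z} z \<partial>disk_area)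
    \<le> ennreal C * (\<integral>\<^sup>+z. ennreal (dens p \<alpha> f z) * indicator {z. 3 * R - 1 \<le> 2 * cmod z} z \<partial>disk_area)"
    using dilation_tail_bound[OF p \<alpha>] hol fin by blast
  obtain C0 where C0: "C0 > 0" "\<And>f b. (\<And>z. z \<in> unit_disk \<Longrightarrow> cmod (f z) \<le> b) \<Longrightarrow> bergman_mass p \<alpha> f \<le> ennreal (C0 * b powr p)"
    using bergman_mass_bounded_function[OF \<alpha> p] by blast
  define k where "k = 2 powr p"
  have k: "k > 0" by (simp add: k_def)
  \<comment> \<open>\<open>\<eta>\<close> and \<open>b\<close> are chosen so that the three errors
    at the end are \<open>\<epsilon> / 4\<close>, \<open>\<epsilon> / 4\<close> and
    \<open>\<epsilon> / 2\<close>; the factors \<open>k\<close> come from two uses of the inequality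
    for \<open>p\<close>-th powers of sums.\<close>
  define \<eta> where "\<eta> = \<epsilon> / (2 * k * k * (C + 1))"
  have \<eta>: "0 < \<eta>" using \<epsilon> k C by (simp add: \<eta>_def)
  define b where "b = (\<epsilon> / (4 * k * C0)) powr (1 / p)"
  have b: "0 < b" "b powr p = \<epsilon> / (4 * k * C0)"
    using \<epsilon> k C0 p by (simp_all add: b_def powr_powr)
  obtain R0 where R0: "R0 < 1" "0 < R0"
    "(\<integral>\<^sup>+z. ennreal (dens p \<alpha> f z) * indicator {z. R0 \<le> cmod z} z \<partial>disk_area) \<le> ennreal \<eta>" (is "?T \<le> _")
    using mass_tail_small[OF hol fin \<eta>] by blast
  \<comment> \<open>\<open>3 * R - 1 = 2 * R0\<close> makes the tail of \<open>f\<close> in the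
    dilation bound begin at \<open>R0\<close>. The larger radius \<open>R1\<close> leaves room for
    the dilation: for \<open>r\<close> close to 1, points beyond \<open>R1\<close> are still mapped
    beyond \<open>R\<close>.\<close>
  define R where "R = (1 + 2 * R0) / 3"
  define R1 where "R1 = (1 + R) / 2"
  have R: "R0 < R" "R < R1" "R1 < 1" "3 * R - 1 = 2 * R0" "0 < R"
    using R0 by (auto simp: R1_def R_def field_simps)
  have "uniformly_continuous_on (cball 0 R1) f"
    using R by (intro compact_uniformly_continuous holomorphic_on_imp_continuous_on holomorphic_on_subset[OF hol]) auto
  then obtain \<delta> where \<delta>: "\<delta> > 0" "\<And>x y. x \<in> cball 0 R1 \<Longrightarrow> y \<in> cball 0 R1 \<Longrightarrow> dist y x < \<delta> \<Longrightarrow> dist (f y) (f x) < b"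
    unfolding uniformly_continuous_on_def using b(1) by meson
  \<comment> \<open>The first value keeps the image of the outer annulus beyond \<open>R\<close>,
    the second moves every point of the disk by less than \<open>\<delta>\<close>.\<close>
  define r where "r = max (R / R1) (1 - \<delta> / 2)"
  have r: "0 < r" "r < 1" "R \<le> r * R1" "1 - r < \<delta>"
  proof -
    have q: "0 < R / R1" "R / R1 < 1" using R by auto
    show "0 < r" "r < 1" "1 - r < \<delta>"
      using q \<delta>(1) by (auto simp: r_def max_def)
    have "R / R1 \<le> r" by (simp add: r_def)
    then show "R \<le> r * R1" using R by (simp add: pos_divide_le_eq)
  qed
  define fr where "fr z = f (of_real r * z)" for z
  have frhol: "fr holomorphic_on ball 0 (1 / r)"
  proof -
    have "(f \<circ> (\<lambda>z. of_real r * z)) holomorphic_on ball 0 (1 / r)"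
      using r by (intro holomorphic_on_compose_gen[OF _ hol] holomorphic_intros) (auto simp: norm_mult field_simps)
    then show ?thesis by (simp add: fr_def[abs_def] o_def)
  qed
  have frhol1: "fr holomorphic_on unit_disk"
    using r by (intro holomorphic_on_subset[OF frhol] subset_ball) simp
  obtain P :: "nat \<Rightarrow> complex poly" where "uniform_limit (cball 0 1) (\<lambda>n z. poly (P n) z) fr sequentially"
    using holomorphic_ball_uniform_polynomials[OF frhol, of 1] r by auto
  from uniform_limitD[OF this b(1)] obtain n where n: "\<And>z. z \<in> cball 0 1 \<Longrightarrow> dist (poly (P n) z) (fr z) < b"
    using eventually_happens by (metis (no_types, lifting) sequentially_bot)
  have meas: "f \<in> borel_measurable disk_area" "fr \<in> borel_measurable disk_area"
    "(\<lambda>z. poly (P n) z) \<in> borel_measurable disk_area"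
    by (intro measurable_disk_area_holomorphic hol frhol1 holomorphic_intros)+
  have 1: "bergman_mass p \<alpha> (\<lambda>z. poly (P n) z - fr z) \<le> ennreal (C0 * b powr p)"
    using n by (intro C0(2)) (auto simp: dist_norm less_imp_le)
  have cl: "{z :: complex. R1 \<le> cmod z} \<in> sets borel"
    by (intro borel_closed closed_Collect_le continuous_intros)
  define I where "I z = (indicator {z :: complex. R1 \<le> cmod z} z :: ennreal)" for z
  have Im: "I \<in> borel_measurable disk_area"
    unfolding I_def by (rule measurable_indicator_closed[OF finite_borel_measure_disk_area cl])
  have 2: "bergman_mass p \<alpha> (\<lambda>z. f z - fr z)
      \<le> ennreal (C0 * b powr p) + (\<integral>\<^sup>+z. ennreal (cmod (f z - fr z) powr p * rho z powr \<alpha>) * I z \<partial>disk_area)"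
    unfolding I_def
  proof (rule bergman_mass_split)
    fix z assume "z \<in> unit_disk" "cmod z < R1"
    then have "z \<in> cball 0 R1" "of_real r * z \<in> cball 0 R1"
      using r mult_left_le_one_le[of "cmod z" r] by (auto simp: norm_mult)
    moreover have "dist z (of_real r * z) < \<delta>"
    proof -
      have "z - of_real r * z = of_real (1 - r) * z" by (simp add: algebra_simps)
      then have "dist z (of_real r * z) = (1 - r) * cmod z"
        using r by (simp only: dist_norm norm_mult norm_of_real abs_of_pos diff_gt_0_iff_gt)
      also have "\<dots> \<le> (1 - r) * 1" using r \<open>z \<in> unit_disk\<close> by (intro mult_left_mono) auto
      finally show ?thesis using r by simp
    qed
    ultimately show "cmod (f z - fr z) \<le> b"
      using \<delta>(2)[of "of_real r * z" z] by (simp add: fr_def dist_norm)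
  qed (use meas p C0(2) b(1) in auto)
  have 3: "(\<integral>\<^sup>+z. ennreal (cmod (f z - fr z) powr p * rho z powr \<alpha>) * I z \<partial>disk_area) \<le> ennreal (k * ((C + 1) * \<eta>))"
  proof -
    define F where "F g z = ennreal (dens p \<alpha> g z) * I z" for g :: "complex \<Rightarrow> complex" and z
    have Fm: "F g \<in> borel_measurable disk_area" if "g \<in> borel_measurable disk_area" for g
      unfolding F_def by (intro borel_measurable_times_ennreal measurable_mass_integrand that Im)
    have "(\<integral>\<^sup>+z. ennreal (cmod (f z - fr z) powr p * rho z powr \<alpha>) * I z \<partial>disk_area)
        \<le> (\<integral>\<^sup>+z. ennreal k * (F f z + F fr z) \<partial>disk_area)"
    proof (rule nn_integral_mono)
      fix z
      have "cmod (f z - fr z) powr p \<le> (cmod (f z) + cmod (fr z)) powr p"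
        using p by (intro powr_mono2 norm_triangle_ineq4) auto
      also have "\<dots> \<le> k * (cmod (f z) powr p + cmod (fr z) powr p)"
        unfolding k_def using p by (intro powr_add_le) auto
      finally have "cmod (f z - fr z) powr p * rho z powr \<alpha>
          \<le> k * (cmod (f z) powr p + cmod (fr z) powr p) * rho z powr \<alpha>"
        by (rule mult_right_mono) simp
      then have "ennreal (cmod (f z - fr z) powr p * rho z powr \<alpha>)
          \<le> ennreal k * (ennreal (dens p \<alpha> f z) + ennreal (dens p \<alpha> fr z))"
        using k by (simp add: ennreal_mult[symmetric] ennreal_plus[symmetric] algebra_simps ennreal_leI del: ennreal_plus)
      then have "ennreal (cmod (f z - fr z) powr p * rho z powr \<alpha>) * I z
          \<le> ennreal k * (ennreal (dens p \<alpha> f z) + ennreal (dens p \<alpha> fr z)) * I z"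
        by (rule mult_right_mono) simp
      then show "ennreal (cmod (f z - fr z) powr p * rho z powr \<alpha>) * I z \<le> ennreal k * (F f z + F fr z)"
        unfolding F_def by (simp only: distrib_left distrib_right mult_ac)
    qed
    also have "\<dots> = ennreal k * ((\<integral>\<^sup>+z. F f z \<partial>disk_area) + (\<integral>\<^sup>+z. F fr z \<partial>disk_area))"
      by (simp only: nn_integral_cmult nn_integral_add borel_measurable_add Fm meas)
    also have "\<dots> \<le> ennreal k * (ennreal \<eta> + ennreal C * ennreal \<eta>)"
    proof (intro mult_left_mono add_mono)
      have "(\<integral>\<^sup>+z. F f z \<partial>disk_area) \<le> ?T"
        using R by (intro nn_integral_mono) (auto simp: F_def I_def indicator_def)
      then show "(\<integral>\<^sup>+z. F f z \<partial>disk_area) \<le> ennreal \<eta>" using R0(3) by (rule order_trans)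
      have sub: "R \<le> r * cmod z" if "R1 \<le> cmod z" for z :: complex
        by (rule order_trans[OF r(3) mult_left_mono[OF that]]) (use r in simp)
      have "(\<integral>\<^sup>+z. F fr z \<partial>disk_area)
          \<le> (\<integral>\<^sup>+z. ennreal (cmod (f (of_real r * z)) powr p * rho z powr \<alpha>) * indicator {z. R \<le> r * cmod z} z \<partial>disk_area)"
        using sub by (intro nn_integral_mono) (auto simp: F_def I_def fr_def indicator_def)
      also have "\<dots> \<le> ennreal C * ?T"
        using C(2)[OF r(1,2), of R] by (simp add: R(4))
      also have "\<dots> \<le> ennreal C * ennreal \<eta>" using R0(3) by (intro mult_left_mono) auto
      finally show "(\<integral>\<^sup>+z. F fr z \<partial>disk_area) \<le> ennreal C * ennreal \<eta>" .
    qed simp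
    also have "\<dots> = ennreal (k * ((C + 1) * \<eta>))"
      using k C(1) \<eta> by (simp add: ennreal_mult[symmetric] ennreal_plus[symmetric] algebra_simps del: ennreal_plus)
    finally show ?thesis .
  qed
  have "bergman_mass p \<alpha> (\<lambda>z. (poly (P n) z - fr z) - (f z - fr z))
      \<le> ennreal k * (bergman_mass p \<alpha> (\<lambda>z. poly (P n) z - fr z) + bergman_mass p \<alpha> (\<lambda>z. f z - fr z))"
    unfolding k_def using meas p by (intro bergman_mass_diff borel_measurable_diff)
  also have "\<dots> \<le> ennreal k * (ennreal (C0 * b powr p) + (ennreal (C0 * b powr p) + ennreal (k * ((C + 1) * \<eta>))))"
    by (intro mult_left_mono add_mono 1 order_trans[OF 2] 3) auto
  also have "\<dots> = ennreal (k * (C0 * b powr p + (C0 * b powr p + k * ((C + 1) * \<eta>))))"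
    using k C0(1) C(1) \<eta> by (simp add: ennreal_mult[symmetric] ennreal_plus[symmetric] del: ennreal_plus)
  also have "k * (C0 * b powr p + (C0 * b powr p + k * ((C + 1) * \<eta>))) = \<epsilon>"
  proof -
    have "k * (C0 * b powr p) = \<epsilon> / 4" using k C0 by (simp add: b(2))
    moreover have "k * (k * ((C + 1) * \<eta>)) = \<epsilon> / 2" using k C(1) by (simp add: \<eta>_def)
    ultimately show ?thesis by (simp add: distrib_left)
  qed
  finally show ?thesis by (intro exI[of _ "P n"]) simp
qed

lemma polynomials_dense:
  assumes p: "0 < p" and \<alpha>: "-1 < \<alpha>" and f: "f \<in> bergman_space p \<alpha>"
  shows "\<exists>P :: nat \<Rightarrow> complex poly. (\<lambda>n. bergman_norm p \<alpha> (\<lambda>z. poly (P n) z - f z)) \<longlonglongrightarrow> 0"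
proof -
  have "\<exists>P. bergman_mass p \<alpha> (\<lambda>z. poly P z - f z) \<le> ennreal (1 / real (Suc n))" for n
    by (rule polynomial_approximation_mass[OF p \<alpha> f]) simp
  then obtain P :: "nat \<Rightarrow> complex poly"
    where P: "\<And>n. bergman_mass p \<alpha> (\<lambda>z. poly (P n) z - f z) \<le> ennreal (1 / real (Suc n))"
    by metis
  have "(\<lambda>n. bergman_norm p \<alpha> (\<lambda>z. poly (P n) z - f z)) \<longlonglongrightarrow> 0"
  proof (rule tendsto_sandwich[of "\<lambda>_. 0" _ _ "\<lambda>n. ((1 + \<alpha>) * (1 / real (Suc n))) powr (1 / p)"])
    show "\<forall>\<^sub>F n in sequentially. bergman_norm p \<alpha> (\<lambda>z. poly (P n) z - f z) \<le> ((1 + \<alpha>) * (1 / real (Suc n))) powr (1 / p)"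
      by (intro always_eventually allI bergman_norm_le P p \<alpha> holomorphic_intros bergman_spaceD[OF f]) auto
    have "(\<lambda>n. (1 + \<alpha>) * (1 / real (Suc n))) \<longlonglongrightarrow> (1 + \<alpha>) * 0"
      by (intro tendsto_intros LIMSEQ_Suc lim_1_over_n)
    then show "(\<lambda>n. ((1 + \<alpha>) * (1 / real (Suc n))) powr (1 / p)) \<longlonglongrightarrow> 0"
      using p \<alpha> by (intro tendsto_eq_rhs[OF tendsto_powr'[where a=0 and b="1 / p"]]) auto
  qed (auto simp: bergman_norm_nonneg)
  then show ?thesis by blast
qed

section \<open>The vanishing kernel condition\<close>

text \<open>A test of Berezin type. On a hyperbolic disk around \<open>z\<close> the kernel is
  comparable to \<open>rho z powr (- c)\<close>, so for positive \<open>c\<close> the condition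
  forces the \<open>\<mu>\<close>-measure of that disk to be of smaller order than
  \<open>rho z powr A\<close>, a bound in which \<open>c\<close> no longer appears.\<close>

definition kernel_vanishing :: "complex measure \<Rightarrow> real \<Rightarrow> real \<Rightarrow> bool" where
  "kernel_vanishing \<mu> c A \<longleftrightarrow> (\<forall>e>0. \<exists>R<1. \<forall>z\<in>unit_disk. R \<le> cmod z \<longrightarrow>
    (\<integral>\<^sup>+w. ennreal (kern (- c) w z) \<partial>\<mu>) \<le> ennreal (e * rho z powr (A - c)))"

definition kernel_bounded :: "complex measure \<Rightarrow> real \<Rightarrow> real \<Rightarrow> real \<Rightarrow> bool" where
  "kernel_bounded \<mu> c A K \<longleftrightarrow> 0 \<le> K \<and> (\<forall>z\<in>unit_disk.
    (\<integral>\<^sup>+w. ennreal (kern (- c) w z) \<partial>\<mu>) \<le> ennreal (K * rho z powr (A - c)))"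

lemma kernel_integral_compact_bound:
  assumes \<mu>: "finite_borel_measure_on_disk \<mu>" and c: "0 < c" and z: "z \<in> unit_disk" "cmod z \<le> R" "R < 1"
  shows "(\<integral>\<^sup>+w. ennreal (kern (- c) w z) \<partial>\<mu>) \<le> ennreal ((1 - R) powr (- c) * measure \<mu> (space \<mu>))"
proof -
  interpret finite_measure \<mu> using \<mu> by (simp add: finite_borel_measure_on_disk_def)
  have "(\<integral>\<^sup>+w. ennreal (kern (- c) w z) \<partial>\<mu>) \<le> (\<integral>\<^sup>+w. ennreal ((1 - R) powr (- c)) \<partial>\<mu>)"
  proof (intro nn_integral_mono ennreal_leI powr_mono2')
    fix w assume "w \<in> space \<mu>"
    then have w: "w \<in> unit_disk" by (simp add: space_disk_measure[OF \<mu>])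
    show "1 - R \<le> cmod (1 - w * cnj z)" using kernel_lower_bound(2)[OF w z(1)] z by simp
  qed (use c z in auto)
  also have "\<dots> = ennreal ((1 - R) powr (- c) * measure \<mu> (space \<mu>))"
    by (simp add: emeasure_eq_measure ennreal_mult)
  finally show ?thesis .
qed

text \<open>Away from the circle the kernel is bounded and \<open>\<mu>\<close> is finite. Since
  \<open>A < c\<close>, the power \<open>rho z powr (A - c)\<close> is at least 1 and absorbs that
  bound.\<close>

lemma kernel_vanishing_imp_bounded:
  assumes \<mu>: "finite_borel_measure_on_disk \<mu>" and c: "0 < c" "A < c" and v: "kernel_vanishing \<mu> c A"
  shows "\<exists>K. kernel_bounded \<mu> c A K"
proof -
  obtain R where R: "R < 1" "\<And>z. z \<in> unit_disk \<Longrightarrow> R \<le> cmod z \<Longrightarrow>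
    (\<integral>\<^sup>+w. ennreal (kern (- c) w z) \<partial>\<mu>) \<le> ennreal (1 * rho z powr (A - c))"
    using v unfolding kernel_vanishing_def by (meson zero_less_one)
  define K where "K = 1 + (1 - R) powr (- c) * measure \<mu> (space \<mu>)"
  have K: "1 \<le> K" "(1 - R) powr (- c) * measure \<mu> (space \<mu>) \<le> K" by (simp_all add: K_def)
  have "kernel_bounded \<mu> c A K"
    unfolding kernel_bounded_def
  proof (intro conjI ballI)
    show "0 \<le> K" using K by simp
    fix z :: complex assume z: "z \<in> unit_disk"
    show "(\<integral>\<^sup>+w. ennreal (kern (- c) w z) \<partial>\<mu>) \<le> ennreal (K * rho z powr (A - c))"
    proof (cases "R \<le> cmod z")
      case True
      have "1 * rho z powr (A - c) \<le> K * rho z powr (A - c)" using K by (intro mult_right_mono) auto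
      then show ?thesis using R(2)[OF z True] by (meson ennreal_leI order_trans)
    next
      case False
      have "1 powr (A - c) \<le> rho z powr (A - c)"
        using c rho_pos[OF z] rho_le_1[of z] by (intro powr_mono2') auto
      then have "K * 1 \<le> K * rho z powr (A - c)" using K by (intro mult_left_mono) auto
      then have "(1 - R) powr (- c) * measure \<mu> (space \<mu>) \<le> K * rho z powr (A - c)"
        by (intro order_trans[OF K(2)]) (simp only: mult_1_right)
      moreover have "(\<integral>\<^sup>+w. ennreal (kern (- c) w z) \<partial>\<mu>)
          \<le> ennreal ((1 - R) powr (- c) * measure \<mu> (space \<mu>))"
        using False R by (intro kernel_integral_compact_bound \<mu> c z) auto
      ultimately show ?thesis by (meson ennreal_leI order_trans)
    qed
  qed
  then show ?thesis by blast
qed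

text \<open>The two occurrences of the mass in \<open>carleson_embedding\<close> combine to the
  power \<open>s / p\<close>, which is the \<open>s\<close>-th power of the norm up to a
  constant.\<close>

lemma bergman_embedding:
  assumes p: "0 < p" "p \<le> s" and \<alpha>: "-1 < \<alpha>" and c: "0 < c"
    and A: "A = (2 + \<alpha>) * s / p + \<sigma>"
  shows "\<exists>C>0. \<forall>\<nu> K R f. finite_borel_measure_on_disk \<nu> \<longrightarrow> 0 \<le> K \<longrightarrow> f \<in> bergman_space p \<alpha> \<longrightarrow>
    (\<forall>z\<in>unit_disk. 3 * R - 1 \<le> 2 * cmod z \<longrightarrow>
      (\<integral>\<^sup>+w. ennreal (kern (- c) w z) \<partial>\<nu>) \<le> ennreal (K * rho z powr (A - c))) \<longrightarrow>
    (\<integral>\<^sup>+w. ennreal (dens s (- \<sigma>) f w) * indicator {w. R \<le> cmod w} w \<partial>\<nu>)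
    \<le> ennreal (C * K * bergman_norm p \<alpha> f powr s)"
proof -
  from carleson_embedding[OF p \<alpha> c A]
  obtain C where C: "C > 0" "\<And>\<nu> K R f m. finite_borel_measure_on_disk \<nu> \<Longrightarrow> 0 \<le> K \<Longrightarrow> f holomorphic_on unit_disk \<Longrightarrow>
    (\<And>z. z \<in> unit_disk \<Longrightarrow> 3 * R - 1 \<le> 2 * cmod z \<Longrightarrow>
      (\<integral>\<^sup>+w. ennreal (kern (- c) w z) \<partial>\<nu>) \<le> ennreal (K * rho z powr (A - c))) \<Longrightarrow>
    0 \<le> m \<Longrightarrow> bergman_mass p \<alpha> f \<le> ennreal m \<Longrightarrow>
    (\<integral>\<^sup>+w. ennreal (dens s (- \<sigma>) f w) * indicator {w. R \<le> cmod w} w \<partial>\<nu>)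
    \<le> ennreal (C * K * m powr ((s - p) / p)) *
      (\<integral>\<^sup>+z. ennreal (dens p \<alpha> f z) * indicator {z. 3 * R - 1 \<le> 2 * cmod z} z \<partial>disk_area)"
    by blast
  define a where "a = (1 / (1 + \<alpha>)) powr (s / p)"
  have a: "0 < a" using \<alpha> by (simp add: a_def)
  show ?thesis
  proof (intro exI[of _ "C * a"] conjI allI impI)
    show "0 < C * a" using C a by simp
    fix \<nu> :: "complex measure" and K R :: real and f
    assume \<nu>: "finite_borel_measure_on_disk \<nu>" and K: "0 \<le> K" and f: "f \<in> bergman_space p \<alpha>"
      and ker: "\<forall>z\<in>unit_disk. 3 * R - 1 \<le> 2 * cmod z \<longrightarrow>
        (\<integral>\<^sup>+w. ennreal (kern (- c) w z) \<partial>\<nu>) \<le> ennreal (K * rho z powr (A - c))"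
    define N where "N = bergman_norm p \<alpha> f"
    define m where "m = N powr p / (1 + \<alpha>)"
    have N: "0 \<le> N" by (simp add: N_def bergman_norm_nonneg)
    have m: "0 \<le> m" "bergman_mass p \<alpha> f = ennreal m"
      using \<alpha> bergman_mass_eq_norm[OF f p(1) \<alpha>] by (auto simp: m_def N_def)
    have "(\<integral>\<^sup>+w. ennreal (dens s (- \<sigma>) f w) * indicator {w. R \<le> cmod w} w \<partial>\<nu>)
      \<le> ennreal (C * K * m powr ((s - p) / p)) *
      (\<integral>\<^sup>+z. ennreal (dens p \<alpha> f z) * indicator {z. 3 * R - 1 \<le> 2 * cmod z} z \<partial>disk_area)"
      using ker m by (intro C(2) \<nu> K bergman_spaceD[OF f]) auto
    also have "\<dots> \<le> ennreal (C * K * m powr ((s - p) / p)) * bergman_mass p \<alpha> f"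
      unfolding bergman_mass_def by (intro mult_left_mono nn_integral_mono) (auto simp: indicator_def)
    also have "\<dots> = ennreal (C * K * (m powr ((s - p) / p) * m))"
      using C K m by (simp add: ennreal_mult[symmetric] mult_ac)
    also have "m powr ((s - p) / p) * m = m powr (s / p)"
      using powr_mult_base[OF m(1), of "(s - p) / p"] p by (simp add: mult.commute diff_divide_distrib)
    also have "m powr (s / p) = a * N powr s"
      using N \<alpha> p by (simp add: m_def a_def powr_divide powr_powr)
    finally show "(\<integral>\<^sup>+w. ennreal (dens s (- \<sigma>) f w) * indicator {w. R \<le> cmod w} w \<partial>\<nu>)
      \<le> ennreal (C * a * K * bergman_norm p \<alpha> f powr s)"
      by (simp add: N_def mult_ac)
  qed
qed

text \<open>Near the circle the embedding holds with a small constant, uniformly along the bounded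
  sequence. On the remaining disk the functions are uniformly small,
  \<open>rho powr (- \<sigma>)\<close> is bounded and \<open>\<mu>\<close> is finite.\<close>

lemma kernel_vanishing_embedding:
  assumes p: "0 < p" "p \<le> s" and \<alpha>: "-1 < \<alpha>" and c: "0 < c" and \<sigma>: "0 \<le> \<sigma>"
    and A: "A = (2 + \<alpha>) * s / p + \<sigma>"
    and \<mu>: "finite_borel_measure_on_disk \<mu>" and v: "kernel_vanishing \<mu> c A"
    and f: "bergman_bounded_seq p \<alpha> f" "locally_uniformly_null f"
  shows "(\<lambda>n. \<integral>\<^sup>+w. ennreal (cmod (f n w) powr s * rho w powr (- \<sigma>)) \<partial>\<mu>) \<longlonglongrightarrow> 0"
proof (rule tendsto_zero_ennreal)
  fix \<epsilon> :: real assume \<epsilon>: "0 < \<epsilon>"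
  interpret finite_measure \<mu> using \<mu> by (simp add: finite_borel_measure_on_disk_def)
  obtain M0 where M0: "\<And>n. f n \<in> bergman_space p \<alpha>" "\<And>n. bergman_norm p \<alpha> (f n) \<le> M0"
    using f(1) unfolding bergman_bounded_seq_def by blast
  obtain C where C: "C > 0" "\<And>K R f. 0 \<le> K \<Longrightarrow> f \<in> bergman_space p \<alpha> \<Longrightarrow>
    (\<And>z. z\<in>unit_disk \<Longrightarrow> 3 * R - 1 \<le> 2 * cmod z \<Longrightarrow>
      (\<integral>\<^sup>+w. ennreal (kern (- c) w z) \<partial>\<mu>) \<le> ennreal (K * rho z powr (A - c))) \<Longrightarrow>
    (\<integral>\<^sup>+w. ennreal (dens s (- \<sigma>) f w) * indicator {w. R \<le> cmod w} w \<partial>\<mu>)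
    \<le> ennreal (C * K * bergman_norm p \<alpha> f powr s)"
    using bergman_embedding[OF p \<alpha> c A] \<mu> by blast
  define D where "D = C * (M0 powr s + 1)"
  have D: "D > 0" using C by (simp add: D_def add_nonneg_pos)
  define e where "e = \<epsilon> / (4 * D)"
  have e: "e > 0" using \<epsilon> D by (simp add: e_def)
  obtain R' where R': "R' < 1" "\<And>z. z \<in> unit_disk \<Longrightarrow> R' \<le> cmod z \<Longrightarrow>
    (\<integral>\<^sup>+w. ennreal (kern (- c) w z) \<partial>\<mu>) \<le> ennreal (e * rho z powr (A - c))"
    using v e unfolding kernel_vanishing_def by blast
  \<comment> \<open>The embedding for the tail beyond \<open>R\<close> uses the kernel condition on
    the larger annulus beyond \<open>(3 * R - 1) / 2\<close>, which must not reach below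
    \<open>R'\<close>.\<close>
  define R where "R = max 0 ((1 + 2 * R') / 3)"
  have "(1 + 2 * R') / 3 \<le> R" by (simp add: R_def)
  then have "2 * R' \<le> 3 * R - 1" by simp
  then have R: "0 \<le> R" "R < 1" "2 * R' \<le> 3 * R - 1" using R'(1) by (simp_all add: R_def)
  have tail: "(\<integral>\<^sup>+w. ennreal (cmod (f n w) powr s * rho w powr (- \<sigma>)) * indicator {w. R \<le> cmod w} w \<partial>\<mu>) \<le> ennreal (\<epsilon> / 4)" for n
  proof -
    have "(\<integral>\<^sup>+w. ennreal (cmod (f n w) powr s * rho w powr (- \<sigma>)) * indicator {w. R \<le> cmod w} w \<partial>\<mu>)
        \<le> ennreal (C * e * bergman_norm p \<alpha> (f n) powr s)"
      using e R by (intro C(2) M0(1) R'(2)) auto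
    also have "\<dots> \<le> ennreal (\<epsilon> / 4)"
    proof (rule ennreal_leI)
      have "bergman_norm p \<alpha> (f n) powr s \<le> M0 powr s"
        using M0(2) p bergman_norm_nonneg by (intro powr_mono2) auto
      then have "C * e * bergman_norm p \<alpha> (f n) powr s \<le> C * e * (M0 powr s + 1)"
        using C e by (intro mult_left_mono) auto
      also have "\<dots> = e * D" by (simp add: D_def)
      also have "\<dots> = \<epsilon> / 4" using D by (simp add: e_def)
      finally show "C * e * bergman_norm p \<alpha> (f n) powr s \<le> \<epsilon> / 4" .
    qed
    finally show ?thesis .
  qed
  define G where "G = (1 - R) powr (- \<sigma>) * (measure \<mu> (space \<mu>) + 1)"
  have G: "G > 0" using R by (simp add: G_def add_nonneg_pos)
  define b where "b = (\<epsilon> / (4 * G)) powr (1 / s)"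
  have b: "b > 0" "b powr s = \<epsilon> / (4 * G)" using \<epsilon> G p by (simp_all add: b_def powr_powr)
  have "uniform_limit (cball 0 R) f (\<lambda>_. 0) sequentially"
    using f(2) R unfolding locally_uniformly_null_def by (elim allE[of _ "cball 0 R"] impE) auto
  from uniform_limitD[OF this b(1)]
  show "\<forall>\<^sub>F n in sequentially. (\<integral>\<^sup>+w. ennreal (cmod (f n w) powr s * rho w powr (- \<sigma>)) \<partial>\<mu>) < ennreal \<epsilon>"
  proof eventually_elim
    case (elim n)
    have cl: "{w :: complex. R \<le> cmod w} \<in> sets borel"
      by (intro borel_closed closed_Collect_le continuous_intros)
    have fm: "f n \<in> borel_measurable \<mu>"
      by (intro disk_measure_measurable_holomorphic[OF \<mu>] bergman_spaceD[OF M0(1)])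
    have m: "(\<lambda>w. ennreal (cmod (f n w) powr s * rho w powr (- \<sigma>)) * indicator {w. R \<le> cmod w} w) \<in> borel_measurable \<mu>"
      by (intro borel_measurable_times_ennreal measurable_indicator_closed[OF \<mu> cl]
          measurable_compose[OF measurable_bergman_integrand[OF \<mu> fm] measurable_ennreal])
    have "(\<integral>\<^sup>+w. ennreal (cmod (f n w) powr s * rho w powr (- \<sigma>)) \<partial>\<mu>)
        \<le> (\<integral>\<^sup>+w. ennreal (cmod (f n w) powr s * rho w powr (- \<sigma>)) * indicator {w. R \<le> cmod w} w
          + ennreal (b powr s * (1 - R) powr (- \<sigma>)) \<partial>\<mu>)"
    proof (rule nn_integral_mono)
      fix w assume "w \<in> space \<mu>"
      then have w: "w \<in> unit_disk" by (simp add: space_disk_measure[OF \<mu>])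
      show "ennreal (cmod (f n w) powr s * rho w powr (- \<sigma>))
          \<le> ennreal (cmod (f n w) powr s * rho w powr (- \<sigma>)) * indicator {w. R \<le> cmod w} w
          + ennreal (b powr s * (1 - R) powr (- \<sigma>))"
      proof (cases "R \<le> cmod w")
        case False
        have "cmod (f n w) powr s \<le> b powr s"
          using elim False p by (intro powr_mono2) (auto simp: less_imp_le)
        moreover have "rho w powr (- \<sigma>) \<le> (1 - R) powr (- \<sigma>)"
          using False R \<sigma> rho_bounds(1)[OF w] by (intro powr_mono2') auto
        ultimately have "cmod (f n w) powr s * rho w powr (- \<sigma>) \<le> b powr s * (1 - R) powr (- \<sigma>)"
          by (intro mult_mono) auto
        then show ?thesis using False by (simp add: ennreal_leI)
      qed simp
    qed
    also have "\<dots> = (\<integral>\<^sup>+w. ennreal (cmod (f n w) powr s * rho w powr (- \<sigma>)) * indicator {w. R \<le> cmod w} w \<partial>\<mu>)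
        + ennreal (b powr s * (1 - R) powr (- \<sigma>)) * emeasure \<mu> (space \<mu>)"
      by (subst nn_integral_add[OF m]) simp_all
    also have "\<dots> \<le> ennreal (\<epsilon> / 4) + ennreal (b powr s * G)"
    proof (intro add_mono tail)
      have "ennreal (b powr s * (1 - R) powr (- \<sigma>)) * emeasure \<mu> (space \<mu>)
          = ennreal (b powr s * ((1 - R) powr (- \<sigma>) * measure \<mu> (space \<mu>)))"
        by (simp add: emeasure_eq_measure ennreal_mult[symmetric] mult.assoc)
      also have "\<dots> \<le> ennreal (b powr s * G)"
        unfolding G_def by (intro ennreal_leI mult_left_mono) auto
      finally show "ennreal (b powr s * (1 - R) powr (- \<sigma>)) * emeasure \<mu> (space \<mu>) \<le> ennreal (b powr s * G)" .
    qed
    also have "\<dots> = ennreal (\<epsilon> / 2)"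
      using \<epsilon> G by (simp add: b(2) ennreal_plus[symmetric] del: ennreal_plus)
    also have "\<dots> < ennreal \<epsilon>" using \<epsilon> by (intro ennreal_lessI) auto
    finally show ?case .
  qed
qed

lemma toeplitz_norm_bound:
  assumes q: "1 < q" and \<beta>: "-1 < \<beta>" and \<sigma>: "\<sigma> = (2 + \<beta>) * (1 - 1 / q)"
  shows "\<exists>C>0. \<forall>\<mu> f L. finite_borel_measure_on_disk \<mu> \<longrightarrow> f \<in> borel_measurable \<mu> \<longrightarrow> 0 \<le> L \<longrightarrow>
    (\<integral>\<^sup>+w. ennreal (cmod (f w) * rho w powr (- \<sigma>)) \<partial>\<mu>) \<le> ennreal L \<longrightarrow>
    integrable \<mu> f \<and> toeplitz \<mu> \<beta> f \<in> bergman_space q \<beta> \<and> bergman_norm q \<beta> (toeplitz \<mu> \<beta> f) \<le> C * L"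
proof -
  obtain C where C: "C > 0" "\<And>\<mu> f L. finite_borel_measure_on_disk \<mu> \<Longrightarrow> f \<in> borel_measurable \<mu> \<Longrightarrow> 0 < L \<Longrightarrow>
    (\<integral>\<^sup>+w. ennreal (cmod (f w) * rho w powr (- \<sigma>)) \<partial>\<mu>) \<le> ennreal L \<Longrightarrow>
    bergman_mass q \<beta> (toeplitz \<mu> \<beta> f) \<le> ennreal (C * L powr q)"
    using toeplitz_mass_bound[OF q \<beta> \<sigma>] by blast
  have \<sigma>0: "0 \<le> \<sigma>" using q \<beta> by (simp add: \<sigma>)
  define B where "B = ((1 + \<beta>) * C) powr (1 / q)"
  have B: "0 < B" using C \<beta> by (simp add: B_def)
  show ?thesis
  proof (intro exI[of _ B] conjI allI impI)
    fix \<mu> :: "complex measure" and f and L :: real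
    assume \<mu>: "finite_borel_measure_on_disk \<mu>" and f: "f \<in> borel_measurable \<mu>" and L: "0 \<le> L"
      and I: "(\<integral>\<^sup>+w. ennreal (cmod (f w) * rho w powr (- \<sigma>)) \<partial>\<mu>) \<le> ennreal L"
    show int: "integrable \<mu> f"
    proof (rule integrableI_bounded[OF f])
      have "(\<integral>\<^sup>+w. ennreal (norm (f w)) \<partial>\<mu>) \<le> (\<integral>\<^sup>+w. ennreal (cmod (f w) * rho w powr (- \<sigma>)) \<partial>\<mu>)"
      proof (intro nn_integral_mono ennreal_leI)
        fix w assume "w \<in> space \<mu>"
        then have w: "w \<in> unit_disk" by (simp add: space_disk_measure[OF \<mu>])
        have "1 powr (- \<sigma>) \<le> rho w powr (- \<sigma>)"
          using \<sigma>0 rho_pos[OF w] rho_le_1[of w] by (intro powr_mono2') auto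
        then have "cmod (f w) * 1 \<le> cmod (f w) * rho w powr (- \<sigma>)" by (intro mult_left_mono) auto
        then show "norm (f w) \<le> cmod (f w) * rho w powr (- \<sigma>)" by simp
      qed
      also have "\<dots> \<le> ennreal L" by (rule I)
      finally show "(\<integral>\<^sup>+w. ennreal (norm (f w)) \<partial>\<mu>) < \<infinity>" by (auto intro: order_le_less_trans)
    qed
    have hol: "toeplitz \<mu> \<beta> f holomorphic_on unit_disk"
      using \<beta> by (intro toeplitz_holomorphic \<mu> int) simp
    \<comment> \<open>The mass bound requires a positive \<open>L\<close>. Working with every
      \<open>L'\<close> above \<open>L\<close> and letting it decrease includes the case
      \<open>L = 0\<close>.\<close>
    have le: "toeplitz \<mu> \<beta> f \<in> bergman_space q \<beta> \<and> bergman_norm q \<beta> (toeplitz \<mu> \<beta> f) \<le> B * L'" if L': "L < L'" for L'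
    proof -
      have "bergman_mass q \<beta> (toeplitz \<mu> \<beta> f) \<le> ennreal (C * L' powr q)"
        using L L' by (intro C(2) \<mu> f order_trans[OF I] ennreal_leI) auto
      from bergman_norm_le[OF hol _ \<beta> _ this] q C
      have "toeplitz \<mu> \<beta> f \<in> bergman_space q \<beta>"
        "bergman_norm q \<beta> (toeplitz \<mu> \<beta> f) \<le> ((1 + \<beta>) * (C * L' powr q)) powr (1 / q)"
        by auto
      moreover have "((1 + \<beta>) * (C * L' powr q)) powr (1 / q) = B * L'"
      proof -
        have "((1 + \<beta>) * C * L' powr q) powr (1 / q) = B * (L' powr q) powr (1 / q)"
          unfolding B_def using C \<beta> by (simp add: powr_mult)
        then show ?thesis using q L L' by (simp add: powr_powr mult.assoc)
      qed
      ultimately show ?thesis by simp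
    qed
    show "toeplitz \<mu> \<beta> f \<in> bergman_space q \<beta>" using le[of "L + 1"] by simp
    show "bergman_norm q \<beta> (toeplitz \<mu> \<beta> f) \<le> B * L"
    proof (rule field_le_epsilon)
      fix \<delta> :: real assume \<delta>: "0 < \<delta>"
      have "bergman_norm q \<beta> (toeplitz \<mu> \<beta> f) \<le> B * (L + \<delta> / B)" using le[of "L + \<delta> / B"] \<delta> B by simp
      also have "\<dots> = B * L + \<delta>" using B by (simp add: distrib_left)
      finally show "bergman_norm q \<beta> (toeplitz \<mu> \<beta> f) \<le> B * L + \<delta>" .
    qed
  qed (rule B)
qed

section \<open>Sufficiency\<close>

lemma toeplitz_diff:
  assumes \<mu>: "finite_borel_measure_on_disk \<mu>" and f: "integrable \<mu> f" "integrable \<mu> g" and z: "z \<in> unit_disk"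
  shows "toeplitz \<mu> \<beta> (\<lambda>w. f w - g w) z = toeplitz \<mu> \<beta> f z - toeplitz \<mu> \<beta> g z"
  unfolding toeplitz_eq left_diff_distrib
  by (intro Bochner_Integration.integral_diff integrable_toeplitz \<mu> f z)

lemma poly_in_bergman_space:
  assumes "0 < p" "-1 < \<alpha>"
  shows "(\<lambda>z. poly P z) \<in> bergman_space p \<alpha>"
proof -
  have "compact (poly P ` cball 0 1)"
    by (intro compact_continuous_image continuous_intros compact_cball)
  then obtain b where b: "\<And>z. z \<in> cball 0 1 \<Longrightarrow> cmod (poly P z) \<le> b"
    using compact_imp_bounded bounded_iff by (metis image_eqI)
  obtain C where C: "C > 0" "\<And>f b. (\<And>z. z \<in> unit_disk \<Longrightarrow> cmod (f z) \<le> b) \<Longrightarrow> bergman_mass p \<alpha> f \<le> ennreal (C * b powr p)"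
    using bergman_mass_bounded_function[OF assms(2,1)] by blast
  have "bergman_mass p \<alpha> (poly P) \<le> ennreal (C * b powr p)"
    using b by (intro C(2)) auto
  then show ?thesis
    using C(1) assms by (intro bergman_norm_le(1)) (auto intro!: holomorphic_intros)
qed

text \<open>The function \<open>G\<close> shows that the choice in \<open>toeplitz_ext\<close> has a
  witness. The images of a single approximating sequence of polynomials converge both to the chosen
  function and to \<open>G\<close>, so these agree almost everywhere, which is all that norms
  detect.\<close>

lemma toeplitz_ext_AE_eq:
  assumes p: "0 < p" "-1 < \<alpha>" and q: "0 < q" "-1 < \<beta>"
    and T: "\<And>P. toeplitz \<mu> \<beta> (poly P) \<in> bergman_space q \<beta>"
    and G: "G \<in> bergman_space q \<beta>"
    and lim: "\<And>P :: nat \<Rightarrow> complex poly. (\<lambda>n. bergman_norm p \<alpha> (\<lambda>z. poly (P n) z - f z)) \<longlonglongrightarrow> 0 \<Longrightarrow>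
      (\<lambda>n. bergman_norm q \<beta> (\<lambda>z. toeplitz \<mu> \<beta> (poly (P n)) z - G z)) \<longlonglongrightarrow> 0"
    and P: "(\<lambda>n. bergman_norm p \<alpha> (\<lambda>z. poly ((P :: nat \<Rightarrow> complex poly) n) z - f z)) \<longlonglongrightarrow> 0"
  shows "toeplitz_ext \<mu> p \<alpha> q \<beta> f \<in> bergman_space q \<beta>"
    and "AE z in disk_area. toeplitz_ext \<mu> p \<alpha> q \<beta> f z = G z"
proof -
  let ?Nq = "bergman_norm q \<beta>"
  let ?T = "toeplitz \<mu> \<beta>"
  define g where "g = toeplitz_ext \<mu> p \<alpha> q \<beta> f"
  have "g \<in> bergman_space q \<beta> \<and>
        (\<forall>P :: nat \<Rightarrow> complex poly.
           (\<lambda>n. bergman_norm p \<alpha> (\<lambda>z. poly (P n) z - f z)) \<longlonglongrightarrow> 0 \<longrightarrow>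
           (\<lambda>n. ?Nq (\<lambda>z. ?T (poly (P n)) z - g z)) \<longlonglongrightarrow> 0)"
    unfolding g_def toeplitz_ext_def by (rule someI[of _ G]) (use G lim in blast)
  then have g: "g \<in> bergman_space q \<beta>"
    and glim: "(\<lambda>n. ?Nq (\<lambda>z. ?T (poly (P n)) z - g z)) \<longlonglongrightarrow> 0"
    using P by blast+
  show "toeplitz_ext \<mu> p \<alpha> q \<beta> f \<in> bergman_space q \<beta>" using g by (simp add: g_def)
  define K where "K = 2 * 2 powr (1 / q)"
  have "?Nq (\<lambda>z. g z - G z)
      \<le> K * (?Nq (\<lambda>z. ?T (poly (P n)) z - G z) + ?Nq (\<lambda>z. ?T (poly (P n)) z - g z))" for n
    using bergman_diff(2)[OF bergman_diff(1)[OF T[of "P n"] G q] bergman_diff(1)[OF T[of "P n"] g q] q]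
    by (simp add: K_def)
  moreover have "(\<lambda>n. K * (?Nq (\<lambda>z. ?T (poly (P n)) z - G z)
      + ?Nq (\<lambda>z. ?T (poly (P n)) z - g z))) \<longlonglongrightarrow> K * (0 + 0)"
    by (intro tendsto_intros lim P glim)
  ultimately have "?Nq (\<lambda>z. g z - G z) \<le> K * (0 + 0)"
    by (intro LIMSEQ_le_const) auto
  then have "?Nq (\<lambda>z. g z - G z) = 0"
    using bergman_norm_nonneg[of q \<beta> "\<lambda>z. g z - G z"] by simp
  from bergman_norm_eq_0_AE[OF bergman_diff(1)[OF g G q] q this]
  show "AE z in disk_area. toeplitz_ext \<mu> p \<alpha> q \<beta> f z = G z" by (simp add: g_def)
qed

lemma bergman_norm_ext_diff:
  assumes "AE z in disk_area. e z = G z" "e \<in> bergman_space q \<beta>" "G \<in> bergman_space q \<beta>" "-1 < \<beta>"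
    and "h \<in> borel_measurable disk_area"
  shows "bergman_norm q \<beta> (\<lambda>z. e z - h z) = bergman_norm q \<beta> (\<lambda>z. G z - h z)"
proof (rule bergman_norm_cong_AE)
  show "(\<lambda>z. e z - h z) \<in> borel_measurable disk_area" "(\<lambda>z. G z - h z) \<in> borel_measurable disk_area"
    by (intro borel_measurable_diff measurable_disk_area_holomorphic assms(5)
        bergman_spaceD[OF assms(2)] bergman_spaceD[OF assms(3)])+
qed (use assms in auto)

text \<open>The embedding with \<open>s = 1\<close>, which is admissible because
  \<open>p \<le> 1\<close>, supplies exactly the weighted integral of \<open>cmod f\<close> that
  Minkowski's inequality requires. The cut-off radius 0 makes it cover the whole disk.\<close>

lemma toeplitz_operator_bound:
  assumes p: "0 < p" "p \<le> 1" and q: "1 < q" and \<alpha>: "-1 < \<alpha>" and \<beta>: "-1 < \<beta>" and c: "0 < c"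
    and \<sigma>: "\<sigma> = (2 + \<beta>) * (1 - 1 / q)" and A: "A = (2 + \<alpha>) / p + \<sigma>"
    and \<mu>: "finite_borel_measure_on_disk \<mu>" and b: "kernel_bounded \<mu> c A K"
  shows "\<exists>B\<ge>0. \<forall>f\<in>bergman_space p \<alpha>.
    (\<integral>\<^sup>+w. ennreal (cmod (f w) * rho w powr (- \<sigma>)) \<partial>\<mu>) \<le> ennreal (B * bergman_norm p \<alpha> f) \<and>
    integrable \<mu> f \<and> toeplitz \<mu> \<beta> f \<in> bergman_space q \<beta> \<and>
    bergman_norm q \<beta> (toeplitz \<mu> \<beta> f) \<le> B * bergman_norm p \<alpha> f"
proof -
  let ?Np = "bergman_norm p \<alpha>"
  let ?T = "toeplitz \<mu> \<beta>"
  have A': "A = (2 + \<alpha>) * 1 / p + \<sigma>" using A by simp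
  have K: "0 \<le> K" using b by (simp add: kernel_bounded_def)
  obtain C where C: "C > 0" "\<And>K R f. 0 \<le> K \<Longrightarrow> f \<in> bergman_space p \<alpha> \<Longrightarrow>
    (\<And>z. z\<in>unit_disk \<Longrightarrow> 3 * R - 1 \<le> 2 * cmod z \<Longrightarrow>
      (\<integral>\<^sup>+w. ennreal (kern (- c) w z) \<partial>\<mu>) \<le> ennreal (K * rho z powr (A - c))) \<Longrightarrow>
    (\<integral>\<^sup>+w. ennreal (dens 1 (- \<sigma>) f w) * indicator {w. R \<le> cmod w} w \<partial>\<mu>)
    \<le> ennreal (C * K * ?Np f powr 1)"
    using bergman_embedding[OF p \<alpha> c A'] \<mu> by blast
  obtain D where D: "D > 0" "\<And>f L. f \<in> borel_measurable \<mu> \<Longrightarrow> 0 \<le> L \<Longrightarrow>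
    (\<integral>\<^sup>+w. ennreal (cmod (f w) * rho w powr (- \<sigma>)) \<partial>\<mu>) \<le> ennreal L \<Longrightarrow>
    integrable \<mu> f \<and> ?T f \<in> bergman_space q \<beta> \<and> bergman_norm q \<beta> (?T f) \<le> D * L"
    using toeplitz_norm_bound[OF q \<beta> \<sigma>] \<mu> by blast
  define B where "B = (1 + D) * (C * K)"
  have CK: "0 \<le> C * K" using C K by simp
  then have B: "0 \<le> B" "C * K \<le> B" "D * (C * K) \<le> B"
    using D(1) by (auto simp: B_def distrib_right)
  show ?thesis
  proof (intro exI[of _ B] conjI ballI)
    fix f assume f: "f \<in> bergman_space p \<alpha>"
    define N where "N = ?Np f"
    have N: "0 \<le> N" by (simp add: N_def bergman_norm_nonneg)
    have "(\<integral>\<^sup>+w. ennreal (dens 1 (- \<sigma>) f w) * indicator {w. 0 \<le> cmod w} w \<partial>\<mu>)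
        \<le> ennreal (C * K * ?Np f powr 1)"
      using b by (intro C(2) K f) (auto simp: kernel_bounded_def)
    then have I: "(\<integral>\<^sup>+w. ennreal (cmod (f w) * rho w powr (- \<sigma>)) \<partial>\<mu>) \<le> ennreal (C * K * N)"
      using N by (simp add: N_def)
    also have "\<dots> \<le> ennreal (B * N)" using B N by (intro ennreal_leI mult_right_mono)
    finally show "(\<integral>\<^sup>+w. ennreal (cmod (f w) * rho w powr (- \<sigma>)) \<partial>\<mu>) \<le> ennreal (B * ?Np f)"
      by (simp add: N_def)
    have "0 \<le> C * K * N" using CK N by simp
    note T = D(2)[OF disk_measure_measurable_holomorphic[OF \<mu> bergman_spaceD[OF f]] this I]
    show "integrable \<mu> f" "?T f \<in> bergman_space q \<beta>" using T by auto
    have "bergman_norm q \<beta> (?T f) \<le> D * (C * K) * N" using T by (simp add: mult.assoc)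
    also have "\<dots> \<le> B * N" using B N by (intro mult_right_mono)
    finally show "bergman_norm q \<beta> (?T f) \<le> B * ?Np f" by (simp add: N_def)
  qed (rule B)
qed

text \<open>If the integral formula is bounded on the whole Bergman space, it is itself a continuous
  extension from the polynomials, and their density makes it the only one.\<close>

lemma toeplitz_ext_eq_toeplitz:
  assumes p: "0 < p" and q: "0 < q" and \<alpha>: "-1 < \<alpha>" and \<beta>: "-1 < \<beta>"
    and \<mu>: "finite_borel_measure_on_disk \<mu>"
    and B: "\<And>f. f \<in> bergman_space p \<alpha> \<Longrightarrow> integrable \<mu> f \<and> toeplitz \<mu> \<beta> f \<in> bergman_space q \<beta> \<and>
      bergman_norm q \<beta> (toeplitz \<mu> \<beta> f) \<le> B * bergman_norm p \<alpha> f"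
    and f: "f \<in> bergman_space p \<alpha>"
  shows "toeplitz_ext \<mu> p \<alpha> q \<beta> f \<in> bergman_space q \<beta>"
    and "AE z in disk_area. toeplitz_ext \<mu> p \<alpha> q \<beta> f z = toeplitz \<mu> \<beta> f z"
proof -
  let ?Np = "bergman_norm p \<alpha>"
  let ?Nq = "bergman_norm q \<beta>"
  let ?T = "toeplitz \<mu> \<beta>"
  have lim: "(\<lambda>n. ?Nq (\<lambda>z. ?T (poly (P n)) z - ?T f z)) \<longlonglongrightarrow> 0"
    if P: "(\<lambda>n. ?Np (\<lambda>z. poly (P n) z - f z)) \<longlonglongrightarrow> 0" for P :: "nat \<Rightarrow> complex poly"
  proof (rule tendsto_sandwich[of "\<lambda>_. 0" _ _ "\<lambda>n. B * ?Np (\<lambda>z. poly (P n) z - f z)"])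
    show "(\<lambda>n. B * ?Np (\<lambda>z. poly (P n) z - f z)) \<longlonglongrightarrow> 0"
      using tendsto_mult_left[OF P, of B] by simp
    show "\<forall>\<^sub>F n in sequentially. ?Nq (\<lambda>z. ?T (poly (P n)) z - ?T f z)
        \<le> B * ?Np (\<lambda>z. poly (P n) z - f z)"
    proof (intro always_eventually allI)
      fix n
      note pn = poly_in_bergman_space[OF p \<alpha>, of "P n"]
      have "?Nq (\<lambda>z. ?T (poly (P n)) z - ?T f z)
          = ?Nq (?T (\<lambda>z. poly (P n) z - f z))"
        using B[OF pn] B[OF f] B[OF bergman_diff(1)[OF pn f p \<alpha>]]
        by (intro bergman_norm_cong_AE \<beta> borel_measurable_diff measurable_disk_area_holomorphic AE_I2
            toeplitz_diff[symmetric] \<mu>) (auto intro: bergman_spaceD)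
      also have "\<dots> \<le> B * ?Np (\<lambda>z. poly (P n) z - f z)"
        using B[OF bergman_diff(1)[OF pn f p \<alpha>]] by simp
      finally show "?Nq (\<lambda>z. ?T (poly (P n)) z - ?T f z)
        \<le> B * ?Np (\<lambda>z. poly (P n) z - f z)" .
    qed
  qed (auto simp: bergman_norm_nonneg)
  obtain P :: "nat \<Rightarrow> complex poly" where P: "(\<lambda>n. ?Np (\<lambda>z. poly (P n) z - f z)) \<longlonglongrightarrow> 0"
    using polynomials_dense[OF p \<alpha> f] by blast
  have T: "?T (poly P) \<in> bergman_space q \<beta>" for P
    using B[OF poly_in_bergman_space[OF p \<alpha>, of P]] by simp
  have G: "?T f \<in> bergman_space q \<beta>" using B[OF f] by simp
  show "toeplitz_ext \<mu> p \<alpha> q \<beta> f \<in> bergman_space q \<beta>"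
    and "AE z in disk_area. toeplitz_ext \<mu> p \<alpha> q \<beta> f z = ?T f z"
    by (rule toeplitz_ext_AE_eq[OF p \<alpha> q \<beta> T G lim P]; assumption)+
qed

text \<open>The weighted integrals of \<open>cmod (f n)\<close> tend to 0 by the embedding with
  \<open>s = 1\<close>, and they dominate the norms of the images.\<close>

lemma kernel_vanishing_toeplitz_null:
  assumes p: "0 < p" "p \<le> 1" and q: "1 < q" and \<alpha>: "-1 < \<alpha>" and \<beta>: "-1 < \<beta>" and c: "0 < c"
    and \<sigma>: "\<sigma> = (2 + \<beta>) * (1 - 1 / q)" and A: "A = (2 + \<alpha>) / p + \<sigma>"
    and \<mu>: "finite_borel_measure_on_disk \<mu>" and v: "kernel_vanishing \<mu> c A"
    and f: "bergman_bounded_seq p \<alpha> f" "locally_uniformly_null f"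
  shows "(\<lambda>n. bergman_norm q \<beta> (toeplitz \<mu> \<beta> (f n))) \<longlonglongrightarrow> 0"
proof -
  let ?T = "toeplitz \<mu> \<beta>"
  have A': "A = (2 + \<alpha>) * 1 / p + \<sigma>" using A by simp
  have \<sigma>0: "0 \<le> \<sigma>" using q \<beta> by (simp add: \<sigma>)
  obtain D where D: "D > 0" "\<And>f L. f \<in> borel_measurable \<mu> \<Longrightarrow> 0 \<le> L \<Longrightarrow>
    (\<integral>\<^sup>+w. ennreal (cmod (f w) * rho w powr (- \<sigma>)) \<partial>\<mu>) \<le> ennreal L \<Longrightarrow>
    integrable \<mu> f \<and> ?T f \<in> bergman_space q \<beta> \<and> bergman_norm q \<beta> (?T f) \<le> D * L"
    using toeplitz_norm_bound[OF q \<beta> \<sigma>] \<mu> by blast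
  define I where "I n = (\<integral>\<^sup>+w. ennreal (cmod (f n w) * rho w powr (- \<sigma>)) \<partial>\<mu>)" for n
  have lim: "I \<longlonglongrightarrow> 0"
    using kernel_vanishing_embedding[OF p \<alpha> c \<sigma>0 A' \<mu> v f] by (simp add: I_def[abs_def])
  have fm: "f n \<in> borel_measurable \<mu>" for n
    using f(1) by (intro disk_measure_measurable_holomorphic[OF \<mu>] bergman_spaceD) (auto simp: bergman_bounded_seq_def)
  show ?thesis
  proof (rule tendstoI)
    fix \<epsilon> :: real assume \<epsilon>: "0 < \<epsilon>"
    have "\<forall>\<^sub>F n in sequentially. I n < ennreal (\<epsilon> / (2 * D))"
      using lim \<epsilon> D(1) by (intro order_tendstoD(2)) auto
    then show "\<forall>\<^sub>F n in sequentially. dist (bergman_norm q \<beta> (?T (f n))) 0 < \<epsilon>"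
    proof eventually_elim
      case (elim n)
      then have "bergman_norm q \<beta> (?T (f n)) \<le> D * (\<epsilon> / (2 * D))"
        using D(2)[OF fm, of "\<epsilon> / (2 * D)" n] \<epsilon> D(1) by (auto simp: I_def)
      also have "\<dots> < \<epsilon>" using \<epsilon> D(1) by simp
      finally show ?case by (simp add: bergman_norm_nonneg)
    qed
  qed
qed

section \<open>Normal families and compactness of the operator\<close>

lemma bergman_pointwise_norm:
  assumes p: "0 < p" and \<alpha>: "-1 < \<alpha>"
  shows "\<exists>C>0. \<forall>f\<in>bergman_space p \<alpha>. \<forall>w\<in>unit_disk.
    cmod (f w) \<le> C * rho w powr (- ((2 + \<alpha>) / p)) * bergman_norm p \<alpha> f"
proof -
  obtain C where C: "C > 0" "\<And>f w. f holomorphic_on unit_disk \<Longrightarrow> w \<in> unit_disk \<Longrightarrow>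
    ennreal (cmod (f w) powr p) \<le> ennreal (C * rho w powr (- (2 + \<alpha>))) * bergman_mass p \<alpha> f"
    using bergman_pointwise_estimate[OF p \<alpha>] by blast
  define D where "D = (C / (1 + \<alpha>)) powr (1 / p)"
  have D: "D > 0" using C \<alpha> by (simp add: D_def)
  show ?thesis
  proof (intro exI[of _ D] conjI ballI)
    fix f w assume f: "f \<in> bergman_space p \<alpha>" and w: "w \<in> unit_disk"
    define N where "N = bergman_norm p \<alpha> f"
    have N: "0 \<le> N" by (simp add: N_def bergman_norm_nonneg)
    have "ennreal (cmod (f w) powr p) \<le> ennreal (C * rho w powr (- (2 + \<alpha>))) * ennreal (N powr p / (1 + \<alpha>))"
      using C(2)[OF bergman_spaceD[OF f] w] by (simp add: bergman_mass_eq_norm[OF f p \<alpha>] N_def)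
    also have "\<dots> = ennreal (C * rho w powr (- (2 + \<alpha>)) * (N powr p / (1 + \<alpha>)))"
      using C(1) \<alpha> by (intro ennreal_mult[symmetric]) auto
    finally have "cmod (f w) powr p \<le> C * rho w powr (- (2 + \<alpha>)) * (N powr p / (1 + \<alpha>))"
      using C(1) \<alpha> by simp
    then have "(cmod (f w) powr p) powr (1 / p) \<le> (C * rho w powr (- (2 + \<alpha>)) * (N powr p / (1 + \<alpha>))) powr (1 / p)"
      using p by (intro powr_mono2) auto
    also have "(cmod (f w) powr p) powr (1 / p) = cmod (f w)" using p by (simp add: powr_powr)
    also have "C * rho w powr (- (2 + \<alpha>)) * (N powr p / (1 + \<alpha>)) = (C / (1 + \<alpha>)) * (rho w powr (- (2 + \<alpha>)) * N powr p)"
      by simp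
    also have "\<dots> powr (1 / p) = D * (rho w powr (- (2 + \<alpha>)) * N powr p) powr (1 / p)"
      unfolding D_def by (rule powr_mult)
    also have "(rho w powr (- (2 + \<alpha>)) * N powr p) powr (1 / p) = rho w powr (- ((2 + \<alpha>) / p)) * N"
      using N p by (simp add: powr_mult powr_powr minus_divide_left)
    finally show "cmod (f w) \<le> D * rho w powr (- ((2 + \<alpha>) / p)) * bergman_norm p \<alpha> f"
      by (simp add: N_def mult.assoc)
  qed (rule D)
qed

text \<open>Point evaluations are bounded locally uniformly, so Montel's theorem provides a locally
  uniform limit, and Fatou's lemma keeps it in the space. This reduces arbitrary bounded sequences,
  which the definition of compactness allows for \<open>p = 1\<close>, to null sequences.\<close>

lemma bergman_bounded_seq_subseq:
  assumes p: "0 < p" and \<alpha>: "-1 < \<alpha>" and f: "bergman_bounded_seq p \<alpha> f"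
  shows "\<exists>r g. strict_mono (r :: nat \<Rightarrow> nat) \<and> g \<in> bergman_space p \<alpha> \<and>
    bergman_bounded_seq p \<alpha> (\<lambda>n z. f (r n) z - g z) \<and> locally_uniformly_null (\<lambda>n z. f (r n) z - g z)"
proof -
  let ?Np = "bergman_norm p \<alpha>"
  let ?Sp = "bergman_space p \<alpha>"
  obtain M where M: "\<And>n. f n \<in> ?Sp" "\<And>n. ?Np (f n) \<le> M"
    using f unfolding bergman_bounded_seq_def by blast
  have M0: "0 \<le> M" using M(2)[of 0] bergman_norm_nonneg[of p \<alpha> "f 0"] by simp
  obtain C where C: "C > 0" "\<And>f w. f \<in> ?Sp \<Longrightarrow> w \<in> unit_disk \<Longrightarrow>
    cmod (f w) \<le> C * rho w powr (- ((2 + \<alpha>) / p)) * ?Np f"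
    using bergman_pointwise_norm[OF p \<alpha>] by blast
  have bdd: "\<exists>B. \<forall>h\<in>range f. \<forall>z\<in>K. norm (h z) \<le> B" if K: "compact K" "K \<subseteq> unit_disk" for K
  proof -
    have "continuous_on K (\<lambda>z. C * rho z powr (- ((2 + \<alpha>) / p)) * M)"
    proof -
      have "continuous_on K rho" unfolding rho_def by (intro continuous_intros)
      moreover have "rho z \<noteq> 0" if "z \<in> K" for z
        using rho_pos[of z] that K(2) by auto
      ultimately show ?thesis by (intro continuous_intros) auto
    qed
    then have "compact ((\<lambda>z. C * rho z powr (- ((2 + \<alpha>) / p)) * M) ` K)"
      by (rule compact_continuous_image[OF _ K(1)])
    then have "bdd_above ((\<lambda>z. C * rho z powr (- ((2 + \<alpha>) / p)) * M) ` K)"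
      by (intro bounded_imp_bdd_above compact_imp_bounded)
    then obtain B where B: "\<And>z. z \<in> K \<Longrightarrow> C * rho z powr (- ((2 + \<alpha>) / p)) * M \<le> B"
      unfolding bdd_above_def by blast
    have "norm (f n z) \<le> B" if "z \<in> K" for n z
    proof -
      have "norm (f n z) \<le> C * rho z powr (- ((2 + \<alpha>) / p)) * ?Np (f n)"
        using K(2) that by (intro C(2) M(1)) auto
      also have "\<dots> \<le> C * rho z powr (- ((2 + \<alpha>) / p)) * M"
        using C(1) by (intro mult_left_mono M(2)) auto
      also have "\<dots> \<le> B" by (rule B[OF that])
      finally show ?thesis .
    qed
    then show ?thesis by blast
  qed
  have holf: "\<And>h. h \<in> range f \<Longrightarrow> h holomorphic_on unit_disk" using bergman_spaceD[OF M(1)] by auto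
  obtain g r where g: "g holomorphic_on unit_disk" and r: "strict_mono (r :: nat \<Rightarrow> nat)"
    and ptw: "\<And>x. x \<in> unit_disk \<Longrightarrow> (\<lambda>n. f (r n) x) \<longlonglongrightarrow> g x"
    and uni: "\<And>K. compact K \<Longrightarrow> K \<subseteq> unit_disk \<Longrightarrow> uniform_limit K (f \<circ> r) g sequentially"
    using Montel[OF open_ball holf bdd order_refl] by metis
  define m where "m = M powr p / (1 + \<alpha>)"
  have m: "0 \<le> m" using \<alpha> by (simp add: m_def)
  have mass: "bergman_mass p \<alpha> (f n) \<le> ennreal m" for n
    unfolding bergman_mass_eq_norm[OF M(1) p \<alpha>] m_def
    using M(2) p \<alpha> bergman_norm_nonneg by (intro ennreal_leI divide_right_mono powr_mono2) auto
  have "bergman_mass p \<alpha> g = (\<integral>\<^sup>+z. liminf (\<lambda>n. ennreal (cmod (f (r n) z) powr p * rho z powr \<alpha>)) \<partial>disk_area)"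
    unfolding bergman_mass_def
  proof (rule nn_integral_cong)
    fix z assume "z \<in> space disk_area"
    then have z: "z \<in> unit_disk" by simp
    have "(\<lambda>n. ennreal (cmod (f (r n) z) powr p * rho z powr \<alpha>)) \<longlonglongrightarrow> ennreal (dens p \<alpha> g z)"
      using p by (intro tendsto_ennrealI tendsto_mult tendsto_const tendsto_powr' tendsto_norm ptw z) auto
    then show "ennreal (dens p \<alpha> g z) = liminf (\<lambda>n. ennreal (cmod (f (r n) z) powr p * rho z powr \<alpha>))"
      by (intro lim_imp_Liminf[symmetric]) auto
  qed
  also have "\<dots> \<le> liminf (\<lambda>n. bergman_mass p \<alpha> (f (r n)))"
    unfolding bergman_mass_def
    by (intro nn_integral_liminf measurable_mass_integrand measurable_disk_area_holomorphic bergman_spaceD[OF M(1)])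
  also have "\<dots> \<le> ennreal m"
    by (rule Liminf_le) (simp_all add: mass)
  finally have gs: "g \<in> ?Sp"
    by (intro bergman_norm_le(1)[OF g p \<alpha> m])
  show ?thesis
  proof (intro exI conjI)
    show "strict_mono r" by (rule r)
    show "g \<in> ?Sp" by (rule gs)
    show "bergman_bounded_seq p \<alpha> (\<lambda>n z. f (r n) z - g z)"
      unfolding bergman_bounded_seq_def
    proof (intro conjI allI exI)
      show "(\<lambda>z. f (r n) z - g z) \<in> ?Sp" for n by (rule bergman_diff(1)[OF M(1) gs p \<alpha>])
      have "?Np (\<lambda>z. f (r n) z - g z) \<le> 2 * 2 powr (1 / p) * (?Np (f (r n)) + ?Np g)" for n
        by (rule bergman_diff(2)[OF M(1) gs p \<alpha>])
      also have "\<dots> n \<le> 2 * 2 powr (1 / p) * (M + ?Np g)" for n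
        using M(2) by (intro mult_left_mono add_right_mono) auto
      finally show "?Np (\<lambda>z. f (r n) z - g z) \<le> 2 * 2 powr (1 / p) * (M + ?Np g)" for n .
    qed
    show "locally_uniformly_null (\<lambda>n z. f (r n) z - g z)"
      unfolding locally_uniformly_null_def
    proof (intro allI impI)
      fix K :: "complex set" assume "compact K \<and> K \<subseteq> unit_disk"
      then have "uniform_limit K (f \<circ> r) g sequentially" using uni by blast
      then show "uniform_limit K (\<lambda>n z. f (r n) z - g z) (\<lambda>_. 0) sequentially"
        by (simp add: uniform_limit_iff dist_norm)
    qed
  qed
qed

lemma kernel_vanishing_imp_toeplitz_compact:
  assumes p: "0 < p" "p \<le> 1" and q: "1 < q" and \<alpha>: "-1 < \<alpha>" and \<beta>: "-1 < \<beta>" and c: "0 < c" "A < c"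
    and \<sigma>: "\<sigma> = (2 + \<beta>) * (1 - 1 / q)" and A: "A = (2 + \<alpha>) / p + \<sigma>"
    and \<mu>: "finite_borel_measure_on_disk \<mu>" and v: "kernel_vanishing \<mu> c A"
  shows "toeplitz_compact \<mu> p \<alpha> q \<beta>"
proof -
  let ?Nq = "bergman_norm q \<beta>"
  let ?Sp = "bergman_space p \<alpha>"
  let ?Sq = "bergman_space q \<beta>"
  let ?Text = "toeplitz_ext \<mu> p \<alpha> q \<beta>"
  let ?T = "toeplitz \<mu> \<beta>"
  have q0: "0 < q" using q by simp
  obtain K where K: "kernel_bounded \<mu> c A K"
    using kernel_vanishing_imp_bounded[OF \<mu> c v] by blast
  obtain B where B: "\<And>f. f \<in> ?Sp \<Longrightarrow> integrable \<mu> f \<and> ?T f \<in> ?Sq \<and>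
      ?Nq (?T f) \<le> B * bergman_norm p \<alpha> f"
    using toeplitz_operator_bound[OF p q \<alpha> \<beta> c(1) \<sigma> A \<mu> K] by blast
  have ext: "?Text f \<in> ?Sq"
    "AE z in disk_area. ?Text f z = ?T f z" if "f \<in> ?Sp" for f
    by (rule toeplitz_ext_eq_toeplitz[OF p(1) q0 \<alpha> \<beta> \<mu> _ that]; rule B; assumption)+
  note null = kernel_vanishing_toeplitz_null[OF p q \<alpha> \<beta> c(1) \<sigma> A \<mu> v]
  have bdd: "toeplitz_bounded \<mu> p \<alpha> q \<beta>"
    unfolding toeplitz_bounded_def using B poly_in_bergman_space[OF p(1) \<alpha>] by (intro exI[of _ B]) auto
  show ?thesis
  proof (cases "1 \<le> p")
    case False
    have "(\<lambda>n. ?Nq (?Text (f n))) \<longlonglongrightarrow> 0"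
      if f: "bergman_bounded_seq p \<alpha> f" "locally_uniformly_null f" for f
    proof -
      have fs: "f n \<in> ?Sp" for n using f(1) by (simp add: bergman_bounded_seq_def)
      have "?Nq (?Text (f n)) = ?Nq (?T (f n))" for n
        using B[OF fs[of n]] ext[OF fs[of n]]
        by (intro bergman_norm_cong_AE measurable_disk_area_holomorphic \<beta> bergman_spaceD[where p=q and \<alpha>=\<beta>]) auto
      then show ?thesis using null[OF f] by simp
    qed
    then show ?thesis using False bdd by (simp add: toeplitz_compact_def)
  next
    case True
    have "\<exists>r g. strict_mono r \<and> g \<in> ?Sq \<and>
        (\<lambda>n. ?Nq (\<lambda>z. ?Text (f (r n)) z - g z)) \<longlonglongrightarrow> 0"
      if f: "bergman_bounded_seq p \<alpha> f" for f
    proof -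
      have fs: "f n \<in> ?Sp" for n using f by (simp add: bergman_bounded_seq_def)
      obtain r g where r: "strict_mono (r :: nat \<Rightarrow> nat)" and g: "g \<in> ?Sp"
        and fr: "bergman_bounded_seq p \<alpha> (\<lambda>n z. f (r n) z - g z)" "locally_uniformly_null (\<lambda>n z. f (r n) z - g z)"
        using bergman_bounded_seq_subseq[OF p(1) \<alpha> f] by blast
      \<comment> \<open>The image of the locally uniform limit is the limit of the images, since the
        differences \<open>f (r n) - g\<close> form a bounded null sequence.\<close>
      have Tg: "?T g \<in> ?Sq" using B[OF g] by simp
      have "?Nq (\<lambda>z. ?Text (f (r n)) z - ?T g z)
          = ?Nq (?T (\<lambda>z. f (r n) z - g z))" for n
      proof -
        have "?Nq (\<lambda>z. ?Text (f (r n)) z - ?T g z)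
            = ?Nq (\<lambda>z. ?T (f (r n)) z - ?T g z)"
          using ext[OF fs[of "r n"]] B[OF fs[of "r n"]] Tg \<beta>
          by (intro bergman_norm_ext_diff measurable_disk_area_holomorphic[OF bergman_spaceD]) auto
        also have "\<dots> = ?Nq (?T (\<lambda>z. f (r n) z - g z))"
          using B[OF fs[of "r n"]] B[OF g] B[OF bergman_diff(1)[OF fs[of "r n"] g p(1) \<alpha>]]
          by (intro bergman_norm_cong_AE \<beta> borel_measurable_diff measurable_disk_area_holomorphic AE_I2
            toeplitz_diff[symmetric] \<mu>) (auto intro: bergman_spaceD)
        finally show ?thesis .
      qed
      then have "(\<lambda>n. ?Nq (\<lambda>z. ?Text (f (r n)) z - ?T g z)) \<longlonglongrightarrow> 0"
        using null[OF fr] by simp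
      then show ?thesis using r Tg by blast
    qed
    then show ?thesis using True bdd by (simp add: toeplitz_compact_def)
  qed
qed

section \<open>Test functions\<close>

lemma ex_sequence_not_kernel_vanishing:
  assumes "\<not> kernel_vanishing \<mu> c A"
  shows "\<exists>e>0. \<exists>a :: nat \<Rightarrow> complex. (\<forall>n. a n \<in> unit_disk) \<and> (\<lambda>n. rho (a n)) \<longlonglongrightarrow> 0 \<and>
    (\<forall>n. ennreal (e * rho (a n) powr (A - c)) < (\<integral>\<^sup>+w. ennreal (kern (- c) w (a n)) \<partial>\<mu>))"
proof -
  obtain e where e: "e > 0" and ne: "\<And>R. R < 1 \<Longrightarrow> \<exists>z\<in>unit_disk. R \<le> cmod z \<and>
    \<not> (\<integral>\<^sup>+w. ennreal (kern (- c) w z) \<partial>\<mu>) \<le> ennreal (e * rho z powr (A - c))"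
    using assms unfolding kernel_vanishing_def by blast
  have "\<exists>z\<in>unit_disk. 1 - 1 / real (Suc n) \<le> cmod z \<and>
    \<not> (\<integral>\<^sup>+w. ennreal (kern (- c) w z) \<partial>\<mu>) \<le> ennreal (e * rho z powr (A - c))" for n
    by (rule ne) simp
  then obtain a where a: "\<And>n. a n \<in> unit_disk" "\<And>n. 1 - 1 / real (Suc n) \<le> cmod (a n)"
    "\<And>n. \<not> (\<integral>\<^sup>+w. ennreal (kern (- c) w (a n)) \<partial>\<mu>) \<le> ennreal (e * rho (a n) powr (A - c))"
    by metis
  have "(\<lambda>n. rho (a n)) \<longlonglongrightarrow> 0"
  proof (rule tendsto_sandwich[of "\<lambda>_. 0" _ _ "\<lambda>n. 2 * (1 / real (Suc n))"])
    have "rho (a n) \<le> 2 * (1 / real (Suc n))" for n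
      using rho_bounds(2)[OF a(1)[of n]] a(2)[of n] by argo
    then show "\<forall>\<^sub>F n in sequentially. rho (a n) \<le> 2 * (1 / real (Suc n))" by simp
    show "\<forall>\<^sub>F n in sequentially. 0 \<le> rho (a n)" using rho_pos[OF a(1)] by (simp add: less_imp_le)
    have "(\<lambda>n. 2 * (1 / real (Suc n))) \<longlonglongrightarrow> 2 * 0"
      by (intro tendsto_intros LIMSEQ_Suc lim_1_over_n)
    then show "(\<lambda>n. 2 * (1 / real (Suc n))) \<longlonglongrightarrow> 0" by simp
  qed simp
  then show ?thesis using e a by (intro exI[of _ e] conjI exI[of _ a]) (auto simp: not_le)
qed

text \<open>A power of the kernel at \<open>a\<close> with a normalizing factor. The monomial meets
  the factor \<open>cnj w ^ N\<close> that an \<open>N\<close>-fold derivative of the Toeplitz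
  integral brings out, and turns it into \<open>cmod w ^ (2 * N)\<close>.\<close>

definition test_fun :: "nat \<Rightarrow> real \<Rightarrow> real \<Rightarrow> complex \<Rightarrow> complex \<Rightarrow> complex" where
  "test_fun N B \<kappa> a w = w ^ N * (of_real (rho a powr \<kappa>) * (1 - w * cnj a) powr complex_of_real (- B))"

lemma cmod_test_fun: "cmod (test_fun N B \<kappa> a w) = cmod w ^ N * (rho a powr \<kappa> * kern (- B) w a)"
  by (simp add: test_fun_def norm_mult norm_power cmod_powr_of_real del: of_real_minus)

text \<open>The radius lies strictly between 1 and \<open>1 / cmod a\<close>, the modulus of the
  singularity when \<open>a\<close> is not 0. Holomorphy beyond the closed unit disk gives uniform
  approximation by polynomials on it.\<close>

lemma test_fun_holomorphic:
  assumes "a \<in> unit_disk"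
  shows "test_fun N B \<kappa> a holomorphic_on ball 0 (2 / (1 + cmod a))" "1 < 2 / (1 + cmod a)"
proof -
  have a: "cmod a < 1" "0 < 1 + cmod a" using assms by (simp_all add: add_pos_nonneg)
  show "1 < 2 / (1 + cmod a)" using a by (simp add: less_divide_eq)
  have "1 - w * cnj a \<notin> \<real>\<^sub>\<le>\<^sub>0" if "w \<in> ball 0 (2 / (1 + cmod a))" for w
  proof -
    have "cmod w * (1 + cmod a) < 2" using that a by (simp add: less_divide_eq)
    then have "cmod w * cmod a < 1 \<or> cmod w \<le> 1" using a by (simp add: algebra_simps) linarith
    then have "cmod w * cmod a < 1"
    proof
      assume "cmod w \<le> 1"
      then have "cmod w * cmod a \<le> 1 * cmod a" by (intro mult_right_mono) auto
      then show ?thesis using a by simp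
    qed
    moreover have "Re (w * cnj a) \<le> cmod w * cmod a"
      using complex_Re_le_cmod[of "w * cnj a"] by (simp only: norm_mult complex_mod_cnj)
    ultimately have "0 < Re (1 - w * cnj a)" by (simp del: times_complex.sel)
    then show ?thesis by (auto simp: complex_nonpos_Reals_iff)
  qed
  then show "test_fun N B \<kappa> a holomorphic_on ball 0 (2 / (1 + cmod a))"
    unfolding test_fun_def[abs_def] by (intro holomorphic_intros) auto
qed

text \<open>\<open>\<kappa>\<close> is the exponent for which the \<open>p\<close>-th power of the
  normalization cancels the growth of the kernel integral, and \<open>B * p > 2 + \<alpha>\<close>
  is the range of the kernel estimate.\<close>

lemma test_fun_bounded:
  assumes p: "0 < p" and \<alpha>: "-1 < \<alpha>" and B: "2 + \<alpha> < B * p" and \<kappa>: "\<kappa> = B - (2 + \<alpha>) / p"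
  shows "\<exists>M\<ge>0. \<forall>a\<in>unit_disk. test_fun N B \<kappa> a \<in> bergman_space p \<alpha> \<and> bergman_norm p \<alpha> (test_fun N B \<kappa> a) \<le> M"
proof -
  obtain C where C: "C \<ge> 0" "\<And>w. w \<in> unit_disk \<Longrightarrow>
    (\<integral>\<^sup>+z. ennreal (rho z powr \<alpha> * kern (- (B * p)) z w) \<partial>disk_area)
    \<le> ennreal (C * rho w powr (2 + \<alpha> - B * p))"
    using disk_kernel_estimate[OF \<alpha> B] by auto
  show ?thesis
  proof (intro exI[of _ "((1 + \<alpha>) * C) powr (1 / p)"] conjI ballI)
    fix a assume a: "a \<in> unit_disk"
    have ra: "0 < rho a" by (rule rho_pos[OF a])
    have hol: "test_fun N B \<kappa> a holomorphic_on unit_disk"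
      using test_fun_holomorphic(2)[OF a]
      by (intro holomorphic_on_subset[OF test_fun_holomorphic(1)[OF a]] subset_ball) simp
    have "bergman_mass p \<alpha> (test_fun N B \<kappa> a)
        \<le> (\<integral>\<^sup>+z. ennreal (rho a powr (\<kappa> * p)) * ennreal (rho z powr \<alpha> * kern (- (B * p)) z a) \<partial>disk_area)"
      unfolding bergman_mass_def
    proof (rule nn_integral_mono)
      fix z assume "z \<in> space disk_area"
      then have z: "z \<in> unit_disk" by simp
      have "cmod (test_fun N B \<kappa> a z) \<le> 1 * (rho a powr \<kappa> * kern (- B) z a)"
        unfolding cmod_test_fun using z by (intro mult_right_mono power_le_one) auto
      then have "cmod (test_fun N B \<kappa> a z) powr p \<le> (rho a powr \<kappa> * kern (- B) z a) powr p"
        using p by (intro powr_mono2) auto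
      also have "\<dots> = rho a powr (\<kappa> * p) * kern (- (B * p)) z a"
        by (simp add: powr_mult powr_powr)
      finally have "cmod (test_fun N B \<kappa> a z) powr p * rho z powr \<alpha>
          \<le> rho a powr (\<kappa> * p) * kern (- (B * p)) z a * rho z powr \<alpha>"
        by (rule mult_right_mono) simp
      then show "ennreal (cmod (test_fun N B \<kappa> a z) powr p * rho z powr \<alpha>)
          \<le> ennreal (rho a powr (\<kappa> * p)) * ennreal (rho z powr \<alpha> * kern (- (B * p)) z a)"
        by (simp add: ennreal_mult[symmetric] mult_ac ennreal_leI)
    qed
    also have "\<dots> = ennreal (rho a powr (\<kappa> * p)) * (\<integral>\<^sup>+z. ennreal (rho z powr \<alpha> * kern (- (B * p)) z a) \<partial>disk_area)"
      by (intro nn_integral_cmult disk_area_measurableI) measurable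
    also have "\<dots> \<le> ennreal (rho a powr (\<kappa> * p)) * ennreal (C * rho a powr (2 + \<alpha> - B * p))"
      by (intro mult_left_mono C(2) a) simp
    also have "\<dots> = ennreal (C * (rho a powr (\<kappa> * p) * rho a powr (2 + \<alpha> - B * p)))"
      using C(1) by (simp add: ennreal_mult[symmetric] mult_ac)
    also have "rho a powr (\<kappa> * p) * rho a powr (2 + \<alpha> - B * p) = 1"
    proof -
      have "\<kappa> * p + (2 + \<alpha> - B * p) = 0" using p by (simp add: \<kappa> field_simps)
      then show ?thesis using ra unfolding powr_add[symmetric] by simp
    qed
    finally have le: "bergman_mass p \<alpha> (test_fun N B \<kappa> a) \<le> ennreal C" by simp
    from bergman_norm_le[OF hol p \<alpha> C(1) le]
    show "test_fun N B \<kappa> a \<in> bergman_space p \<alpha>"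
      "bergman_norm p \<alpha> (test_fun N B \<kappa> a) \<le> ((1 + \<alpha>) * C) powr (1 / p)" .
  qed simp
qed

lemma compact_subset_unit_disk:
  assumes "compact K" "K \<subseteq> (unit_disk :: complex set)"
  shows "\<exists>R<1. 0 \<le> R \<and> K \<subseteq> cball 0 R"
proof (cases "K = {}")
  case True
  then show ?thesis by (intro exI[of _ 0]) auto
next
  case False
  then obtain x where "x \<in> K" "\<And>y. y \<in> K \<Longrightarrow> cmod y \<le> cmod x"
    using continuous_attains_sup[OF assms(1), of cmod] by (auto intro: continuous_intros)
  then show ?thesis using assms(2) by (intro exI[of _ "cmod x"]) auto
qed

text \<open>On a compact subset of the disk the kernel powers stay bounded while the normalization
  tends to 0.\<close>

lemma test_fun_null:
  assumes a: "\<And>n. a n \<in> unit_disk" "(\<lambda>n. rho (a n)) \<longlonglongrightarrow> 0" and \<kappa>: "0 < \<kappa>" and B: "0 < B"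
  shows "locally_uniformly_null (\<lambda>n. test_fun N B \<kappa> (a n))"
  unfolding locally_uniformly_null_def
proof (intro allI impI)
  fix K :: "complex set" assume "compact K \<and> K \<subseteq> unit_disk"
  then obtain R where R: "R < 1" "0 \<le> R" "K \<subseteq> cball 0 R" using compact_subset_unit_disk by blast
  have lim: "(\<lambda>n. rho (a n) powr \<kappa> * (1 - R) powr (- B)) \<longlonglongrightarrow> 0"
  proof -
    have "(\<lambda>n. rho (a n) powr \<kappa>) \<longlonglongrightarrow> 0 powr \<kappa>"
      using \<kappa> rho_pos[OF a(1)] by (intro tendsto_powr' a(2) tendsto_const) (auto intro!: always_eventually less_imp_le)
    then show ?thesis using \<kappa> by (auto intro: tendsto_mult_left_zero)
  qed
  show "uniform_limit K (\<lambda>n. test_fun N B \<kappa> (a n)) (\<lambda>_. 0) sequentially"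
  proof (rule uniform_limitI)
    fix \<epsilon> :: real assume "0 < \<epsilon>"
    from order_tendstoD(2)[OF lim this]
    show "\<forall>\<^sub>F n in sequentially. \<forall>x\<in>K. dist (test_fun N B \<kappa> (a n) x) 0 < \<epsilon>"
    proof (rule eventually_mono, intro ballI)
      fix n x assume elim: "rho (a n) powr \<kappa> * (1 - R) powr (- B) < \<epsilon>" and "x \<in> K"
      have x: "cmod x \<le> R" "x \<in> unit_disk" using \<open>x \<in> K\<close> R by auto
      have "kern (- B) x (a n) \<le> (1 - R) powr (- B)"
        using kernel_lower_bound(1)[OF x(2) a(1)[of n]] x R B by (intro powr_mono2') auto
      then have "cmod (test_fun N B \<kappa> (a n) x) \<le> 1 * (rho (a n) powr \<kappa> * (1 - R) powr (- B))"
        unfolding cmod_test_fun using x by (intro mult_mono mult_left_mono power_le_one) auto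
      then show "dist (test_fun N B \<kappa> (a n) x) 0 < \<epsilon>" using elim by simp
    qed
  qed
qed

section \<open>The kernel condition and vanishing Carleson measures\<close>

lemma vanishing_carleson_imp_kernel_vanishing:
  assumes \<alpha>: "-1 < \<alpha>" and s: "0 < s" and \<mu>: "finite_borel_measure_on_disk \<mu>"
    and v: "vanishing_carleson \<mu> s 1 \<alpha>"
  shows "kernel_vanishing \<mu> ((3 + \<alpha>) * s) ((2 + \<alpha>) * s)"
proof (rule ccontr)
  assume "\<not> ?thesis"
  then obtain e a where e: "0 < e" and a: "\<And>n. a n \<in> unit_disk" "(\<lambda>n. rho (a n)) \<longlonglongrightarrow> 0"
    and gt: "\<And>n. ennreal (e * rho (a n) powr ((2 + \<alpha>) * s - (3 + \<alpha>) * s))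
      < (\<integral>\<^sup>+w. ennreal (kern (- ((3 + \<alpha>) * s)) w (a n)) \<partial>\<mu>)"
    using ex_sequence_not_kernel_vanishing[of \<mu> "(3 + \<alpha>) * s" "(2 + \<alpha>) * s"] by blast
  \<comment> \<open>For \<open>p = 1\<close> the exponent \<open>3 + \<alpha>\<close> goes with the
    normalization \<open>rho (a n)\<close>. The \<open>s\<close>-th power of the modulus is
    \<open>rho (a n) powr s\<close> times the kernel with exponent
    \<open>(3 + \<alpha>) * s\<close>, and the first factor cancels the power in the negated
    condition.\<close>
  define f where "f n = test_fun 0 (3 + \<alpha>) 1 (a n)" for n
  obtain M where M: "\<And>a. a\<in>unit_disk \<Longrightarrow> test_fun 0 (3 + \<alpha>) 1 a \<in> bergman_space 1 \<alpha> \<and> bergman_norm 1 \<alpha> (test_fun 0 (3 + \<alpha>) 1 a) \<le> M"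
  proof -
    have "\<exists>M\<ge>0. \<forall>a\<in>unit_disk. test_fun 0 (3 + \<alpha>) 1 a \<in> bergman_space 1 \<alpha> \<and> bergman_norm 1 \<alpha> (test_fun 0 (3 + \<alpha>) 1 a) \<le> M"
      by (rule test_fun_bounded[OF _ \<alpha>]) simp_all
    then show ?thesis using that by blast
  qed
  have "bergman_bounded_seq 1 \<alpha> f"
    unfolding bergman_bounded_seq_def f_def using M a(1) by blast
  moreover have "locally_uniformly_null f"
    unfolding f_def using \<alpha> by (intro test_fun_null a) auto
  ultimately have "(\<lambda>n. \<integral>\<^sup>+w. ennreal (cmod (f n w) powr s) \<partial>\<mu>) \<longlonglongrightarrow> 0"
    using v unfolding vanishing_carleson_def by blast
  then have "\<forall>\<^sub>F n in sequentially. (\<integral>\<^sup>+w. ennreal (cmod (f n w) powr s) \<partial>\<mu>) < ennreal e"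
    using e by (intro order_tendstoD(2)) auto
  then obtain n where n: "(\<integral>\<^sup>+w. ennreal (cmod (f n w) powr s) \<partial>\<mu>) < ennreal e"
    by (auto simp: eventually_sequentially)
  have ra: "0 < rho (a n)" by (rule rho_pos[OF a(1)])
  have id\<mu>: "(\<lambda>w. w) \<in> borel_measurable \<mu>" using \<mu> by (rule disk_measure_measurable) simp
  have "(\<integral>\<^sup>+w. ennreal (cmod (f n w) powr s) \<partial>\<mu>)
      = (\<integral>\<^sup>+w. ennreal (rho (a n) powr s) * ennreal (kern (- ((3 + \<alpha>) * s)) w (a n)) \<partial>\<mu>)"
  proof (rule nn_integral_cong)
    fix w
    have "cmod (f n w) powr s = rho (a n) powr s * kern (- ((3 + \<alpha>) * s)) w (a n)"
      unfolding f_def cmod_test_fun using ra by (simp add: powr_mult powr_powr algebra_simps)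
    then show "ennreal (cmod (f n w) powr s)
        = ennreal (rho (a n) powr s) * ennreal (kern (- ((3 + \<alpha>) * s)) w (a n))"
      by (simp add: ennreal_mult)
  qed
  also have "\<dots> = ennreal (rho (a n) powr s) * (\<integral>\<^sup>+w. ennreal (kern (- ((3 + \<alpha>) * s)) w (a n)) \<partial>\<mu>)"
    by (intro nn_integral_cmult measurable_kernel_comp id\<mu>) simp
  finally have eq: "(\<integral>\<^sup>+w. ennreal (cmod (f n w) powr s) \<partial>\<mu>)
      = ennreal (rho (a n) powr s) * (\<integral>\<^sup>+w. ennreal (kern (- ((3 + \<alpha>) * s)) w (a n)) \<partial>\<mu>)" .
  have "rho (a n) powr s * rho (a n) powr ((2 + \<alpha>) * s - (3 + \<alpha>) * s) = 1"
    using ra unfolding powr_add[symmetric] by (simp add: algebra_simps)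
  then have "ennreal e = ennreal (rho (a n) powr s * (e * rho (a n) powr ((2 + \<alpha>) * s - (3 + \<alpha>) * s)))"
    by (simp add: mult.left_commute)
  also have "\<dots> = ennreal (rho (a n) powr s) * ennreal (e * rho (a n) powr ((2 + \<alpha>) * s - (3 + \<alpha>) * s))"
    using e by (intro ennreal_mult) auto
  also have "\<dots> \<le> (\<integral>\<^sup>+w. ennreal (cmod (f n w) powr s) \<partial>\<mu>)"
    unfolding eq by (intro mult_left_mono less_imp_le[OF gt]) simp
  finally show False using n by simp
qed

text \<open>The embedding with \<open>p = 1\<close> and \<open>\<sigma> = 0\<close>; the condition
  \<open>p \<le> s\<close> in it becomes \<open>1 \<le> s\<close>.\<close>

lemma kernel_vanishing_imp_vanishing_carleson:
  assumes \<alpha>: "-1 < \<alpha>" and s: "1 \<le> s" and c: "0 < c" and \<mu>: "finite_borel_measure_on_disk \<mu>"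
    and v: "kernel_vanishing \<mu> c ((2 + \<alpha>) * s)"
  shows "vanishing_carleson \<mu> s 1 \<alpha>"
  unfolding vanishing_carleson_def
proof (intro allI impI)
  fix f assume "bergman_bounded_seq 1 \<alpha> f \<and> locally_uniformly_null f"
  then have f: "bergman_bounded_seq 1 \<alpha> f" "locally_uniformly_null f" by auto
  have "(\<lambda>n. \<integral>\<^sup>+w. ennreal (cmod (f n w) powr s * rho w powr (- 0)) \<partial>\<mu>) \<longlonglongrightarrow> 0"
    by (rule kernel_vanishing_embedding[OF _ s \<alpha> c order_refl _ \<mu> v f]) simp_all
  moreover have "(\<integral>\<^sup>+w. ennreal (cmod (f n w) powr s * rho w powr (- 0)) \<partial>\<mu>) = (\<integral>\<^sup>+w. ennreal (cmod (f n w) powr s) \<partial>\<mu>)" for n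
  proof (rule nn_integral_cong)
    fix w assume "w \<in> space \<mu>"
    then have "rho w \<noteq> 0" using rho_pos[of w] by (auto simp: space_disk_measure[OF \<mu>])
    then show "ennreal (cmod (f n w) powr s * rho w powr (- 0)) = ennreal (cmod (f n w) powr s)" by simp
  qed
  ultimately show "(\<lambda>n. \<integral>\<^sup>+w. ennreal (cmod (f n w) powr s) \<partial>\<mu>) \<longlonglongrightarrow> 0" by simp
qed

text \<open>For fixed \<open>z\<close> the kernel is bounded in \<open>w\<close>, so convergence in
  \<open>L^1\<close> of \<open>\<mu>\<close> implies pointwise convergence of the images.\<close>

lemma cmod_toeplitz_le_L1:
  assumes \<mu>: "finite_borel_measure_on_disk \<mu>" and f: "f \<in> borel_measurable \<mu>" and z: "z \<in> unit_disk" and \<beta>: "-2 < \<beta>"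
  shows "ennreal (cmod (toeplitz \<mu> \<beta> f z)) \<le> ennreal ((1 - cmod z) powr (- (2 + \<beta>))) * (\<integral>\<^sup>+w. ennreal (cmod (f w)) \<partial>\<mu>)"
proof -
  have "ennreal (cmod (toeplitz \<mu> \<beta> f z)) \<le> (\<integral>\<^sup>+w. ennreal (cmod (f w) * kern (- (2 + \<beta>)) z w) \<partial>\<mu>)"
    by (rule cmod_toeplitz_le)
  also have "\<dots> \<le> (\<integral>\<^sup>+w. ennreal ((1 - cmod z) powr (- (2 + \<beta>))) * ennreal (cmod (f w)) \<partial>\<mu>)"
  proof (rule nn_integral_mono)
    fix w assume "w \<in> space \<mu>"
    then have w: "w \<in> unit_disk" by (simp add: space_disk_measure[OF \<mu>])
    have "kern (- (2 + \<beta>)) z w \<le> (1 - cmod z) powr (- (2 + \<beta>))"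
      using kernel_lower_bound(1)[OF z w] z \<beta> by (intro powr_mono2') auto
    then have "cmod (f w) * kern (- (2 + \<beta>)) z w \<le> cmod (f w) * (1 - cmod z) powr (- (2 + \<beta>))"
      by (rule mult_left_mono) simp
    then show "ennreal (cmod (f w) * kern (- (2 + \<beta>)) z w)
        \<le> ennreal ((1 - cmod z) powr (- (2 + \<beta>))) * ennreal (cmod (f w))"
      by (simp add: ennreal_mult[symmetric] mult.commute ennreal_leI)
  qed
  also have "\<dots> = ennreal ((1 - cmod z) powr (- (2 + \<beta>))) * (\<integral>\<^sup>+w. ennreal (cmod (f w)) \<partial>\<mu>)"
    using f by (intro nn_integral_cmult) measurable
  finally show ?thesis .
qed

section \<open>Necessity\<close>

text \<open>Such a function is a uniform limit of polynomials on the closed disk. Their images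
  converge pointwise to the Toeplitz integral because \<open>\<mu>\<close> is finite, and
  boundedness makes them a Cauchy sequence in norm; hence the integral is also the limit in norm and
  agrees with the extension. The constant \<open>D\<close> collects those of the two triangle
  inequalities.\<close>

lemma toeplitz_bounded_extension:
  assumes p: "0 < p" and q: "0 < q" and \<alpha>: "-1 < \<alpha>" and \<beta>: "-1 < \<beta>"
    and \<mu>: "finite_borel_measure_on_disk \<mu>" and b: "toeplitz_bounded \<mu> p \<alpha> q \<beta>"
  shows "\<exists>D\<ge>0. \<forall>R f. 1 < R \<longrightarrow> f holomorphic_on ball 0 R \<longrightarrow> integrable \<mu> f \<and>
    toeplitz \<mu> \<beta> f \<in> bergman_space q \<beta> \<and> bergman_norm q \<beta> (toeplitz \<mu> \<beta> f) \<le> D * bergman_norm p \<alpha> f \<and>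
    toeplitz_ext \<mu> p \<alpha> q \<beta> f \<in> bergman_space q \<beta> \<and>
    (AE z in disk_area. toeplitz_ext \<mu> p \<alpha> q \<beta> f z = toeplitz \<mu> \<beta> f z)"
proof -
  let ?Np = "bergman_norm p \<alpha>"
  let ?Nq = "bergman_norm q \<beta>"
  let ?Sp = "bergman_space p \<alpha>"
  let ?Sq = "bergman_space q \<beta>"
  let ?Text = "toeplitz_ext \<mu> p \<alpha> q \<beta>"
  let ?T = "toeplitz \<mu> \<beta>"
  interpret finite_measure \<mu> using \<mu> by (simp add: finite_borel_measure_on_disk_def)
  obtain C' where C': "\<And>P. ?T (poly P) \<in> ?Sq"
    "\<And>P. ?Nq (?T (poly P)) \<le> C' * ?Np (poly P)"
    using b unfolding toeplitz_bounded_def by blast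
  \<comment> \<open>The constant of the definition may be negative; monotonicity in the norm
    requires a nonnegative one.\<close>
  define C where "C = max C' 0"
  have C0: "0 \<le> C" by (simp add: C_def)
  have C: "?Nq (?T (poly P)) \<le> C * ?Np (poly P)" for P
    by (rule order_trans[OF C'(2)]) (simp add: C_def mult_right_mono bergman_norm_nonneg)
  define Kp where "Kp = 2 * 2 powr (1 / p)"
  define Kq where "Kq = 2 * 2 powr (1 / q)"
  have Kpq: "0 \<le> Kp" "0 \<le> Kq" by (simp_all add: Kp_def Kq_def)
  have tri_p: "?Np (\<lambda>z. f z - g z) \<le> Kp * (?Np f + ?Np g)"
    if "f \<in> ?Sp" "g \<in> ?Sp" for f g
    unfolding Kp_def by (rule bergman_diff(2)[OF that p \<alpha>])
  have tri_q: "?Nq (\<lambda>z. f z - g z) \<le> Kq * (?Nq f + ?Nq g)"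
    if "f \<in> ?Sq" "g \<in> ?Sq" for f g
    unfolding Kq_def by (rule bergman_diff(2)[OF that q \<beta>])
  note poly_p = poly_in_bergman_space[OF p \<alpha>]
  have bounded_int: "integrable \<mu> f" if "f holomorphic_on unit_disk" "\<And>z. z \<in> unit_disk \<Longrightarrow> cmod (f z) \<le> c" for f c
    using that disk_measure_measurable_holomorphic[OF \<mu> that(1)]
    by (intro integrable_const_bound[where B=c]) (auto intro!: AE_I2 simp: space_disk_measure[OF \<mu>])
  have poly_int: "integrable \<mu> (poly P)" for P
  proof -
    have "compact (poly P ` cball 0 1)"
      by (intro compact_continuous_image continuous_intros compact_cball)
    then obtain c where "\<And>z. z \<in> cball 0 1 \<Longrightarrow> cmod (poly P z) \<le> c"
      using compact_imp_bounded bounded_iff by (metis image_eqI)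
    then show ?thesis by (intro bounded_int[of _ c] holomorphic_intros) auto
  qed
  have Tdiff: "?Nq (\<lambda>z. ?T (poly P) z - ?T (poly Q) z)
      \<le> C * ?Np (\<lambda>z. poly P z - poly Q z)" for P Q
  proof -
    have "?Nq (\<lambda>z. ?T (poly P) z - ?T (poly Q) z)
        = ?Nq (?T (poly (P - Q)))"
      using toeplitz_diff[OF \<mu> poly_int[of P] poly_int[of Q]]
      by (intro bergman_norm_cong_AE \<beta> borel_measurable_diff measurable_disk_area_holomorphic
          bergman_spaceD[OF C'(1)] AE_I2) (auto simp: poly_diff[abs_def])
    also have "\<dots> \<le> C * ?Np (poly (P - Q))" by (rule C)
    finally show ?thesis by (simp add: poly_diff[abs_def])
  qed
  define D where "D = Kq * C * Kp"
  have D: "0 \<le> D" using Kpq C0 by (simp add: D_def)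
  show ?thesis
  proof (intro exI[of _ D] conjI[OF D] allI impI)
    fix R :: real and f assume R: "1 < R" and f: "f holomorphic_on ball 0 R"
    have fd: "f holomorphic_on unit_disk" using R by (intro holomorphic_on_subset[OF f] subset_ball) simp
    have "compact (f ` cball 0 1)"
      using R by (intro compact_continuous_image compact_cball holomorphic_on_imp_continuous_on holomorphic_on_subset[OF f]) auto
    then obtain c where c: "\<And>z. z \<in> cball 0 1 \<Longrightarrow> cmod (f z) \<le> c"
      using compact_imp_bounded bounded_iff by (metis image_eqI)
    have fint: "integrable \<mu> f" using c by (intro bounded_int[OF fd, of c]) auto
    obtain C1 where C1: "C1 > 0" "\<And>f b. (\<And>z. z \<in> unit_disk \<Longrightarrow> cmod (f z) \<le> b) \<Longrightarrow> bergman_mass p \<alpha> f \<le> ennreal (C1 * b powr p)"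
      using bergman_mass_bounded_function[OF \<alpha> p] by blast
    have "bergman_mass p \<alpha> f \<le> ennreal (C1 * c powr p)"
      using c by (intro C1(2)) auto
    then have fs: "f \<in> ?Sp"
      using C1(1) by (intro bergman_norm_le(1)[OF fd p \<alpha>, of "C1 * c powr p"]) auto
    obtain P :: "nat \<Rightarrow> complex poly" where P: "uniform_limit (cball 0 1) (\<lambda>n z. poly (P n) z) f sequentially"
      using holomorphic_ball_uniform_polynomials[OF f, of 1] R by auto
    define d where "d n = ?Np (\<lambda>z. poly (P n) z - f z)" for n
    have dlim: "d \<longlonglongrightarrow> 0"
    proof (rule tendstoI)
      fix \<epsilon> :: real assume \<epsilon>: "0 < \<epsilon>"
      define \<eta> where "\<eta> = \<epsilon> / (2 * ((1 + \<alpha>) * C1) powr (1 / p))"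
      have k: "0 < ((1 + \<alpha>) * C1) powr (1 / p)" using \<alpha> C1(1) by simp
      have \<eta>: "0 < \<eta>" using \<epsilon> k by (simp add: \<eta>_def)
      from uniform_limitD[OF P \<eta>] show "\<forall>\<^sub>F n in sequentially. dist (d n) 0 < \<epsilon>"
      proof eventually_elim
        case (elim n)
        have "bergman_mass p \<alpha> (\<lambda>z. poly (P n) z - f z) \<le> ennreal (C1 * \<eta> powr p)"
          using elim by (intro C1(2)) (auto simp: dist_norm less_imp_le)
        then have "d n \<le> ((1 + \<alpha>) * (C1 * \<eta> powr p)) powr (1 / p)"
          unfolding d_def using C1(1)
          by (intro bergman_norm_le(2) p \<alpha> holomorphic_intros fd) auto
        also have "\<dots> = ((1 + \<alpha>) * C1) powr (1 / p) * (\<eta> powr p) powr (1 / p)"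
          unfolding mult.assoc[symmetric] by (rule powr_mult)
        also have "\<dots> = \<epsilon> / 2" using \<eta> p k by (simp add: powr_powr) (simp add: \<eta>_def)
        also have "\<dots> < \<epsilon>" using \<epsilon> by simp
        finally show ?case by (simp add: d_def bergman_norm_nonneg)
      qed
    qed
    have ptw: "(\<lambda>n. ?T (poly (P n)) z) \<longlonglongrightarrow> ?T f z" if z: "z \<in> unit_disk" for z
    proof (rule tendstoI)
      fix \<epsilon> :: real assume \<epsilon>: "0 < \<epsilon>"
      define k where "k = (1 - cmod z) powr (- (2 + \<beta>)) * (measure \<mu> (space \<mu>) + 1)"
      have k: "0 < k" using z by (simp add: k_def add_nonneg_pos)
      define \<eta> where "\<eta> = \<epsilon> / (2 * k)"
      have \<eta>: "0 < \<eta>" using \<epsilon> k by (simp add: \<eta>_def)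
      from uniform_limitD[OF P \<eta>] show "\<forall>\<^sub>F n in sequentially. dist (?T (poly (P n)) z) (?T f z) < \<epsilon>"
      proof eventually_elim
        case (elim n)
        have m: "(\<lambda>w. poly (P n) w - f w) \<in> borel_measurable \<mu>"
          by (intro disk_measure_measurable_holomorphic \<mu> holomorphic_intros fd)
        have \<beta>2: "-2 < \<beta>" using \<beta> by simp
        have "ennreal (cmod (?T (\<lambda>w. poly (P n) w - f w) z))
            \<le> ennreal ((1 - cmod z) powr (- (2 + \<beta>))) * (\<integral>\<^sup>+w. ennreal (cmod (poly (P n) w - f w)) \<partial>\<mu>)"
          by (rule cmod_toeplitz_le_L1[OF \<mu> m z \<beta>2])
        also have "\<dots> \<le> ennreal ((1 - cmod z) powr (- (2 + \<beta>))) * (\<integral>\<^sup>+w. ennreal \<eta> \<partial>\<mu>)"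
          using elim by (intro mult_left_mono nn_integral_mono ennreal_leI)
            (auto simp: space_disk_measure[OF \<mu>] dist_norm less_imp_le)
        also have "\<dots> = ennreal ((1 - cmod z) powr (- (2 + \<beta>)) * (\<eta> * measure \<mu> (space \<mu>)))"
          using \<eta> by (simp add: emeasure_eq_measure ennreal_mult)
        finally have "cmod (?T (\<lambda>w. poly (P n) w - f w) z)
            \<le> (1 - cmod z) powr (- (2 + \<beta>)) * (\<eta> * measure \<mu> (space \<mu>))"
          using \<eta> by simp
        also have "\<dots> \<le> (1 - cmod z) powr (- (2 + \<beta>)) * (\<eta> * (measure \<mu> (space \<mu>) + 1))"
          using \<eta> by (intro mult_left_mono) auto
        also have "\<dots> = k * \<eta>" by (simp add: k_def mult_ac)
        also have "\<dots> = \<epsilon> / 2" using k by (simp add: \<eta>_def)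
        finally show ?case
          using \<epsilon> toeplitz_diff[OF \<mu> poly_int[of "P n"] fint z, of \<beta>] by (simp add: dist_norm)
      qed
    qed
    have Thol: "?T f holomorphic_on unit_disk"
      using \<beta> by (intro toeplitz_holomorphic \<mu> fint) simp
    \<comment> \<open>Two late images differ by little in norm. Letting the second index tend to
      infinity, Fatou's lemma passes the bound to the pointwise limit \<open>?T f\<close>.\<close>
    have Cauchy: "\<exists>N. \<forall>n\<ge>N. (\<lambda>z. ?T (poly (P n)) z - ?T f z) \<in> ?Sq \<and>
        ?Nq (\<lambda>z. ?T (poly (P n)) z - ?T f z) \<le> \<epsilon>" if \<epsilon>: "0 < \<epsilon>" for \<epsilon>
    proof -
      define k where "k = C * Kp + 1"
      define \<eta> where "\<eta> = \<epsilon> / (2 * k)"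
      have k: "0 < k" using C0 Kpq by (simp add: k_def add_nonneg_pos)
      then have \<eta>: "0 < \<eta>" using \<epsilon> by (simp add: \<eta>_def)
      have "k * (2 * \<eta>) = \<epsilon>" using k by (simp add: \<eta>_def)
      then have \<eta>le: "C * Kp * (2 * \<eta>) \<le> \<epsilon>" using \<eta> by (simp add: k_def distrib_right)
      obtain N where N: "\<And>n. n \<ge> N \<Longrightarrow> d n < \<eta>"
        using order_tendstoD(2)[OF dlim \<eta>] by (auto simp: eventually_sequentially)
      define m where "m = \<epsilon> powr q / (1 + \<beta>)"
      have m0: "0 \<le> m" using \<beta> by (simp add: m_def)
      have pair: "bergman_mass q \<beta> (\<lambda>z. ?T (poly (P n)) z - ?T (poly (P k)) z) \<le> ennreal m"
        if "n \<ge> N" "k \<ge> N" for n k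
      proof -
        have "?Np (\<lambda>z. poly (P n) z - poly (P k) z) \<le> Kp * (d n + d k)"
          using tri_p[OF bergman_diff(1)[OF poly_p[of "P n"] fs p \<alpha>] bergman_diff(1)[OF poly_p[of "P k"] fs p \<alpha>]]
          by (simp add: d_def)
        also have "\<dots> \<le> Kp * (2 * \<eta>)" using N[OF that(1)] N[OF that(2)] Kpq by (intro mult_left_mono) auto
        finally have "C * ?Np (\<lambda>z. poly (P n) z - poly (P k) z) \<le> C * (Kp * (2 * \<eta>))"
          using C0 by (rule mult_left_mono)
        then have "?Nq (\<lambda>z. ?T (poly (P n)) z - ?T (poly (P k)) z) \<le> \<epsilon>"
          using Tdiff[of "P n" "P k"] \<eta>le by simp
        then show ?thesis
          unfolding bergman_mass_eq_norm[OF bergman_diff(1)[OF C'(1) C'(1) q \<beta>] q \<beta>] m_def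
          using q \<beta> bergman_norm_nonneg by (intro ennreal_leI divide_right_mono powr_mono2) auto
      qed
      show ?thesis
      proof (intro exI[of _ N] allI impI)
        fix n assume n: "n \<ge> N"
        have "bergman_mass q \<beta> (\<lambda>z. ?T (poly (P n)) z - ?T f z)
            = (\<integral>\<^sup>+z. liminf (\<lambda>k. ennreal (cmod (?T (poly (P n)) z - ?T (poly (P k)) z) powr q * rho z powr \<beta>)) \<partial>disk_area)"
          unfolding bergman_mass_def
        proof (rule nn_integral_cong)
          fix z assume "z \<in> space disk_area"
          then have z: "z \<in> unit_disk" by simp
          have "(\<lambda>k. ennreal (cmod (?T (poly (P n)) z - ?T (poly (P k)) z) powr q * rho z powr \<beta>))
            \<longlonglongrightarrow> ennreal (cmod (?T (poly (P n)) z - ?T f z) powr q * rho z powr \<beta>)"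
            using q by (intro tendsto_ennrealI tendsto_mult tendsto_const tendsto_powr' tendsto_norm tendsto_diff ptw z) auto
          then show "ennreal (cmod (?T (poly (P n)) z - ?T f z) powr q * rho z powr \<beta>)
            = liminf (\<lambda>k. ennreal (cmod (?T (poly (P n)) z - ?T (poly (P k)) z) powr q * rho z powr \<beta>))"
            by (intro lim_imp_Liminf[symmetric]) auto
        qed
        also have "\<dots> \<le> liminf (\<lambda>k. bergman_mass q \<beta> (\<lambda>z. ?T (poly (P n)) z - ?T (poly (P k)) z))"
          unfolding bergman_mass_def
          by (intro nn_integral_liminf measurable_mass_integrand measurable_disk_area_holomorphic
              holomorphic_intros bergman_spaceD[OF C'(1)])
        also have "\<dots> \<le> ennreal m"
          using pair[OF n] by (intro Liminf_le) (auto simp: eventually_sequentially)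
        finally have le: "bergman_mass q \<beta> (\<lambda>z. ?T (poly (P n)) z - ?T f z) \<le> ennreal m" .
        have hol: "(\<lambda>z. ?T (poly (P n)) z - ?T f z) holomorphic_on unit_disk"
          by (intro holomorphic_intros bergman_spaceD[OF C'(1)] Thol)
        have "((1 + \<beta>) * m) powr (1 / q) = \<epsilon>" using \<beta> q \<epsilon> by (simp add: m_def powr_powr)
        with bergman_norm_le[OF hol q \<beta> m0 le]
        show "(\<lambda>z. ?T (poly (P n)) z - ?T f z) \<in> ?Sq \<and>
          ?Nq (\<lambda>z. ?T (poly (P n)) z - ?T f z) \<le> \<epsilon>" by simp
      qed
    qed
    have Ts: "?T f \<in> ?Sq"
    proof -
      obtain N where "(\<lambda>z. ?T (poly (P N)) z - ?T f z) \<in> ?Sq"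
        using Cauchy[of 1] by auto
      from bergman_diff(1)[OF C'(1)[of "P N"] this q \<beta>] show ?thesis by simp
    qed
    have Tlim: "(\<lambda>n. ?Nq (\<lambda>z. ?T (poly (P n)) z - ?T f z)) \<longlonglongrightarrow> 0"
    proof (rule tendstoI)
      fix \<epsilon> :: real assume \<epsilon>: "0 < \<epsilon>"
      obtain N where N: "\<And>n. n \<ge> N \<Longrightarrow> ?Nq (\<lambda>z. ?T (poly (P n)) z - ?T f z) \<le> \<epsilon> / 2"
        using Cauchy[of "\<epsilon> / 2"] \<epsilon> by auto
      show "\<forall>\<^sub>F n in sequentially. dist (?Nq (\<lambda>z. ?T (poly (P n)) z - ?T f z)) 0 < \<epsilon>"
        unfolding eventually_sequentially
      proof (intro exI[of _ N] allI impI)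
        fix n assume "N \<le> n"
        from N[OF this] \<epsilon> show "dist (?Nq (\<lambda>z. ?T (poly (P n)) z - ?T f z)) 0 < \<epsilon>"
          by (simp add: bergman_norm_nonneg)
      qed
    qed
    \<comment> \<open>The extension is tested against every sequence \<open>Q\<close> of polynomials
      converging to \<open>f\<close>, also non-uniformly. It is compared with the uniformly
      convergent \<open>P\<close>, to which the bound for polynomials applies.\<close>
    have lim: "(\<lambda>n. ?Nq (\<lambda>z. ?T (poly (Q n)) z - ?T f z)) \<longlonglongrightarrow> 0"
      if Q: "(\<lambda>n. ?Np (\<lambda>z. poly (Q n) z - f z)) \<longlonglongrightarrow> 0" for Q :: "nat \<Rightarrow> complex poly"
    proof (rule tendsto_sandwich[of "\<lambda>_. 0" _ _
        "\<lambda>n. Kq * (C * (Kp * (?Np (\<lambda>z. poly (Q n) z - f z) + d n)) + ?Nq (\<lambda>z. ?T f z - ?T (poly (P n)) z))"])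
      have sym: "?Nq (\<lambda>z. ?T f z - ?T (poly (P n)) z)
          = ?Nq (\<lambda>z. ?T (poly (P n)) z - ?T f z)" for n
        unfolding bergman_norm_def by (simp add: norm_minus_commute)
      have "(\<lambda>n. Kq * (C * (Kp * (?Np (\<lambda>z. poly (Q n) z - f z) + d n)) + ?Nq (\<lambda>z. ?T (poly (P n)) z - ?T f z)))
          \<longlonglongrightarrow> Kq * (C * (Kp * (0 + 0)) + 0)"
        by (intro tendsto_intros Q dlim Tlim)
      then show "(\<lambda>n. Kq * (C * (Kp * (?Np (\<lambda>z. poly (Q n) z - f z) + d n)) + ?Nq (\<lambda>z. ?T f z - ?T (poly (P n)) z)))
          \<longlonglongrightarrow> 0" by (simp add: sym)
      show "\<forall>\<^sub>F n in sequentially. ?Nq (\<lambda>z. ?T (poly (Q n)) z - ?T f z)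
        \<le> Kq * (C * (Kp * (?Np (\<lambda>z. poly (Q n) z - f z) + d n)) + ?Nq (\<lambda>z. ?T f z - ?T (poly (P n)) z))"
      proof (intro always_eventually allI)
        fix n
        have "?Nq (\<lambda>z. ?T (poly (Q n)) z - ?T f z)
            \<le> Kq * (?Nq (\<lambda>z. ?T (poly (Q n)) z - ?T (poly (P n)) z)
              + ?Nq (\<lambda>z. ?T f z - ?T (poly (P n)) z))"
          using tri_q[OF bergman_diff(1)[OF C'(1)[of "Q n"] C'(1)[of "P n"] q \<beta>] bergman_diff(1)[OF Ts C'(1)[of "P n"] q \<beta>]]
          by simp
        also have "\<dots> \<le> Kq * (C * (Kp * (?Np (\<lambda>z. poly (Q n) z - f z) + d n))
              + ?Nq (\<lambda>z. ?T f z - ?T (poly (P n)) z))"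
        proof (intro mult_left_mono add_right_mono Kpq)
          have "?Np (\<lambda>z. poly (Q n) z - poly (P n) z) \<le> Kp * (?Np (\<lambda>z. poly (Q n) z - f z) + d n)"
            using tri_p[OF bergman_diff(1)[OF poly_p[of "Q n"] fs p \<alpha>] bergman_diff(1)[OF poly_p[of "P n"] fs p \<alpha>]]
            by (simp add: d_def)
          then show "?Nq (\<lambda>z. ?T (poly (Q n)) z - ?T (poly (P n)) z)
              \<le> C * (Kp * (?Np (\<lambda>z. poly (Q n) z - f z) + d n))"
            using C0 by (intro order_trans[OF Tdiff] mult_left_mono)
        qed
        finally show "?Nq (\<lambda>z. ?T (poly (Q n)) z - ?T f z)
          \<le> Kq * (C * (Kp * (?Np (\<lambda>z. poly (Q n) z - f z) + d n)) + ?Nq (\<lambda>z. ?T f z - ?T (poly (P n)) z))" .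
      qed
    qed (auto simp: bergman_norm_nonneg)
    have Plim: "(\<lambda>n. ?Np (\<lambda>z. poly (P n) z - f z)) \<longlonglongrightarrow> 0" using dlim by (simp add: d_def[abs_def])
    note ext = toeplitz_ext_AE_eq[OF p \<alpha> q \<beta> C'(1) Ts lim Plim]
    have ext': "?Text f \<in> ?Sq"
      "AE z in disk_area. ?Text f z = ?T f z"
      by (rule ext; assumption)+
    have norm_le: "?Nq (?T f) \<le> D * ?Np f"
    proof (rule LIMSEQ_le_const)
      show "(\<lambda>n. Kq * (C * (Kp * (d n + ?Np f)) + ?Nq (\<lambda>z. ?T (poly (P n)) z - ?T f z)))
          \<longlonglongrightarrow> D * ?Np f"
      proof -
        have "(\<lambda>n. Kq * (C * (Kp * (d n + ?Np f)) + ?Nq (\<lambda>z. ?T (poly (P n)) z - ?T f z)))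
            \<longlonglongrightarrow> Kq * (C * (Kp * (0 + ?Np f)) + 0)"
          by (intro tendsto_intros dlim Tlim)
        then show ?thesis by (simp add: D_def mult.assoc)
      qed
      show "\<exists>N. \<forall>n\<ge>N. ?Nq (?T f)
          \<le> Kq * (C * (Kp * (d n + ?Np f)) + ?Nq (\<lambda>z. ?T (poly (P n)) z - ?T f z))"
      proof (intro exI allI impI)
        fix n
        \<comment> \<open>The triangle inequality is available for differences, so
          \<open>poly (P n)\<close> is written as \<open>(poly (P n) - f) - (- f)\<close>.\<close>
        have fneg: "(\<lambda>z. - f z) \<in> ?Sp" "?Np (\<lambda>z. - f z) = ?Np f"
          using fs by (auto simp: bergman_space_def bergman_norm_def intro: holomorphic_intros)
        have "?Np (poly (P n)) \<le> Kp * (d n + ?Np f)"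
          using tri_p[OF bergman_diff(1)[OF poly_p[of "P n"] fs p \<alpha>] fneg(1)] by (simp add: d_def fneg(2))
        then have 1: "?Nq (?T (poly (P n))) \<le> C * (Kp * (d n + ?Np f))"
          using C0 by (intro order_trans[OF C] mult_left_mono)
        have "?Nq (?T f) \<le> Kq * (?Nq (?T (poly (P n)))
            + ?Nq (\<lambda>z. ?T (poly (P n)) z - ?T f z))"
          using tri_q[OF C'(1)[of "P n"] bergman_diff(1)[OF C'(1)[of "P n"] Ts q \<beta>]] by simp
        also have "\<dots> \<le> Kq * (C * (Kp * (d n + ?Np f)) + ?Nq (\<lambda>z. ?T (poly (P n)) z - ?T f z))"
          using Kpq 1 by (intro mult_left_mono add_right_mono)
        finally show "?Nq (?T f)
          \<le> Kq * (C * (Kp * (d n + ?Np f)) + ?Nq (\<lambda>z. ?T (poly (P n)) z - ?T f z))" .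
      qed
    qed
    show "integrable \<mu> f \<and>
      ?T f \<in> ?Sq \<and> ?Nq (?T f) \<le> D * ?Np f \<and>
      ?Text f \<in> ?Sq \<and>
      (AE z in disk_area. ?Text f z = ?T f z)"
      using fint Ts norm_le ext' by blast
  qed
qed

text \<open>After \<open>N\<close> derivatives the Toeplitz kernel has exponent
  \<open>2 + \<beta> + N = B\<close>. At the point \<open>a\<close> it is the complex conjugate of
  the kernel in the test function, so the integrand is nonnegative and nothing is lost by
  cancellation.\<close>

lemma toeplitz_test_fun_deriv:
  assumes \<mu>: "finite_borel_measure_on_disk \<mu>" and a: "a \<in> unit_disk" and \<beta>: "-1 < \<beta>"
    and B: "B = 2 + \<beta> + real N" and int: "integrable \<mu> (test_fun N B \<kappa> a)"
  shows "cmod ((deriv ^^ N) (toeplitz \<mu> \<beta> (test_fun N B \<kappa> a)) a)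
    = pochhammer (2 + \<beta>) N * (rho a powr \<kappa> * (\<integral>w. cmod w ^ (2 * N) * kern (- (2 * B)) w a \<partial>\<mu>))"
proof -
  define Q where "Q = (\<integral>w. cmod w ^ (2 * N) * kern (- (2 * B)) w a \<partial>\<mu>)"
  have "- (2 + (\<beta> + real N)) = - B" by (simp add: B)
  then have "toeplitz \<mu> (\<beta> + real N) (\<lambda>w. cnj w ^ N * test_fun N B \<kappa> a w) a
      = (\<integral>w. (cnj w ^ N * test_fun N B \<kappa> a w) * (1 - a * cnj w) powr complex_of_real (- B) \<partial>\<mu>)"
    by (simp only: toeplitz_eq)
  also have "\<dots> = (\<integral>w. complex_of_real (rho a powr \<kappa> * (cmod w ^ (2 * N) * kern (- (2 * B)) w a)) \<partial>\<mu>)"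
  proof (rule Bochner_Integration.integral_cong[OF refl])
    fix w assume "w \<in> space \<mu>"
    then have w: "w \<in> unit_disk" by (simp add: space_disk_measure[OF \<mu>])
    define X where "X = (1 - w * cnj a) powr complex_of_real (- B)"
    have "(1 - a * cnj w) = cnj (1 - w * cnj a)" by simp
    then have "(1 - a * cnj w) powr complex_of_real (- B) = cnj X"
      unfolding X_def using cnj_powr[of "1 - w * cnj a" "complex_of_real (- B)"] kernel_lower_bound(4)[OF w a]
      by (simp only: complex_cnj_complex_of_real less_imp_le)
    moreover have "X * cnj X = of_real (kern (- (2 * B)) w a)"
    proof -
      have "X * cnj X = of_real ((cmod X)\<^sup>2)" by (simp only: complex_norm_square)
      also have "(cmod X)\<^sup>2 = kern (- (2 * B)) w a"
        unfolding X_def cmod_powr_of_real by (simp only: power2_eq_square powr_add[symmetric]) simp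
      finally show ?thesis .
    qed
    moreover have "cnj w ^ N * w ^ N = of_real (cmod w ^ (2 * N))"
    proof -
      have "complex_of_real (cmod w ^ (2 * N)) = (complex_of_real ((cmod w)\<^sup>2)) ^ N"
        by (simp add: power_mult)
      then show ?thesis
        unfolding complex_norm_square by (simp only: power_mult_distrib mult.commute)
    qed
    moreover have "(cnj w ^ N * test_fun N B \<kappa> a w) * cnj X = (cnj w ^ N * w ^ N) * of_real (rho a powr \<kappa>) * (X * cnj X)"
      unfolding test_fun_def X_def by (simp only: mult_ac)
    ultimately show "(cnj w ^ N * test_fun N B \<kappa> a w) * (1 - a * cnj w) powr complex_of_real (- B)
        = complex_of_real (rho a powr \<kappa> * (cmod w ^ (2 * N) * kern (- (2 * B)) w a))"
      by (simp only: of_real_mult mult_ac)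
  qed
  also have "\<dots> = complex_of_real (rho a powr \<kappa> * Q)"
    unfolding Q_def by (simp only: integral_complex_of_real integral_mult_right_zero)
  finally have "(deriv ^^ N) (toeplitz \<mu> \<beta> (test_fun N B \<kappa> a)) a
      = complex_of_real (pochhammer (2 + \<beta>) N * (rho a powr \<kappa> * Q))"
    using higher_deriv_toeplitz[OF \<mu> int _ a, of \<beta> N] \<beta> by simp
  moreover have "0 \<le> Q" unfolding Q_def by (intro Bochner_Integration.integral_nonneg) auto
  ultimately show ?thesis
    using \<beta> pochhammer_pos[of "2 + \<beta>" N] by (simp add: Q_def norm_mult abs_mult del: of_real_mult)
qed

text \<open>The derivative of order \<open>N\<close> is used because the kernel exponent \<open>2 + \<beta>\<close> itself may be too
  small for the test functions to be bounded in the Bergman space.\<close>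

lemma kernel_integral_le_toeplitz_norm:
  assumes q: "1 < q" and \<beta>: "-1 < \<beta>" and \<mu>: "finite_borel_measure_on_disk \<mu>"
    and B: "B = 2 + \<beta> + real N"
    and A: "A = B - \<kappa> + (2 + \<beta>) * (1 - 1 / q)"
  shows "\<exists>C>0. \<forall>a\<in>unit_disk. integrable \<mu> (test_fun N B \<kappa> a) \<longrightarrow>
    toeplitz \<mu> \<beta> (test_fun N B \<kappa> a) \<in> bergman_space q \<beta> \<longrightarrow>
    (\<integral>\<^sup>+w. ennreal (kern (- (2 * B)) w a) \<partial>\<mu>)
    \<le> ennreal (C * rho a powr (A - 2 * B) * bergman_norm q \<beta> (toeplitz \<mu> \<beta> (test_fun N B \<kappa> a)) + C)"
proof -
  interpret finite_measure \<mu> using \<mu> by (simp add: finite_borel_measure_on_disk_def)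
  define \<gamma> where "\<gamma> = 2 + \<beta>"
  have \<gamma>: "1 < \<gamma>" using \<beta> by (simp add: \<gamma>_def)
  have B1: "1 < B" using \<beta> by (simp add: B)
  obtain C1 where C1: "C1 > 0" "\<And>f w. f \<in> bergman_space q \<beta> \<Longrightarrow> w \<in> unit_disk \<Longrightarrow>
    cmod (f w) \<le> C1 * rho w powr (- ((2 + \<beta>) / q)) * bergman_norm q \<beta> f"
    using bergman_pointwise_norm[of q \<beta>] q \<beta> by auto
  define P where "P = pochhammer \<gamma> N"
  have P: "0 < P" unfolding P_def using \<gamma> by (intro pochhammer_pos) simp
  define E where "E = fact N * 4 ^ N * C1 * 4 powr (\<gamma> / q)"
  have E: "0 < E" using C1 by (simp add: E_def)
  define C where "C = 4 ^ N * (E / P) + 2 powr (2 * B) * measure \<mu> (space \<mu>)"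
  have EP: "0 < 4 ^ N * (E / P)" using E P by simp
  show ?thesis
  proof (intro exI[of _ C] conjI ballI impI)
    show "0 < C" unfolding C_def using EP by (intro add_pos_nonneg) auto
    fix a assume a: "a \<in> unit_disk" and int: "integrable \<mu> (test_fun N B \<kappa> a)"
      and Ts: "toeplitz \<mu> \<beta> (test_fun N B \<kappa> a) \<in> bergman_space q \<beta>"
    define F where "F = toeplitz \<mu> \<beta> (test_fun N B \<kappa> a)"
    define n where "n = bergman_norm q \<beta> F"
    have n0: "0 \<le> n" by (simp add: n_def bergman_norm_nonneg)
    have ra: "0 < rho a" by (rule rho_pos[OF a])
    define Q where "Q = (\<integral>w. cmod w ^ (2 * N) * kern (- (2 * B)) w a \<partial>\<mu>)"
    \<comment> \<open>On the disk of this radius \<open>rho\<close> is at least a constant times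
      \<open>rho a\<close>. Cauchy's inequality therefore costs only the power
      \<open>rho a powr (- real N)\<close> beyond the pointwise growth of \<open>F\<close>.\<close>
    define r where "r = (1 - cmod a) / 2"
    have r: "0 < r" "rho a \<le> 4 * r" using a rho_bounds(2)[OF a] by (auto simp: r_def)
    have Fhol: "F holomorphic_on unit_disk" unfolding F_def by (rule bergman_spaceD[OF Ts])
    have inD: "w \<in> unit_disk \<and> r \<le> 1 - cmod w" if "w \<in> cball a r" for w
    proof -
      have "cmod w \<le> cmod a + cmod (w - a)" using norm_triangle_sub by blast
      then have "cmod w \<le> cmod a + r" using that by (simp add: dist_norm norm_minus_commute)
      then show ?thesis using r(1) by (simp add: r_def field_simps)
    qed
    have sub: "cball a r \<subseteq> unit_disk" using inD by blast
    have bd: "cmod (F w) \<le> C1 * (4 powr (\<gamma> / q) * rho a powr (- (\<gamma> / q))) * n" if w: "w \<in> cball a r" for w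
    proof -
      have wd: "w \<in> unit_disk" "r \<le> 1 - cmod w" using inD[OF w] by auto
      have "rho a / 4 \<le> rho w" using r rho_bounds(1)[OF wd(1)] wd(2) by linarith
      then have "rho w powr (- (\<gamma> / q)) \<le> (rho a / 4) powr (- (\<gamma> / q))"
        using ra \<gamma> q by (intro powr_mono2') auto
      also have "\<dots> = 4 powr (\<gamma> / q) * rho a powr (- (\<gamma> / q))"
        using ra unfolding powr_minus by (simp add: powr_divide field_simps)
      finally have "C1 * rho w powr (- (\<gamma> / q)) * n \<le> C1 * (4 powr (\<gamma> / q) * rho a powr (- (\<gamma> / q))) * n"
        using C1(1) n0 by (intro mult_right_mono mult_left_mono) auto
      moreover have "cmod (F w) \<le> C1 * rho w powr (- (\<gamma> / q)) * n"
        unfolding n_def \<gamma>_def using Ts by (intro C1(2) wd) (simp add: F_def)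
      ultimately show ?thesis by linarith
    qed
    have "cmod ((deriv ^^ N) F a) \<le> fact N * (C1 * (4 powr (\<gamma> / q) * rho a powr (- (\<gamma> / q))) * n) / r ^ N"
    proof (rule Cauchy_inequality)
      show "F holomorphic_on ball a r" using sub by (intro holomorphic_on_subset[OF Fhol]) auto
      show "continuous_on (cball a r) F" using sub by (intro holomorphic_on_imp_continuous_on holomorphic_on_subset[OF Fhol])
      show "cmod (F x) \<le> C1 * (4 powr (\<gamma> / q) * rho a powr (- (\<gamma> / q))) * n" if "cmod (a - x) = r" for x
        using that by (intro bd) (simp add: dist_norm)
    qed (rule r)
    also have "\<dots> \<le> fact N * (C1 * (4 powr (\<gamma> / q) * rho a powr (- (\<gamma> / q))) * n) / (rho a / 4) ^ N"
      using r ra C1(1) n0 by (intro divide_left_mono power_mono mult_pos_pos mult_nonneg_nonneg zero_less_power) auto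
    also have "\<dots> = E * (rho a powr (- (\<gamma> / q)) * rho a powr (- real N)) * n"
    proof -
      have "inverse ((rho a / 4) ^ N) = 4 ^ N * rho a powr (- real N)"
        using ra by (simp add: power_divide powr_minus powr_realpow field_simps)
      then show ?thesis
        unfolding divide_inverse[of _ "(rho a / 4) ^ N"] E_def by (simp only: mult_ac)
    qed
    also have "rho a powr (- (\<gamma> / q)) * rho a powr (- real N) = rho a powr (- (\<gamma> / q) - real N)"
      unfolding powr_add[symmetric] by (rule arg_cong) simp
    finally have "P * (rho a powr \<kappa> * Q) \<le> E * rho a powr (- (\<gamma> / q) - real N) * n"
      using toeplitz_test_fun_deriv[OF \<mu> a \<beta> B int] by (simp only: F_def Q_def P_def \<gamma>_def)
    then have "rho a powr (- \<kappa>) * (P * (rho a powr \<kappa> * Q)) \<le> rho a powr (- \<kappa>) * (E * rho a powr (- (\<gamma> / q) - real N) * n)"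
      by (rule mult_left_mono) simp
    moreover have "rho a powr (- \<kappa>) * (P * (rho a powr \<kappa> * Q)) = P * Q"
      using ra by (simp add: powr_minus)
    moreover have "rho a powr (- \<kappa>) * (E * rho a powr (- (\<gamma> / q) - real N) * n) = E * (rho a powr (A - 2 * B) * n)"
    proof -
      have "- \<kappa> + (- (\<gamma> / q) - real N) = A - 2 * B"
        unfolding A B \<gamma>_def using q by (simp add: field_simps)
      then have "rho a powr (- \<kappa>) * rho a powr (- (\<gamma> / q) - real N) = rho a powr (A - 2 * B)"
        unfolding powr_add[symmetric] by (simp only:)
      then show ?thesis by (simp add: mult_ac)
    qed
    ultimately have "P * Q \<le> E * (rho a powr (A - 2 * B) * n)" by (simp only:)
    then have Qle: "Q \<le> E / P * (rho a powr (A - 2 * B) * n)"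
      using P by (simp add: field_simps)
    have id\<mu>: "(\<lambda>w. w) \<in> borel_measurable \<mu>" using \<mu> by (rule disk_measure_measurable) simp
    have Qm: "(\<lambda>w. cmod w ^ (2 * N) * kern (- (2 * B)) w a) \<in> borel_measurable \<mu>"
      by (rule disk_measure_measurable[OF \<mu>]) measurable
    have Qint: "integrable \<mu> (\<lambda>w. cmod w ^ (2 * N) * kern (- (2 * B)) w a)"
    proof (rule integrable_const_bound[where B="(1 - cmod a) powr (- (2 * B))", OF _ Qm], rule AE_I2)
      fix w assume "w \<in> space \<mu>"
      then have w: "w \<in> unit_disk" by (simp add: space_disk_measure[OF \<mu>])
      have "kern (- (2 * B)) w a \<le> (1 - cmod a) powr (- (2 * B))"
        using kernel_lower_bound(2)[OF w a] a B1 by (intro powr_mono2') auto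
      then have "cmod w ^ (2 * N) * kern (- (2 * B)) w a \<le> 1 * (1 - cmod a) powr (- (2 * B))"
        using w by (intro mult_mono power_le_one) auto
      then show "norm (cmod w ^ (2 * N) * kern (- (2 * B)) w a) \<le> (1 - cmod a) powr (- (2 * B))"
        by simp
    qed
    have "(\<integral>\<^sup>+w. ennreal (kern (- (2 * B)) w a) \<partial>\<mu>)
        \<le> (\<integral>\<^sup>+w. ennreal (4 ^ N) * ennreal (cmod w ^ (2 * N) * kern (- (2 * B)) w a) + ennreal (2 powr (2 * B)) \<partial>\<mu>)"
    proof (rule nn_integral_mono)
      fix w assume "w \<in> space \<mu>"
      then have w: "w \<in> unit_disk" by (simp add: space_disk_measure[OF \<mu>])
      \<comment> \<open>Where \<open>cmod w \<ge> 1 / 2\<close>, the factor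
        \<open>cmod w ^ (2 * N)\<close> costs at most \<open>4 ^ N\<close>; on the inner disk the
        kernel itself is bounded, which accounts for the additive constant.\<close>
      have "kern (- (2 * B)) w a
          \<le> 4 ^ N * (cmod w ^ (2 * N) * kern (- (2 * B)) w a) + 2 powr (2 * B)"
      proof (cases "1 / 2 \<le> cmod w")
        case True
        have "(1 / 2) ^ (2 * N) \<le> cmod w ^ (2 * N)" using True by (intro power_mono) auto
        then have "4 ^ N * (1 / 2) ^ (2 * N) \<le> 4 ^ N * cmod w ^ (2 * N)" by (intro mult_left_mono) auto
        moreover have "(4::real) ^ N * (1 / 2) ^ (2 * N) = 1"
          by (simp add: power_mult power2_eq_square power_divide)
        ultimately have "1 * kern (- (2 * B)) w a \<le> 4 ^ N * cmod w ^ (2 * N) * kern (- (2 * B)) w a"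
          by (intro mult_right_mono) auto
        then show ?thesis by (simp add: mult.assoc add_increasing2)
      next
        case False
        have "1 / 2 \<le> cmod (1 - w * cnj a)" using kernel_lower_bound(1)[OF w a] False by simp
        then have "kern (- (2 * B)) w a \<le> (1 / 2) powr (- (2 * B))"
          using B1 by (intro powr_mono2') auto
        also have "\<dots> = 2 powr (2 * B)" unfolding powr_minus by (simp add: powr_divide)
        finally show ?thesis by (simp add: add_increasing)
      qed
      then show "ennreal (kern (- (2 * B)) w a)
          \<le> ennreal (4 ^ N) * ennreal (cmod w ^ (2 * N) * kern (- (2 * B)) w a) + ennreal (2 powr (2 * B))"
        by (simp add: ennreal_mult[symmetric] ennreal_plus[symmetric] ennreal_leI del: ennreal_plus)
    qed
    also have "\<dots> = ennreal (4 ^ N) * (\<integral>\<^sup>+w. ennreal (cmod w ^ (2 * N) * kern (- (2 * B)) w a) \<partial>\<mu>)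
        + ennreal (2 powr (2 * B)) * emeasure \<mu> (space \<mu>)"
      by (simp only: nn_integral_add nn_integral_cmult nn_integral_const measurable_compose[OF Qm measurable_ennreal]
          borel_measurable_const borel_measurable_times_ennreal)
    also have "(\<integral>\<^sup>+w. ennreal (cmod w ^ (2 * N) * kern (- (2 * B)) w a) \<partial>\<mu>) = ennreal Q"
      unfolding Q_def by (rule nn_integral_eq_integral[OF Qint]) simp
    also have "ennreal (4 ^ N) * ennreal Q + ennreal (2 powr (2 * B)) * emeasure \<mu> (space \<mu>)
        = ennreal (4 ^ N * Q + 2 powr (2 * B) * measure \<mu> (space \<mu>))"
    proof -
      have "0 \<le> Q" unfolding Q_def by (intro Bochner_Integration.integral_nonneg) auto
      then show ?thesis
        by (simp add: emeasure_eq_measure ennreal_mult[symmetric] ennreal_plus[symmetric] del: ennreal_plus)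
    qed
    also have "\<dots> \<le> ennreal (C * rho a powr (A - 2 * B) * n + C)"
    proof (rule ennreal_leI)
      have "4 ^ N * Q \<le> 4 ^ N * (E / P * (rho a powr (A - 2 * B) * n))"
        by (rule mult_left_mono[OF Qle]) simp
      also have "\<dots> = 4 ^ N * (E / P) * (rho a powr (A - 2 * B) * n)" by (simp only: mult_ac)
      also have "\<dots> \<le> C * (rho a powr (A - 2 * B) * n)"
        using n0 by (intro mult_right_mono) (auto simp: C_def)
      finally have "4 ^ N * Q \<le> C * rho a powr (A - 2 * B) * n" by (simp only: mult.assoc)
      moreover have "2 powr (2 * B) * measure \<mu> (space \<mu>) \<le> C" using EP by (simp add: C_def)
      ultimately show "4 ^ N * Q + 2 powr (2 * B) * measure \<mu> (space \<mu>) \<le> C * rho a powr (A - 2 * B) * n + C"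
        by (rule add_mono)
    qed
    finally show "(\<integral>\<^sup>+w. ennreal (kern (- (2 * B)) w a) \<partial>\<mu>)
      \<le> ennreal (C * rho a powr (A - 2 * B) * bergman_norm q \<beta> (toeplitz \<mu> \<beta> (test_fun N B \<kappa> a)) + C)"
      by (simp only: n_def F_def)
  qed
qed

text \<open>The weight \<open>rho powr (- \<sigma>)\<close> tends to infinity at the circle. A bound
  on the weighted integrals thus makes the unweighted ones uniformly small outside the compact set
  \<open>K\<close>, and on \<open>K\<close> the convergence is uniform.\<close>

lemma weighted_L1_bounded_imp_L1_null:
  assumes \<mu>: "finite_borel_measure_on_disk \<mu>" and \<sigma>: "0 < \<sigma>"
    and I: "\<And>n. (\<integral>\<^sup>+w. ennreal (cmod (f n w) * rho w powr (- \<sigma>)) \<partial>\<mu>) \<le> ennreal L" and L: "0 \<le> L"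
    and f: "\<And>n. f n \<in> borel_measurable \<mu>" "locally_uniformly_null f"
  shows "(\<lambda>n. \<integral>\<^sup>+w. ennreal (cmod (f n w)) \<partial>\<mu>) \<longlonglongrightarrow> 0"
proof (rule tendsto_zero_ennreal)
  fix \<epsilon> :: real assume \<epsilon>: "0 < \<epsilon>"
  interpret finite_measure \<mu> using \<mu> by (simp add: finite_borel_measure_on_disk_def)
  define k where "k = L + 1"
  have k: "0 < k" using L by (simp add: k_def)
  define \<delta> where "\<delta> = \<epsilon> / (4 * k)"
  have \<delta>: "0 < \<delta>" using \<epsilon> k by (simp add: \<delta>_def)
  have "\<delta> * k = \<epsilon> / 4" using k by (simp add: \<delta>_def)
  then have \<delta>L: "\<delta> * L \<le> \<epsilon> / 4" using \<delta> by (simp add: k_def distrib_left)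
  define x where "x = \<delta> powr (1 / \<sigma>)"
  have x: "0 < x" "x powr \<sigma> = \<delta>" using \<delta> \<sigma> by (simp_all add: x_def powr_powr)
  define K where "K = {w. x \<le> rho w}"
  have KD: "K \<subseteq> unit_disk"
  proof
    fix w assume "w \<in> K"
    then have "(cmod w)\<^sup>2 < 1" using x by (simp add: K_def rho_def)
    then show "w \<in> unit_disk" by (simp add: abs_square_less_1)
  qed
  have "closed K" unfolding K_def rho_def by (intro closed_Collect_le continuous_intros)
  moreover have "bounded K" using KD bounded_ball bounded_subset by blast
  ultimately have K: "compact K" by (simp add: compact_eq_bounded_closed)
  define l where "l = measure \<mu> (space \<mu>) + 1"
  have l: "0 < l" by (simp add: l_def add_nonneg_pos)
  define b where "b = \<epsilon> / (4 * l)"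
  have b: "0 < b" using \<epsilon> l by (simp add: b_def)
  have "b * l = \<epsilon> / 4" using l by (simp add: b_def)
  then have bm: "b * measure \<mu> (space \<mu>) \<le> \<epsilon> / 4" using b by (simp add: l_def distrib_left)
  have "uniform_limit K f (\<lambda>_. 0) sequentially"
    using f(2) K KD unfolding locally_uniformly_null_def by blast
  from uniform_limitD[OF this b]
  show "\<forall>\<^sub>F n in sequentially. (\<integral>\<^sup>+w. ennreal (cmod (f n w)) \<partial>\<mu>) < ennreal \<epsilon>"
  proof eventually_elim
    case (elim n)
    have "(\<integral>\<^sup>+w. ennreal (cmod (f n w)) \<partial>\<mu>)
        \<le> (\<integral>\<^sup>+w. ennreal \<delta> * ennreal (cmod (f n w) * rho w powr (- \<sigma>)) + ennreal b \<partial>\<mu>)"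
    proof (rule nn_integral_mono)
      fix w assume "w \<in> space \<mu>"
      then have w: "w \<in> unit_disk" by (simp add: space_disk_measure[OF \<mu>])
      have rw: "0 < rho w" by (rule rho_pos[OF w])
      have "cmod (f n w) \<le> \<delta> * (cmod (f n w) * rho w powr (- \<sigma>)) + b"
      proof (cases "w \<in> K")
        case True
        then have "cmod (f n w) \<le> b" using elim by (auto intro: less_imp_le)
        then show ?thesis using \<delta> by (simp add: add_increasing)
      next
        case False
        then have "x powr (- \<sigma>) \<le> rho w powr (- \<sigma>)"
          using rw \<sigma> by (intro powr_mono2') (auto simp: K_def)
        then have "\<delta> * x powr (- \<sigma>) \<le> \<delta> * rho w powr (- \<sigma>)" using \<delta> by (intro mult_left_mono) auto
        moreover have "\<delta> * x powr (- \<sigma>) = 1" using x \<delta> by (simp add: powr_minus)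
        ultimately have "cmod (f n w) * 1 \<le> cmod (f n w) * (\<delta> * rho w powr (- \<sigma>))"
          by (intro mult_left_mono) auto
        then show ?thesis using b by (simp add: mult_ac)
      qed
      then show "ennreal (cmod (f n w)) \<le> ennreal \<delta> * ennreal (cmod (f n w) * rho w powr (- \<sigma>)) + ennreal b"
        using \<delta> b by (simp add: ennreal_mult[symmetric] ennreal_plus[symmetric] ennreal_leI del: ennreal_plus)
    qed
    also have "\<dots> = ennreal \<delta> * (\<integral>\<^sup>+w. ennreal (cmod (f n w) * rho w powr (- \<sigma>)) \<partial>\<mu>) + ennreal b * emeasure \<mu> (space \<mu>)"
    proof -
      have m: "(\<lambda>w. ennreal (cmod (f n w) * rho w powr (- \<sigma>))) \<in> borel_measurable \<mu>"
        using measurable_compose[OF measurable_bergman_integrand[OF \<mu> f(1)[of n], of 1] measurable_ennreal] by simp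
      show ?thesis
        by (simp only: nn_integral_add nn_integral_cmult nn_integral_const m borel_measurable_const borel_measurable_times_ennreal)
    qed
    also have "\<dots> \<le> ennreal \<delta> * ennreal L + ennreal (b * measure \<mu> (space \<mu>))"
      using b by (intro add_mono mult_left_mono I) (simp_all add: emeasure_eq_measure ennreal_mult)
    also have "\<dots> = ennreal (\<delta> * L + b * measure \<mu> (space \<mu>))"
      using \<delta> b L by (simp add: ennreal_mult[symmetric] ennreal_plus[symmetric] del: ennreal_plus)
    also have "\<dots> \<le> ennreal (\<epsilon> / 2)" using \<delta>L bm by (intro ennreal_leI) simp
    also have "\<dots> < ennreal \<epsilon>" using \<epsilon> by (intro ennreal_lessI) auto
    finally show ?case .
  qed
qed

text \<open>Point evaluations are bounded on the Bergman space, so the limit in norm can be computed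
  point by point.\<close>

lemma bergman_norm_limit_pointwise:
  assumes q: "0 < q" and \<beta>: "-1 < \<beta>" and h: "\<And>n. h n \<in> bergman_space q \<beta>" and g: "g \<in> bergman_space q \<beta>"
    and lim: "(\<lambda>n. bergman_norm q \<beta> (\<lambda>z. h n z - g z)) \<longlonglongrightarrow> 0" and z: "z \<in> unit_disk"
  shows "(\<lambda>n. h n z) \<longlonglongrightarrow> g z"
proof -
  obtain C where C: "\<And>f w. f \<in> bergman_space q \<beta> \<Longrightarrow> w \<in> unit_disk \<Longrightarrow>
    cmod (f w) \<le> C * rho w powr (- ((2 + \<beta>) / q)) * bergman_norm q \<beta> f"
    using bergman_pointwise_norm[OF q \<beta>] by blast
  have "(\<lambda>n. h n z - g z) \<longlonglongrightarrow> 0"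
  proof (rule Lim_null_comparison)
    show "\<forall>\<^sub>F n in sequentially. norm (h n z - g z) \<le> C * rho z powr (- ((2 + \<beta>) / q)) * bergman_norm q \<beta> (\<lambda>z. h n z - g z)"
      by (intro always_eventually allI C bergman_diff(1) h g q \<beta> z)
    show "(\<lambda>n. C * rho z powr (- ((2 + \<beta>) / q)) * bergman_norm q \<beta> (\<lambda>z. h n z - g z)) \<longlonglongrightarrow> 0"
      using tendsto_mult_left[OF lim, of "C * rho z powr (- ((2 + \<beta>) / q))"] by simp
  qed
  then show ?thesis by (rule LIM_zero_cancel)
qed

text \<open>For \<open>p = 1\<close> compactness only yields a convergent subsequence of the images. Its limit is 0
  because boundedness of the operator already gives the bounded form of the kernel condition, and
  with it the convergence of the integrals against \<open>\<mu>\<close>.\<close>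

lemma toeplitz_compact_imp_kernel_vanishing:
  assumes p: "0 < p" "p \<le> 1" and q: "1 < q" and \<alpha>: "-1 < \<alpha>" and \<beta>: "-1 < \<beta>"
    and \<sigma>: "\<sigma> = (2 + \<beta>) * (1 - 1 / q)" and A: "A = (2 + \<alpha>) / p + \<sigma>"
    and \<mu>: "finite_borel_measure_on_disk \<mu>" and compact: "toeplitz_compact \<mu> p \<alpha> q \<beta>"
  shows "\<exists>c>0. A < c \<and> kernel_vanishing \<mu> c A"
proof -
  let ?Np = "bergman_norm p \<alpha>"
  let ?Nq = "bergman_norm q \<beta>"
  let ?Sq = "bergman_space q \<beta>"
  let ?Text = "toeplitz_ext \<mu> p \<alpha> q \<beta>"
  let ?T = "toeplitz \<mu> \<beta>"
  have q0: "0 < q" using q by simp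
  have bdd: "toeplitz_bounded \<mu> p \<alpha> q \<beta>" using compact by (simp add: toeplitz_compact_def)
  \<comment> \<open>This size of \<open>N\<close> gives \<open>B * p > 2 + \<alpha>\<close>, needed
    for bounded test functions, and \<open>\<kappa> > 2 + \<beta> > \<sigma>\<close>, whence
    \<open>A = B - \<kappa> + \<sigma>\<close> stays below the kernel exponent
    \<open>2 * B\<close>.\<close>
  obtain N :: nat where N: "(2 + \<alpha>) / p < real N" using reals_Archimedean2 by blast
  define B where "B = 2 + \<beta> + real N"
  define \<kappa> where "\<kappa> = B - (2 + \<alpha>) / p"
  have \<kappa>: "0 < \<kappa>" "2 + \<beta> < \<kappa>" using N \<beta> by (auto simp: \<kappa>_def B_def)
  have "(2 + \<alpha>) / p < B" using N \<beta> by (simp add: B_def)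
  then have Bp: "2 + \<alpha> < B * p" using p by (simp add: pos_divide_less_eq)
  have \<sigma>0: "0 < \<sigma>" "\<sigma> < 2 + \<beta>"
  proof -
    show "0 < \<sigma>" unfolding \<sigma> using q \<beta> by (intro mult_pos_pos) auto
    have "(2 + \<beta>) * (1 - 1 / q) < (2 + \<beta>) * 1" using q \<beta> by (intro mult_strict_left_mono) auto
    then show "\<sigma> < 2 + \<beta>" by (simp add: \<sigma>)
  qed
  have B0: "0 < B" "2 + \<beta> \<le> B" using \<beta> by (auto simp: B_def)
  have A': "A = B - \<kappa> + (2 + \<beta>) * (1 - 1 / q)" by (simp add: A \<sigma> \<kappa>_def)
  have Ac: "A < 2 * B"
  proof -
    have "A = B - \<kappa> + \<sigma>" using A' \<sigma> by simp
    then show ?thesis using \<sigma>0 \<kappa> B0 by linarith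
  qed
  define F where "F a = test_fun N B \<kappa> a" for a
  obtain M where M: "0 \<le> M" "\<And>a. a \<in> unit_disk \<Longrightarrow> F a \<in> bergman_space p \<alpha>" "\<And>a. a \<in> unit_disk \<Longrightarrow> ?Np (F a) \<le> M"
    using test_fun_bounded[OF p(1) \<alpha> Bp \<kappa>_def, of N] unfolding F_def by blast
  obtain D where D: "0 \<le> D" "\<And>R f. 1 < R \<Longrightarrow> f holomorphic_on ball 0 R \<Longrightarrow> integrable \<mu> f \<and>
    ?T f \<in> ?Sq \<and> ?Nq (?T f) \<le> D * ?Np f \<and>
    ?Text f \<in> ?Sq \<and>
    (AE z in disk_area. ?Text f z = ?T f z)"
    using toeplitz_bounded_extension[OF p(1) q0 \<alpha> \<beta> \<mu> bdd] by blast
  have FT: "integrable \<mu> (F a)" "?T (F a) \<in> ?Sq"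
    "?Nq (?T (F a)) \<le> D * M"
    "?Text (F a) \<in> ?Sq"
    "AE z in disk_area. ?Text (F a) z = ?T (F a) z"
    if a: "a \<in> unit_disk" for a
  proof -
    note T = D(2)[OF test_fun_holomorphic(2,1)[OF a], of N B \<kappa>, folded F_def]
    then show "integrable \<mu> (F a)" "?T (F a) \<in> ?Sq"
      "?Text (F a) \<in> ?Sq"
      "AE z in disk_area. ?Text (F a) z = ?T (F a) z" by auto
    have "D * ?Np (F a) \<le> D * M" by (intro mult_left_mono M(3) a D(1))
    then show "?Nq (?T (F a)) \<le> D * M" using T by linarith
  qed
  obtain C where C: "C > 0" "\<And>a. a \<in> unit_disk \<Longrightarrow>
    (\<integral>\<^sup>+w. ennreal (kern (- (2 * B)) w a) \<partial>\<mu>)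
    \<le> ennreal (C * rho a powr (A - 2 * B) * ?Nq (?T (F a)) + C)"
    using kernel_integral_le_toeplitz_norm[OF q \<beta> \<mu> B_def A'] FT unfolding F_def by blast
  \<comment> \<open>The images of the test functions have bounded norm. As \<open>A < 2 * B\<close>,
    the power of \<open>rho a\<close> is at least 1 and takes up the additive constant.\<close>
  have kb: "kernel_bounded \<mu> (2 * B) A (C * (D * M) + C)"
    unfolding kernel_bounded_def
  proof (intro conjI ballI)
    show "0 \<le> C * (D * M) + C" using C(1) D(1) M(1) by simp
    fix a :: complex assume a: "a \<in> unit_disk"
    have "1 powr (A - 2 * B) \<le> rho a powr (A - 2 * B)"
      using Ac rho_pos[OF a] rho_le_1[of a] by (intro powr_mono2') auto
    then have "C * 1 \<le> C * rho a powr (A - 2 * B)" using C(1) by (intro mult_left_mono) auto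
    moreover have "C * rho a powr (A - 2 * B) * ?Nq (?T (F a)) \<le> C * rho a powr (A - 2 * B) * (D * M)"
      using C(1) by (intro mult_left_mono FT(3) a) auto
    ultimately have "C * rho a powr (A - 2 * B) * ?Nq (?T (F a)) + C
        \<le> C * rho a powr (A - 2 * B) * (D * M) + C * rho a powr (A - 2 * B)" by simp
    also have "\<dots> = (C * (D * M) + C) * rho a powr (A - 2 * B)" by (simp only: distrib_right mult_ac)
    finally show "(\<integral>\<^sup>+w. ennreal (kern (- (2 * B)) w a) \<partial>\<mu>) \<le> ennreal ((C * (D * M) + C) * rho a powr (A - 2 * B))"
      by (intro order_trans[OF C(2)[OF a]] ennreal_leI)
  qed
  have "kernel_vanishing \<mu> (2 * B) A"
  proof (rule ccontr)
    assume "\<not> kernel_vanishing \<mu> (2 * B) A"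
    then obtain e a where e: "0 < e" and a: "\<And>n. a n \<in> unit_disk" "(\<lambda>n. rho (a n)) \<longlonglongrightarrow> 0"
      and gt: "\<And>n. ennreal (e * rho (a n) powr (A - 2 * B))
        < (\<integral>\<^sup>+w. ennreal (kern (- (2 * B)) w (a n)) \<partial>\<mu>)"
      using ex_sequence_not_kernel_vanishing[of \<mu> "2 * B" A] by blast
    define f where "f n = F (a n)" for n
    have f: "bergman_bounded_seq p \<alpha> f"
      unfolding bergman_bounded_seq_def f_def using M a(1) by blast
    have fnull: "locally_uniformly_null f"
      unfolding f_def F_def by (intro test_fun_null a \<kappa> B0)
    have "\<exists>r. strict_mono (r :: nat \<Rightarrow> nat) \<and> (\<lambda>n. ?Nq (?T (f (r n)))) \<longlonglongrightarrow> 0"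
    proof (cases "1 \<le> p")
      case False
      then have "(\<lambda>n. ?Nq (?Text (f n))) \<longlonglongrightarrow> 0"
        using compact f fnull by (simp add: toeplitz_compact_def)
      moreover have "?Nq (?Text (f n)) = ?Nq (?T (f n))" for n
        unfolding f_def using FT[OF a(1)[of n]]
        by (intro bergman_norm_cong_AE \<beta> measurable_disk_area_holomorphic) (auto intro: bergman_spaceD)
      ultimately show ?thesis by (intro exI[of _ id]) (simp add: strict_mono_id)
    next
      case True
      then obtain r g where r: "strict_mono (r :: nat \<Rightarrow> nat)" and g: "g \<in> ?Sq"
        and lim: "(\<lambda>n. ?Nq (\<lambda>z. ?Text (f (r n)) z - g z)) \<longlonglongrightarrow> 0"
        using compact f unfolding toeplitz_compact_def by (simp only: if_True) blast
      have fT: "?T (f n) \<in> ?Sq" "integrable \<mu> (f n)" for n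
        unfolding f_def using FT[OF a(1)[of n]] by auto
      have "?Nq (\<lambda>z. ?Text (f (r n)) z - g z)
          = ?Nq (\<lambda>z. ?T (f (r n)) z - g z)" for n
        unfolding f_def using FT[OF a(1)[of "r n"]] \<beta>
        by (intro bergman_norm_ext_diff measurable_disk_area_holomorphic bergman_spaceD[OF g]) auto
      then have lim2: "(\<lambda>n. ?Nq (\<lambda>z. ?T (f (r n)) z - g z)) \<longlonglongrightarrow> 0"
        using lim by simp
      have B2: "0 < 2 * B" using B0 by simp
      obtain E where E: "0 \<le> E" "\<And>f. f \<in> bergman_space p \<alpha> \<Longrightarrow>
        (\<integral>\<^sup>+w. ennreal (cmod (f w) * rho w powr (- \<sigma>)) \<partial>\<mu>) \<le> ennreal (E * ?Np f)"
        using toeplitz_operator_bound[OF p q \<alpha> \<beta> B2 \<sigma> A \<mu> kb] by blast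
      have I: "(\<integral>\<^sup>+w. ennreal (cmod (f n w) * rho w powr (- \<sigma>)) \<partial>\<mu>) \<le> ennreal (E * M)" for n
        unfolding f_def using E(1) M a(1)
        by (intro order_trans[OF E(2)] ennreal_leI mult_left_mono) auto
      have L1: "(\<lambda>n. \<integral>\<^sup>+w. ennreal (cmod (f n w)) \<partial>\<mu>) \<longlonglongrightarrow> 0"
        using E(1) M(1) fT(2) by (intro weighted_L1_bounded_imp_L1_null[OF \<mu> \<sigma>0(1) I _ _ fnull]) auto
      \<comment> \<open>The images tend to 0 pointwise by the convergence in \<open>L^1\<close>,
        while convergence in norm makes them tend to \<open>g\<close> pointwise along the
        subsequence.\<close>
      have g0: "g z = 0" if z: "z \<in> unit_disk" for z
      proof -
        have "(\<lambda>n. ?T (f n) z) \<longlonglongrightarrow> 0"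
        proof (rule tendstoI)
          fix \<epsilon> :: real assume \<epsilon>: "0 < \<epsilon>"
          define k where "k = (1 - cmod z) powr (- (2 + \<beta>))"
          have k: "0 < k" using z by (simp add: k_def)
          have \<beta>2: "-2 < \<beta>" using \<beta> by simp
          have "\<forall>\<^sub>F n in sequentially. (\<integral>\<^sup>+w. ennreal (cmod (f n w)) \<partial>\<mu>) < ennreal (\<epsilon> / (2 * k))"
            using \<epsilon> k by (intro order_tendstoD(2)[OF L1]) auto
          then show "\<forall>\<^sub>F n in sequentially. dist (?T (f n) z) 0 < \<epsilon>"
          proof eventually_elim
            case (elim n)
            have "ennreal (cmod (?T (f n) z)) \<le> ennreal k * (\<integral>\<^sup>+w. ennreal (cmod (f n w)) \<partial>\<mu>)"
              unfolding k_def by (rule cmod_toeplitz_le_L1[OF \<mu> borel_measurable_integrable[OF fT(2)] z \<beta>2])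
            also have "\<dots> \<le> ennreal k * ennreal (\<epsilon> / (2 * k))" using elim by (intro mult_left_mono) auto
            also have "\<dots> = ennreal (\<epsilon> / 2)" using k \<epsilon> by (simp add: ennreal_mult[symmetric])
            finally have "cmod (?T (f n) z) \<le> \<epsilon> / 2" using \<epsilon> by simp
            then show ?case using \<epsilon> by simp
          qed
        qed
        then have "(\<lambda>n. ?T (f (r n)) z) \<longlonglongrightarrow> 0"
          using LIMSEQ_subseq_LIMSEQ[OF _ r, of "\<lambda>n. ?T (f n) z"] by (simp add: o_def)
        moreover have "(\<lambda>n. ?T (f (r n)) z) \<longlonglongrightarrow> g z"
          by (rule bergman_norm_limit_pointwise[OF q0 \<beta> fT(1) g lim2 z])
        ultimately show ?thesis using LIMSEQ_unique by blast
      qed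
      have "?Nq (\<lambda>z. ?T (f (r n)) z - g z) = ?Nq (?T (f (r n)))" for n
        using g0 by (intro bergman_norm_cong_AE \<beta> borel_measurable_diff measurable_disk_area_holomorphic
            bergman_spaceD[OF fT(1)] bergman_spaceD[OF g] AE_I2) auto
      then show ?thesis using lim2 r by auto
    qed
    then obtain r where r: "strict_mono (r :: nat \<Rightarrow> nat)"
      and lim: "(\<lambda>n. ?Nq (?T (f (r n)))) \<longlonglongrightarrow> 0" by blast
    \<comment> \<open>The failure of the condition is divided by
      \<open>rho (a n) powr (A - 2 * B)\<close>. Along the subsequence both terms on the right then
      tend to 0, the second because \<open>A < 2 * B\<close>, contradicting
      \<open>0 < e\<close>.\<close>
    have ineq: "e \<le> C * ?Nq (?T (f n)) + C * rho (a n) powr (2 * B - A)" for n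
    proof -
      define X where "X = ?Nq (?T (f n))"
      define R where "R = rho (a n) powr (A - 2 * B)"
      have ra: "0 < rho (a n)" by (rule rho_pos[OF a(1)])
      have X: "0 \<le> X" by (simp add: X_def bergman_norm_nonneg)
      have R: "0 < R" using ra by (simp add: R_def)
      have "ennreal (e * R) < ennreal (C * R * X + C)"
        using less_le_trans[OF gt C(2)[OF a(1)]] by (simp add: R_def X_def f_def)
      then have "e * R \<le> C * R * X + C" using ennreal_less_iff[of "e * R" "C * R * X + C"] R e by (simp del: ennreal_plus)
      moreover have RR: "R * rho (a n) powr (2 * B - A) = 1"
        using ra unfolding R_def powr_add[symmetric] by simp
      ultimately have "R * e \<le> R * (C * X + C * rho (a n) powr (2 * B - A))"
        by (simp add: distrib_left mult.left_commute[of R] mult_ac)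
      then show ?thesis using R by (simp add: X_def)
    qed
    have "(\<lambda>n. rho (a n) powr (2 * B - A)) \<longlonglongrightarrow> 0 powr (2 * B - A)"
      using Ac rho_pos[OF a(1)] by (intro tendsto_powr' a(2) tendsto_const) (auto intro!: always_eventually less_imp_le)
    then have "(\<lambda>n. rho (a n) powr (2 * B - A)) \<longlonglongrightarrow> 0" by simp
    from LIMSEQ_subseq_LIMSEQ[OF this r]
    have "(\<lambda>n. C * ?Nq (?T (f (r n))) + C * rho (a (r n)) powr (2 * B - A)) \<longlonglongrightarrow> C * 0 + C * 0"
      by (intro tendsto_intros lim) (simp add: o_def)
    then have "e \<le> C * 0 + C * 0"
      using ineq by (intro LIMSEQ_le_const) auto
    then show False using e by simp
  qed
  then show ?thesis using Ac B0 by (intro exI[of _ "2 * B"]) simp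
qed

text \<open>The operator and the Carleson property lead to the kernel condition with different
  exponents, \<open>2 * B\<close> and \<open>(3 + \<alpha>) * s\<close>. The converse implications
  accept every positive exponent and every positive one above \<open>A\<close>, respectively for the
  Carleson property and for the operator, so both equivalences close.\<close>

theorem theorem1p4:
  fixes \<mu> :: "complex measure" and p q q' \<alpha> \<beta> t :: real
  assumes "finite_borel_measure_on_disk \<mu>"
    and "0 < p" "p \<le> 1" "1 < q"
    and "-1 < \<beta>" "\<beta> \<le> \<alpha>"
    and "t = (\<beta> + 2) / (\<alpha> + 2)"
    and "1 / q + 1 / q' = 1"
  shows "toeplitz_compact \<mu> p \<alpha> q \<beta> \<longleftrightarrow> vanishing_carleson \<mu> (1 / p + t / q') 1 \<alpha>"
proof -
  have \<alpha>: "-1 < \<alpha>" using assms(5,6) by simp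
  define s where "s = 1 / p + t / q'"
  define \<sigma> where "\<sigma> = (2 + \<beta>) * (1 - 1 / q)"
  define A where "A = (2 + \<alpha>) / p + \<sigma>"
  have q': "1 / q' = 1 - 1 / q" using assms(8) by simp
  have t: "0 \<le> t" using assms(5,7) \<alpha> by simp
  have "t / q' = t * (1 - 1 / q)" using q' by (metis times_divide_eq_right mult_1_right)
  then have s: "s = 1 / p + t * (1 - 1 / q)" by (simp add: s_def)
  have "0 \<le> t * (1 - 1 / q)" using t assms(4) by (intro mult_nonneg_nonneg) auto
  \<comment> \<open>Already \<open>1 / p\<close> is at least 1; the embedding of functions of
    \<open>L^1\<close> with exponent \<open>s\<close> depends on this.\<close>
  then have s1: "1 \<le> s" using assms(2,3) by (simp add: s add_increasing2)
  have "(2 + \<alpha>) * t = 2 + \<beta>" using \<alpha> by (simp add: assms(7) add.commute)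
  then have A_eq: "A = (2 + \<alpha>) * s"
    by (simp add: A_def \<sigma>_def s distrib_left mult.assoc[symmetric])
  have s0: "0 < s" using s1 by simp
  have "toeplitz_compact \<mu> p \<alpha> q \<beta> \<longleftrightarrow> vanishing_carleson \<mu> s 1 \<alpha>"
  proof
    assume "toeplitz_compact \<mu> p \<alpha> q \<beta>"
    from toeplitz_compact_imp_kernel_vanishing[OF assms(2-4) \<alpha> assms(5) \<sigma>_def A_def assms(1) this]
    obtain c where "c > 0" "kernel_vanishing \<mu> c A" by blast
    then show "vanishing_carleson \<mu> s 1 \<alpha>"
      using kernel_vanishing_imp_vanishing_carleson[OF \<alpha> s1 _ assms(1)] by (simp add: A_eq)
  next
    assume "vanishing_carleson \<mu> s 1 \<alpha>"
    then have v: "kernel_vanishing \<mu> ((3 + \<alpha>) * s) A"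
      unfolding A_eq by (rule vanishing_carleson_imp_kernel_vanishing[OF \<alpha> s0 assms(1)])
    have "A < (3 + \<alpha>) * s" using s0 by (simp add: A_eq)
    moreover have "0 < (3 + \<alpha>) * s" using s0 \<alpha> by (intro mult_pos_pos) auto
    ultimately show "toeplitz_compact \<mu> p \<alpha> q \<beta>"
      using kernel_vanishing_imp_toeplitz_compact[OF assms(2-4) \<alpha> assms(5) _ _ \<sigma>_def A_def assms(1) v] by simp
  qed
  then show ?thesis by (simp only: s_def)
qed

end
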